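(* Let $b$ be a non-extreme point of the closed unit ball of $H^\infty$ and let $\varphi\in H^\infty$. Then the operator $T_{\overline{\varphi}}:\mathcal H(b)\to\mathcal H(b)$, $f\mapsto P_+(\overline{\varphi}f)$, is compact if and only if $\varphi=0$.
   Context: $\mathbb D$ is the open unit disc, $\mathbb T=\partial\mathbb D$ with normalized Lebesgue measure $m$, $H^2$ is the Hardy space of $\mathbb D$ (identified via boundary values with a closed subspace of $L^2(\mathbb T)=L^2(\mathbb T,m)$), and $H^\infty$ is the algebra of bounded analytic functions on $\mathbb D$ with the supremum norm. $P_+:L^2(\mathbb T)\to H^2$ is the orthogonal projection. For $b$ in the closed unit ball of $H^\infty$, the de Branges-Rovnyak space $\mathcal H(b)$ is the Hilbert space of analytic functions on $\mathbb D$ with reproducing kernel $k_\lambda^b(z)=\frac{1-\overline{b(\lambda)}b(z)}{1-\overline{\lambda}z}$, $\lambda,z\in\mathbb D$; it is contractively contained in $H^2$. "Non-extreme" means that $b$ is not an extreme point of the closed unit ball of $H^\infty$; equivalently $\log(1-|b|)\in L^1(\mathbb T)$. For $\varphi\in H^\infty$, the Toeplitz operator $T_{\overline\varphi}f=P_+(\overline\varphi f)$ on $H^2$ maps $\mathcal H(b)$ into itself and is bounded on $\mathcal H(b)$ with norm at most $\|\varphi\|_\infty$. *)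

theory Defs
  imports "HOL-Analysis.Analysis"
begin

section \<open>Analytic functions on the unit disc\<close>

abbreviation unit_disc :: "complex set" where
  "unit_disc \<equiv> ball 0 1"

text \<open>
  Functions on the disc are represented by total functions that vanish off the disc. With this
  normal form, two of them are equal as HOL functions iff they agree on the disc.
\<close>

definition disc_analytic :: "(complex \<Rightarrow> complex) set" where
  "disc_analytic = {f. f holomorphic_on unit_disc \<and> (\<forall>z. z \<notin> unit_disc \<longrightarrow> f z = 0)}"

definition Hinf :: "(complex \<Rightarrow> complex) set" where
  "Hinf = {f \<in> disc_analytic. bounded (f ` unit_disc)}"

definition Hinf_norm :: "(complex \<Rightarrow> complex) \<Rightarrow> real" where
  "Hinf_norm f = (SUP z\<in>unit_disc. cmod (f z))"

definition Hinf_ball :: "(complex \<Rightarrow> complex) set" where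
  "Hinf_ball = {f \<in> Hinf. Hinf_norm f \<le> 1}"

text \<open>
  This is \<open>b extreme_point_of Hinf_ball\<close> with the library definition written out; the library
  constant needs a \<open>real_vector\<close> instance, which the function type does not have.
\<close>

definition extreme_in_Hinf_ball :: "(complex \<Rightarrow> complex) \<Rightarrow> bool" where
  "extreme_in_Hinf_ball b \<longleftrightarrow> b \<in> Hinf_ball \<and>
     (\<forall>f\<in>Hinf_ball. \<forall>g\<in>Hinf_ball.
        \<not> (f \<noteq> g \<and> (\<exists>u::real. 0 < u \<and> u < 1 \<and>
              b = (\<lambda>z. complex_of_real (1 - u) * f z + complex_of_real u * g z))))"


section \<open>The circle, the Hardy space and the Riesz projection\<close>

text \<open>Normalized Lebesgue measure on the unit circle, as a Borel measure on the plane.\<close>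

definition circle_measure :: "complex measure" where
  "circle_measure = distr (uniform_measure lborel {0..<2 * pi}) borel cis"

definition L2_inner :: "(complex \<Rightarrow> complex) \<Rightarrow> (complex \<Rightarrow> complex) \<Rightarrow> complex" where
  "L2_inner h g = (\<integral>\<zeta>. h \<zeta> * cnj (g \<zeta>) \<partial>circle_measure)"

definition H2 :: "(complex \<Rightarrow> complex) set" where
  "H2 = {f \<in> disc_analytic.
     bdd_above ((\<lambda>r::real. \<integral>\<zeta>. (cmod (f (complex_of_real r * \<zeta>)))\<^sup>2 \<partial>circle_measure) ` {0..<1})}"

text \<open>
  Radial boundary values. For functions in \<open>H2\<close> the limit exists almost everywhere on the circle
  (Fatou); at the remaining points \<open>Lim\<close> is an irrelevant constant.
\<close>

definition boundary :: "(complex \<Rightarrow> complex) \<Rightarrow> complex \<Rightarrow> complex" where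
  "boundary f \<zeta> = Lim (at_left (1::real)) (\<lambda>r. f (complex_of_real r * \<zeta>))"

text \<open>
  Orthogonal projection of \<open>h\<close> in \<open>L\<^sup>2\<close> of the circle onto the
  closed subspace of boundary functions of \<open>H2\<close>, returned as a function on the disc.
\<close>

definition riesz_projection :: "(complex \<Rightarrow> complex) \<Rightarrow> complex \<Rightarrow> complex" where
  "riesz_projection h =
     (THE g. g \<in> H2 \<and> (\<forall>u\<in>H2. L2_inner (\<lambda>\<zeta>. h \<zeta> - boundary g \<zeta>) (boundary u) = 0))"

definition conj_toeplitz :: "(complex \<Rightarrow> complex) \<Rightarrow> (complex \<Rightarrow> complex) \<Rightarrow> complex \<Rightarrow> complex" where
  "conj_toeplitz \<phi> f = riesz_projection (\<lambda>\<zeta>. cnj (boundary \<phi> \<zeta>) * boundary f \<zeta>)"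


section \<open>Hilbert spaces of analytic functions\<close>

definition ip_norm ::
  "((complex \<Rightarrow> complex) \<Rightarrow> (complex \<Rightarrow> complex) \<Rightarrow> complex) \<Rightarrow> (complex \<Rightarrow> complex) \<Rightarrow> real" where
  "ip_norm ip f = sqrt (Re (ip f f))"

text \<open>
  A Hilbert space is given by its carrier \<open>H\<close>, with the pointwise vector operations, and an inner
  product \<open>ip\<close>, linear in the first argument; \<open>ip\<close> is only relevant on \<open>H\<close>.
\<close>

locale analytic_hilbert_space =
  fixes H :: "(complex \<Rightarrow> complex) set"
    and ip :: "(complex \<Rightarrow> complex) \<Rightarrow> (complex \<Rightarrow> complex) \<Rightarrow> complex"
  assumes analytic: "H \<subseteq> disc_analytic"
    and zero_mem: "(\<lambda>z. 0) \<in> H"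
    and add_mem: "\<lbrakk>f \<in> H; g \<in> H\<rbrakk> \<Longrightarrow> (\<lambda>z. f z + g z) \<in> H"
    and scale_mem: "f \<in> H \<Longrightarrow> (\<lambda>z. c * f z) \<in> H"
    and ip_add: "\<lbrakk>f \<in> H; g \<in> H; h \<in> H\<rbrakk> \<Longrightarrow> ip (\<lambda>z. f z + g z) h = ip f h + ip g h"
    and ip_scale: "\<lbrakk>f \<in> H; h \<in> H\<rbrakk> \<Longrightarrow> ip (\<lambda>z. c * f z) h = c * ip f h"
    and ip_cnj: "\<lbrakk>f \<in> H; g \<in> H\<rbrakk> \<Longrightarrow> ip g f = cnj (ip f g)"
    and ip_nonneg: "f \<in> H \<Longrightarrow> 0 \<le> Re (ip f f)"
    and ip_definite: "\<lbrakk>f \<in> H; ip f f = 0\<rbrakk> \<Longrightarrow> f = (\<lambda>z. 0)"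
    and complete: "\<lbrakk>\<And>n::nat. X n \<in> H;
        \<And>e. 0 < e \<Longrightarrow> \<exists>N. \<forall>m\<ge>N. \<forall>n\<ge>N. ip_norm ip (\<lambda>z. X m z - X n z) < e\<rbrakk>
        \<Longrightarrow> \<exists>f\<in>H. (\<lambda>n. ip_norm ip (\<lambda>z. X n z - f z)) \<longlonglongrightarrow> 0"

definition reproducing_kernel ::
  "(complex \<Rightarrow> complex) set \<Rightarrow> ((complex \<Rightarrow> complex) \<Rightarrow> (complex \<Rightarrow> complex) \<Rightarrow> complex)
     \<Rightarrow> (complex \<Rightarrow> complex \<Rightarrow> complex) \<Rightarrow> bool" where
  "reproducing_kernel H ip k \<longleftrightarrow>
     (\<forall>w\<in>unit_disc. k w \<in> H \<and> (\<forall>f\<in>H. f w = ip f (k w)))"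

definition dBR_kernel :: "(complex \<Rightarrow> complex) \<Rightarrow> complex \<Rightarrow> complex \<Rightarrow> complex" where
  "dBR_kernel b w z =
     (if z \<in> unit_disc then (1 - cnj (b w) * b z) / (1 - cnj w * z) else 0)"

text \<open>
  \<open>(H, ip)\<close> is the de Branges-Rovnyak space of \<open>b\<close>. For \<open>b \<in> Hinf_ball\<close> such a pair exists, and
  \<open>H\<close> and the values of \<open>ip\<close> on \<open>H\<close> are determined by the kernel (Moore-Aronszajn).
\<close>

definition de_Branges_Rovnyak_space ::
  "(complex \<Rightarrow> complex) \<Rightarrow> (complex \<Rightarrow> complex) set
     \<Rightarrow> ((complex \<Rightarrow> complex) \<Rightarrow> (complex \<Rightarrow> complex) \<Rightarrow> complex) \<Rightarrow> bool" where
  "de_Branges_Rovnyak_space b H ip \<longleftrightarrow>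
     analytic_hilbert_space H ip \<and> reproducing_kernel H ip (dBR_kernel b)"

text \<open>Compact linear operators from \<open>(H, ip)\<close> to itself.\<close>

definition compact_operator_on ::
  "(complex \<Rightarrow> complex) set \<Rightarrow> ((complex \<Rightarrow> complex) \<Rightarrow> (complex \<Rightarrow> complex) \<Rightarrow> complex)
     \<Rightarrow> ((complex \<Rightarrow> complex) \<Rightarrow> (complex \<Rightarrow> complex)) \<Rightarrow> bool" where
  "compact_operator_on H ip T \<longleftrightarrow>
     (\<forall>f\<in>H. T f \<in> H) \<and>
     (\<forall>f\<in>H. \<forall>g\<in>H. T (\<lambda>z. f z + g z) = (\<lambda>z. T f z + T g z)) \<and>
     (\<forall>c. \<forall>f\<in>H. T (\<lambda>z. c * f z) = (\<lambda>z. c * T f z)) \<and>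
     (\<forall>X :: nat \<Rightarrow> complex \<Rightarrow> complex.
        (\<forall>n. X n \<in> H) \<and> (\<exists>C. \<forall>n. ip_norm ip (X n) \<le> C) \<longrightarrow>
        (\<exists>(r :: nat \<Rightarrow> nat) g. strict_mono r \<and> g \<in> H \<and>
            (\<lambda>n. ip_norm ip (\<lambda>z. T (X (r n)) z - g z)) \<longlonglongrightarrow> 0))"

end

theory Submission
  imports Defs "HOL-Complex_Analysis.Complex_Analysis" "HOL-Probability.Probability_Measure"
begin

text \<open>
  The operator \<open>T f = conj_toeplitz \<phi> f\<close> has the Cauchy kernels
  \<open>k\<^sub>w(z) = 1 / (1 - cnj w * z)\<close> as eigenvectors, with eigenvalue \<open>cnj (\<phi> w)\<close>
  (\<open>conj_toeplitz_szego_kernel\<close>). A compact operator cannot have an infinite linearly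
  independent family of eigenvectors whose eigenvalues stay away from 0
  (\<open>not_compact_if_eigenvalues_away_from_0\<close>). So, for \<open>\<phi> \<noteq> 0\<close>, it is enough that
  infinitely many of the kernels \<open>k\<^sub>w\<close> with \<open>\<bar>\<phi> w\<bar> \<ge> \<delta>\<close> belong to the space, and this
  is where \<open>b\<close> being non-extreme is used.

  If \<open>b\<close> is a proper convex combination of two distinct elements of the ball, then there is an analytic
  \<open>h \<noteq> 0\<close> with \<open>\<bar>b\<bar>\<^sup>2 + \<bar>h\<bar>\<^sup>2 \<le> 1\<close> on the disc (\<open>non_extreme_companion\<close>). Let \<open>F\<close> be a
  finite combination \<open>\<Sum>c\<^sub>w k\<^sub>w\<close> and let \<open>G\<close> be the image of \<open>F\<close> under the adjoint of
  multiplication by \<open>b\<close> on the Hardy space. With \<open>k\<^sub>w\<^sup>b\<close> for the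
  reproducing kernels of the space, the element \<open>\<Sum>c\<^sub>w k\<^sub>w\<^sup>b\<close> has square norm
  \<open>\<parallel>F\<parallel>\<^sup>2 - \<parallel>G\<parallel>\<^sup>2 \<ge> \<parallel>F\<parallel>\<^sup>2 - \<parallel>b F\<parallel>\<^sup>2 \<ge> \<parallel>h F\<parallel>\<^sup>2 \<ge> (1 - \<bar>l\<bar>\<^sup>2) * \<bar>h(l) F(l)\<bar>\<^sup>2\<close>
  (\<open>dBR_kernel_dominates\<close>). Hence \<open>\<Sum>c\<^sub>w k\<^sub>w\<^sup>b \<mapsto> F(l)\<close> is a bounded functional if
  \<open>h(l) \<noteq> 0\<close>, and the element representing it is \<open>k\<^sub>l\<close> (\<open>szego_kernel_mem_dBR\<close>).

  Both directions need the Riesz projection, which is given through radial boundary values, to be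
  well determined. This rests on Fatou's theorem that these limits exist almost everywhere for
  functions in the Hardy space (\<open>Fatou_H2\<close>). Its proof here goes through a weak-type bound for
  the radial maximal function: averages of Poisson integrals over the radii \<open>r, r\<^sup>2, r\<^sup>3, \<dots>\<close>
  are ergodic averages of the Poisson semigroup, so that Hopf's maximal ergodic theorem controls them
  (\<open>maximal_ergodic_poisson\<close>), and Harnack's inequality bounds single values by averages
  (\<open>weak_type_radii\<close>).
\<close>

section \<open>Integration on the circle\<close>

lemma borel_measurable_cis [measurable]: "cis \<in> borel_measurable borel"
  by (intro borel_measurable_continuous_onI continuous_intros)

lemma borel_measurable_cnj [measurable (raw)]:
  "f \<in> borel_measurable N \<Longrightarrow> (\<lambda>x. cnj (f x)) \<in> borel_measurable N"
  by (rule borel_measurable_continuous_on) (intro continuous_intros continuous_on_id)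

interpretation circle: prob_space circle_measure
proof -
  interpret U: prob_space "uniform_measure lborel {0..<2 * pi}"
    by (rule prob_space_uniform_measure) auto
  show "prob_space circle_measure"
    unfolding circle_measure_def by (rule U.prob_space_distr) (simp add: uniform_measure_def)
qed

lemma sets_circle_measure [measurable_cong, simp]: "sets circle_measure = sets borel"
  by (simp add: circle_measure_def)

lemma space_circle_measure [simp]: "space circle_measure = UNIV"
  by (simp add: circle_measure_def)

lemma measure_circle_UNIV [simp]: "measure circle_measure UNIV = 1"
  using circle.prob_space by simp

lemma AE_circle_norm: "AE \<zeta> in circle_measure. norm \<zeta> = 1"
  unfolding circle_measure_def by (subst AE_distr_iff) (auto simp: uniform_measure_def)

lemma circle_AE_I: "(\<And>\<zeta>. norm \<zeta> = 1 \<Longrightarrow> P \<zeta>) \<Longrightarrow> AE \<zeta> in circle_measure. P \<zeta>"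
  using AE_circle_norm by eventually_elim auto

lemma circle_integrable_bounded:
  fixes f :: "complex \<Rightarrow> 'b::{banach,second_countable_topology}"
  assumes "f \<in> borel_measurable borel" "\<And>\<zeta>. norm \<zeta> = 1 \<Longrightarrow> norm (f \<zeta>) \<le> B"
  shows "integrable circle_measure f"
  by (rule circle.integrable_const_bound[of _ B]) (use assms in \<open>auto intro: circle_AE_I\<close>)

lemma circle_integral_cong:
  fixes f g :: "complex \<Rightarrow> 'b::{banach,second_countable_topology}"
  assumes "f \<in> borel_measurable borel" "g \<in> borel_measurable borel"
    "\<And>\<zeta>. norm \<zeta> = 1 \<Longrightarrow> f \<zeta> = g \<zeta>"
  shows "integral\<^sup>L circle_measure f = integral\<^sup>L circle_measure g"
  by (rule integral_cong_AE) (use assms in \<open>auto intro: circle_AE_I\<close>)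

lemma circle_integral_eq:
  fixes f :: "complex \<Rightarrow> complex"
  assumes [measurable]: "f \<in> borel_measurable borel"
  shows "integral\<^sup>L circle_measure f
           = (\<integral>t. indicator {0..2 * pi} t *\<^sub>R f (cis t) \<partial>lborel) / (2 * pi)"
proof -
  have eq: "uniform_measure lborel {0..<2 * pi}
      = density lborel (\<lambda>t. ennreal (indicator {0..<2 * pi} t / (2 * pi)))"
    unfolding uniform_measure_def
    by (rule density_cong) (auto split: split_indicator simp: divide_ennreal simp flip: ennreal_1)
  have "integral\<^sup>L circle_measure f = (\<integral>t. f (cis t) \<partial>uniform_measure lborel {0..<2 * pi})"
    unfolding circle_measure_def by (rule integral_distr) auto
  also have "\<dots> = (\<integral>t. (indicator {0..<2 * pi} t / (2 * pi)) *\<^sub>R f (cis t) \<partial>lborel)"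
    unfolding eq by (rule integral_density) auto
  also have "\<dots> = (\<integral>t. (indicator {0..2 * pi} t *\<^sub>R f (cis t)) / (2 * pi) \<partial>lborel)"
  proof (rule integral_cong_AE)
    show "AE t in lborel. (indicator {0..<2 * pi} t / (2 * pi)) *\<^sub>R f (cis t)
        = (indicator {0..2 * pi} t *\<^sub>R f (cis t)) / (2 * pi)"
      using AE_lborel_singleton[of "2*pi"]
      by eventually_elim (auto split: split_indicator simp: scaleR_conv_of_real)
  qed auto
  finally show ?thesis by simp
qed

lemma circle_integral_monomial:
  "(\<integral>\<zeta>. \<zeta> ^ n * cnj (\<zeta> ^ m) \<partial>circle_measure) = (if n = m then 1 else 0)"
proof (cases "n = m")
  case True
  have "(\<integral>\<zeta>. \<zeta> ^ n * cnj (\<zeta> ^ m) \<partial>circle_measure) = (\<integral>\<zeta>. (1::complex) \<partial>circle_measure)"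
    by (rule circle_integral_cong)
       (auto simp: True complex_norm_square[symmetric] norm_power simp del: complex_cnj_power)
  then show ?thesis using True by simp
next
  case False
  define k where "k = real n - real m"
  have k: "k \<noteq> 0" using False by (simp add: k_def)
  have fe: "cis t ^ n * cnj (cis t ^ m) = cis (k * t)" for t
    by (simp add: k_def Complex.DeMoivre cis_cnj cis_mult left_diff_distrib)
  have "(\<integral>\<zeta>. \<zeta> ^ n * cnj (\<zeta> ^ m) \<partial>circle_measure)
      = (\<integral>t. indicator {0..2 * pi} t *\<^sub>R cis (k * t) \<partial>lborel) / (2 * pi)"
    by (subst circle_integral_eq) (auto simp: fe simp del: complex_cnj_power)
  also have "(\<integral>t. indicator {0..2 * pi} t *\<^sub>R cis (k * t) \<partial>lborel)
      = cis (k * (2 * pi)) / (\<i> * k) - cis (k * 0) / (\<i> * k)"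
  proof (rule integral_FTC_Icc)
    show "((\<lambda>t. cis (k * t) / (\<i> * k)) has_vector_derivative cis (k * x)) (at x within {0..2*pi})" for x
      unfolding cis_conv_exp using k
      by (auto intro!: derivative_eq_intros has_vector_derivative_real_field simp: mult_ac)
  qed (auto intro!: continuous_intros)
  also have "cis (k * (2 * pi)) = 1"
    using cis_multiple_2pi[of k] by (simp add: k_def mult.commute)
  finally show ?thesis using False by simp
qed


text \<open>
  Parseval's identity. Partial sums are paired by orthogonality of the monomials; they are dominated
  by the sums of the absolute values of the coefficients.
\<close>

lemma circle_integral_power_series:
  fixes F G :: "complex \<Rightarrow> complex"
  assumes [measurable]: "F \<in> borel_measurable borel" "G \<in> borel_measurable borel"
    and a: "summable (\<lambda>n. norm (a n))" and b: "summable (\<lambda>n. norm (b n))"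
    and F: "\<And>\<zeta>. norm \<zeta> = 1 \<Longrightarrow> (\<lambda>n. a n * \<zeta> ^ n) sums F \<zeta>"
    and G: "\<And>\<zeta>. norm \<zeta> = 1 \<Longrightarrow> (\<lambda>n. b n * \<zeta> ^ n) sums G \<zeta>"
  shows "(\<lambda>n. a n * cnj (b n)) sums (\<integral>\<zeta>. F \<zeta> * cnj (G \<zeta>) \<partial>circle_measure)"
proof -
  define S where "S c N \<zeta> = (\<Sum>n<N. c n * \<zeta> ^ n)" for c :: "nat \<Rightarrow> complex" and N \<zeta>
  have meas [measurable]: "S c N \<in> borel_measurable borel" for c N
    unfolding S_def by measurable
  have bound: "norm (S c N \<zeta>) \<le> (\<Sum>n. norm (c n))"
    if "summable (\<lambda>n. norm (c n))" "norm \<zeta> = 1" for c N \<zeta>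
  proof -
    have "norm (S c N \<zeta>) \<le> (\<Sum>n<N. norm (c n * \<zeta> ^ n))"
      unfolding S_def by (rule norm_sum)
    also have "\<dots> = (\<Sum>n<N. norm (c n))"
      using that by (simp add: norm_mult norm_power)
    also have "\<dots> \<le> (\<Sum>n. norm (c n))"
      by (rule sum_le_suminf) (use that in auto)
    finally show ?thesis .
  qed
  have "(\<lambda>N. \<integral>\<zeta>. S a N \<zeta> * cnj (S b N \<zeta>) \<partial>circle_measure)
      \<longlonglongrightarrow> (\<integral>\<zeta>. F \<zeta> * cnj (G \<zeta>) \<partial>circle_measure)"
  proof (rule integral_dominated_convergence)
    show "AE \<zeta> in circle_measure. (\<lambda>N. S a N \<zeta> * cnj (S b N \<zeta>)) \<longlonglongrightarrow> F \<zeta> * cnj (G \<zeta>)"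
      by (rule circle_AE_I)
         (use F G in \<open>auto simp: S_def sums_def simp del: cnj_sum complex_cnj_power
           intro!: tendsto_mult tendsto_cnj\<close>)
    show "AE \<zeta> in circle_measure. norm (S a N \<zeta> * cnj (S b N \<zeta>))
        \<le> (\<Sum>n. norm (a n)) * (\<Sum>n. norm (b n))" for N
      by (rule circle_AE_I) (auto simp: norm_mult intro!: mult_mono bound a b suminf_nonneg)
  qed auto
  moreover have "(\<integral>\<zeta>. S a N \<zeta> * cnj (S b N \<zeta>) \<partial>circle_measure) = (\<Sum>n<N. a n * cnj (b n))" for N
  proof -
    have int: "integrable circle_measure (\<lambda>\<zeta>. c * (\<zeta> ^ n * cnj (\<zeta> ^ m)))" for c :: complex and n m
      by (rule circle_integrable_bounded[of _ "norm c"]) (auto simp: norm_mult norm_power)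
    have "(\<integral>\<zeta>. S a N \<zeta> * cnj (S b N \<zeta>) \<partial>circle_measure)
        = (\<integral>\<zeta>. (\<Sum>n<N. \<Sum>m<N. (a n * cnj (b m)) * (\<zeta> ^ n * cnj (\<zeta> ^ m))) \<partial>circle_measure)"
      unfolding S_def cnj_sum sum_product
      by (intro Bochner_Integration.integral_cong refl sum.cong) (simp add: mult_ac)
    also have "\<dots> = (\<Sum>n<N. \<Sum>m<N. (a n * cnj (b m)) *
        (\<integral>\<zeta>. \<zeta> ^ n * cnj (\<zeta> ^ m) \<partial>circle_measure))"
      using int by (simp add: Bochner_Integration.integral_sum del: complex_cnj_power)
    also have "\<dots> = (\<Sum>n<N. a n * cnj (b n))"
      unfolding circle_integral_monomial by (intro sum.cong refl) (simp add: if_distrib sum.delta cong: if_cong)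
    finally show ?thesis .
  qed
  ultimately show ?thesis by (simp add: sums_def)
qed

text \<open>
  By compactness the function is analytic on a disc of radius larger than 1, so that its Taylor series
  converges absolutely on the closed unit disc.
\<close>

lemma analytic_on_cball_power_series:
  assumes "F analytic_on cball (0::complex) 1"
  obtains a where "summable (\<lambda>n. norm (a n))" "\<And>z. norm z \<le> 1 \<Longrightarrow> (\<lambda>n. a n * z ^ n) sums F z"
proof -
  obtain T where T: "open T" "cball 0 1 \<subseteq> T" "F holomorphic_on T"
    using assms by (auto simp: analytic_on_holomorphic)
  obtain e where e: "e > 0" "(\<Union>x\<in>cball 0 1. ball x e) \<subseteq> T"
    using compact_subset_open_imp_ball_epsilon_subset[of "cball (0::complex) 1" T] T by auto
  have "ball 0 (1 + e) \<subseteq> T"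
  proof
    fix z :: complex assume z: "z \<in> ball 0 (1 + e)"
    show "z \<in> T"
    proof (cases "norm z \<le> 1")
      case True then show ?thesis using T by auto
    next
      case False
      then have z0: "z \<noteq> 0" by (metis norm_zero zero_le_one)
      then have "z / norm z - z = z * of_real (1 / norm z - 1)"
        by (simp add: algebra_simps)
      then have "dist (z / norm z) z = norm z * \<bar>1 / norm z - 1\<bar>"
        by (simp only: dist_norm norm_mult norm_of_real)
      also have "\<dots> = norm z - 1"
        using False z0 by (simp add: abs_if field_simps)
      finally have "dist (z / norm z) z < e" using z by simp
      moreover have "norm (z / norm z) \<le> 1" by (simp add: norm_divide)
      ultimately have "z \<in> (\<Union>x\<in>cball 0 1. ball x e)"
        by (intro UN_I[of "z / norm z"]) (auto)
      then show ?thesis using e by blast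
    qed
  qed
  then have hol: "F holomorphic_on ball 0 (1 + e)"
    using T holomorphic_on_subset by blast
  define a where "a n = (deriv ^^ n) F 0 / fact n" for n
  have sums: "(\<lambda>n. a n * z ^ n) sums F z" if "norm z < 1 + e" for z
    using holomorphic_power_series[OF hol, of z] that by (simp add: a_def)
  define x where "x = complex_of_real (1 + e/2)"
  have x: "norm x = 1 + e/2" using e unfolding x_def norm_of_real by simp
  have "summable (\<lambda>n. norm (a n * 1 ^ n))"
    by (rule powser_insidea[of _ x]) (use sums[of x] e x in \<open>auto simp: sums_iff\<close>)
  then show ?thesis using sums e by (intro that[of a]) auto
qed

lemma analytic_on_cball_bounded:
  assumes "F analytic_on cball (0::complex) 1"
  obtains B where "\<And>z. norm z \<le> 1 \<Longrightarrow> norm (F z) \<le> B"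
proof -
  have "continuous_on (cball 0 1) F"
    using assms analytic_imp_holomorphic holomorphic_on_imp_continuous_on by blast
  then have "bounded (F ` cball 0 1)"
    by (simp add: compact_continuous_image compact_imp_bounded)
  then show ?thesis unfolding bounded_iff using that by (metis imageI mem_cball_0)
qed

text \<open>
  The factor \<open>1 / (1 - z * cnj \<eta>)\<close> is the conjugate of a geometric series in \<open>\<eta>\<close>,
  so Parseval's identity returns the power series of \<open>F\<close> at \<open>z\<close>.
\<close>

lemma cauchy_formula_circle:
  assumes [measurable]: "F \<in> borel_measurable borel" and F: "F analytic_on cball 0 1"
    and z: "norm z < 1"
  shows "(\<integral>\<eta>. F \<eta> / (1 - z * cnj \<eta>) \<partial>circle_measure) = F z"
proof -
  obtain a where a: "summable (\<lambda>n. norm (a n))"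
    "\<And>z. norm z \<le> 1 \<Longrightarrow> (\<lambda>n. a n * z ^ n) sums F z"
    using analytic_on_cball_power_series[OF F] by blast
  have "(\<lambda>n. a n * cnj (cnj z ^ n)) sums
      (\<integral>\<eta>. F \<eta> * cnj (1 / (1 - cnj z * \<eta>)) \<partial>circle_measure)"
  proof (rule circle_integral_power_series)
    show "summable (\<lambda>n. norm (cnj z ^ n))"
      using z by (simp add: norm_power summable_geometric)
    show "(\<lambda>n. cnj z ^ n * \<zeta> ^ n) sums (1 / (1 - cnj z * \<zeta>))" if "norm \<zeta> = 1" for \<zeta>
      using geometric_sums[of "cnj z * \<zeta>"] z that by (simp add: power_mult_distrib norm_mult)
  qed (use a in auto)
  moreover have "(\<lambda>n. a n * cnj (cnj z ^ n)) sums F z"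
    using a(2)[of z] z by simp
  ultimately show ?thesis by (auto dest: sums_unique2)
qed

section \<open>The Poisson kernel\<close>

definition poisson_kernel :: "complex \<Rightarrow> complex \<Rightarrow> real" where
  "poisson_kernel z \<eta> = (1 - (norm z)\<^sup>2) / (norm (\<eta> - z))\<^sup>2"

lemma poisson_kernel_measurable [measurable (raw)]:
  assumes "f \<in> borel_measurable N" "g \<in> borel_measurable N"
  shows "(\<lambda>x. poisson_kernel (f x) (g x)) \<in> borel_measurable N"
  using assms unfolding poisson_kernel_def by measurable

lemma poisson_kernel_nonneg: "norm z \<le> 1 \<Longrightarrow> 0 \<le> poisson_kernel z \<eta>"
  by (simp add: poisson_kernel_def power_le_one)

lemma poisson_kernel_le:
  assumes "norm z \<le> r" "r < 1" "norm \<eta> = 1"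
  shows "poisson_kernel z \<eta> \<le> 1 / (1 - r)\<^sup>2"
  unfolding poisson_kernel_def
proof (rule frac_le)
  show "(1 - r)\<^sup>2 \<le> (norm (\<eta> - z))\<^sup>2"
    using assms norm_triangle_ineq2[of \<eta> z] by (intro power_mono) auto
qed (use assms in auto)

text \<open>
  As a function of \<open>z\<close> the kernel is harmonic; the semigroup law is Poisson's formula for the
  analytic function displayed here.
\<close>

lemma poisson_kernel_eq_Re:
  assumes "norm z < 1" "norm \<eta> = 1"
  shows "poisson_kernel z \<eta> = Re ((\<eta> + z) / (\<eta> - z))"
proof -
  have ne: "\<eta> \<noteq> z" using assms by auto
  have "(\<eta> + z) / (\<eta> - z) = (\<eta> + z) * cnj (\<eta> - z) / (norm (\<eta> - z))\<^sup>2"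
    by (rule complex_div_cnj)
  moreover have "Re ((\<eta> + z) * cnj (\<eta> - z)) = (norm \<eta>)\<^sup>2 - (norm z)\<^sup>2"
    unfolding cmod_power2 by (simp add: algebra_simps power2_eq_square)
  ultimately show ?thesis
    using assms by (simp add: poisson_kernel_def)
qed

lemma poisson_kernel_eq_product:
  assumes "norm z < 1" "norm \<eta> = 1"
  shows "complex_of_real (poisson_kernel z \<eta>)
    = (1 - (norm z)\<^sup>2) / ((1 - cnj z * \<eta>) * (1 - z * cnj \<eta>))"
proof -
  have "complex_of_real ((norm (\<eta> - z))\<^sup>2) = (\<eta> - z) * cnj (\<eta> - z)"
    by (simp only: complex_norm_square)
  also have "\<dots> = (1 - cnj z * \<eta>) * (1 - z * cnj \<eta>)"
  proof -
    have "\<eta> * cnj \<eta> = 1" using assms complex_norm_square[of \<eta>] by simp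
    then have "\<eta> * cnj \<eta> = 1" "z * cnj z * (\<eta> * cnj \<eta>) = z * cnj z" by simp_all
    then show ?thesis by (simp add: algebra_simps)
  qed
  finally show ?thesis by (simp add: poisson_kernel_def)
qed

text \<open>
  On the circle the kernel factors as in \<open>poisson_kernel_eq_product\<close>. One factor is analytic in
  \<open>\<eta>\<close> and is absorbed into \<open>F\<close>; the other one is the kernel of Cauchy's formula.
\<close>

lemma poisson_formula_circle:
  assumes [measurable]: "F \<in> borel_measurable borel" and F: "F analytic_on cball 0 1"
    and z: "norm z < 1"
  shows "(\<integral>\<eta>. F \<eta> * poisson_kernel z \<eta> \<partial>circle_measure) = F z"
proof -
  define G where "G \<eta> = F \<eta> * (1 - (norm z)\<^sup>2) / (1 - cnj z * \<eta>)" for \<eta>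
  have [measurable]: "G \<in> borel_measurable borel" unfolding G_def by measurable
  have ne: "1 - cnj z * \<eta> \<noteq> 0" if "norm \<eta> \<le> 1" for \<eta>
  proof
    assume "1 - cnj z * \<eta> = 0"
    then have "norm (cnj z * \<eta>) = 1" by simp
    moreover have "norm z * norm \<eta> < 1"
      using that z mult_left_le[of "norm \<eta>" "norm z"] by auto
    ultimately show False by (simp add: norm_mult)
  qed
  have "G analytic_on cball 0 1"
    unfolding G_def by (intro analytic_intros F) (use ne in auto)
  from cauchy_formula_circle[OF _ this z]
  have "(\<integral>\<eta>. G \<eta> / (1 - z * cnj \<eta>) \<partial>circle_measure) = G z" by simp
  also have "(\<integral>\<eta>. G \<eta> / (1 - z * cnj \<eta>) \<partial>circle_measure)
      = (\<integral>\<eta>. F \<eta> * poisson_kernel z \<eta> \<partial>circle_measure)"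
    by (rule circle_integral_cong) (auto simp: G_def poisson_kernel_eq_product[OF z])
  also have "G z = F z"
    using ne[of z] z complex_norm_square[of z] by (simp add: G_def mult.commute)
  finally show ?thesis .
qed

lemma integrable_poisson:
  fixes h :: "complex \<Rightarrow> 'b::{banach,second_countable_topology,real_normed_algebra_1}"
  assumes [measurable]: "h \<in> borel_measurable borel"
    and h: "\<And>\<eta>. norm \<eta> = 1 \<Longrightarrow> norm (h \<eta>) \<le> B" and z: "norm z < 1"
  shows "integrable circle_measure (\<lambda>\<eta>. poisson_kernel z \<eta> *\<^sub>R h \<eta>)"
proof (rule circle_integrable_bounded)
  show "norm (poisson_kernel z \<eta> *\<^sub>R h \<eta>) \<le> 1 / (1 - norm z)\<^sup>2 * B" if "norm \<eta> = 1" for \<eta>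
    unfolding norm_scaleR
    by (rule mult_mono)
       (use that z h[OF that] poisson_kernel_le[of z "norm z" \<eta>] poisson_kernel_nonneg[of z \<eta>]
         in auto)
qed measurable

lemma integral_poisson_kernel:
  assumes "norm z < 1"
  shows "(\<integral>\<eta>. poisson_kernel z \<eta> \<partial>circle_measure) = 1"
proof -
  have "complex_of_real (\<integral>\<eta>. poisson_kernel z \<eta> \<partial>circle_measure) = 1"
    using poisson_formula_circle[of "\<lambda>_. 1" z] assms by simp
  then show ?thesis by (simp only: of_real_eq_1_iff)
qed

lemma poisson_kernel_sym:
  assumes "norm \<zeta> = 1" "norm \<eta> = 1" 
  shows "poisson_kernel (complex_of_real r * \<zeta>) \<eta> = poisson_kernel (complex_of_real r * \<eta>) \<zeta>"
proof -
  have "(norm (\<eta> - r * \<zeta>))\<^sup>2 = (norm \<eta>)\<^sup>2 + r\<^sup>2 * (norm \<zeta>)\<^sup>2 - 2 * r * (Re \<eta> * Re \<zeta> + Im \<eta> * Im \<zeta>)"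
    for \<eta> \<zeta> :: complex
    unfolding cmod_power2 by (simp add: power2_eq_square algebra_simps)
  then have "(norm (\<eta> - r * \<zeta>))\<^sup>2 = (norm (\<zeta> - r * \<eta>))\<^sup>2"
    using assms by (simp add: mult.commute)
  then show ?thesis using assms by (simp add: poisson_kernel_def norm_mult)
qed

lemma poisson_kernel_semigroup:
  assumes "norm z < 1" "0 \<le> s" "s < 1" "norm \<eta> = 1"
  shows "(\<integral>x. poisson_kernel (of_real s * x) \<eta> * poisson_kernel z x \<partial>circle_measure)
       = poisson_kernel (of_real s * z) \<eta>"
proof -
  define F where "F x = (\<eta> + of_real s * x) / (\<eta> - of_real s * x)" for x
  have [measurable]: "F \<in> borel_measurable borel" unfolding F_def by measurable
  have lt: "norm (of_real s * x) < 1" if "norm x \<le> 1" for x :: complex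
    using that assms mult_left_le[of "norm x" s] by (auto simp: norm_mult)
  have ne: "\<eta> - of_real s * x \<noteq> 0" if "norm x \<le> 1" for x
    using lt[OF that] assms(4) by auto
  have pk: "poisson_kernel (of_real s * x) \<eta> = Re (F x)" if "norm x \<le> 1" for x
    using lt[OF that] assms(4) by (simp add: poisson_kernel_eq_Re F_def)
  have F: "F analytic_on cball 0 1"
    unfolding F_def by (intro analytic_intros) (use ne in auto)
  from poisson_formula_circle[OF _ F assms(1)]
  have eq: "(\<integral>x. F x * poisson_kernel z x \<partial>circle_measure) = F z" by simp
  obtain B where B: "\<And>x. norm x \<le> 1 \<Longrightarrow> norm (F x) \<le> B"
    using analytic_on_cball_bounded[OF F] by blast
  have int: "integrable circle_measure (\<lambda>x. poisson_kernel z x *\<^sub>R F x)"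
    by (rule integrable_poisson[where B=B]) (use B assms in auto)
  have "poisson_kernel (of_real s * z) \<eta> = Re (F z)"
    using pk[of z] assms by simp
  also have "\<dots> = (\<integral>x. Re (F x * poisson_kernel z x) \<partial>circle_measure)"
    unfolding eq[symmetric]
    by (rule integral_Re[symmetric]) (use int in \<open>simp add: scaleR_conv_of_real mult.commute\<close>)
  also have "\<dots> = (\<integral>x. poisson_kernel (of_real s * x) \<eta> * poisson_kernel z x \<partial>circle_measure)"
    by (rule circle_integral_cong)
       (use pk in auto)
  finally show ?thesis by simp
qed

section \<open>The Poisson integral and its maximal function\<close>

text \<open>
  Poisson kernels are bounded on the torus but not on the whole plane, so the bound is
  only asked for where the measure lives.
\<close>

lemma circle_Fubini:
  fixes K :: "complex \<Rightarrow> complex \<Rightarrow> real"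
  assumes [measurable]: "case_prod K \<in> borel_measurable (borel \<Otimes>\<^sub>M borel)"
    and K: "\<And>x y. norm x = 1 \<Longrightarrow> norm y = 1 \<Longrightarrow> \<bar>K x y\<bar> \<le> B"
  shows "(\<integral>y. (\<integral>x. K x y \<partial>circle_measure) \<partial>circle_measure)
       = (\<integral>x. (\<integral>y. K x y \<partial>circle_measure) \<partial>circle_measure)"
proof -
  interpret pair_sigma_finite circle_measure circle_measure ..
  have meas: "(\<lambda>y. K x y) \<in> borel_measurable borel" for x
    by measurable
  have int: "integrable circle_measure (\<lambda>y. K x y)" if "norm x = 1" for x
    by (rule circle_integrable_bounded[of _ B]) (use meas K that in auto)
  show ?thesis
  proof (intro Fubini_integral Fubini_integrable)
    show "integrable circle_measure (\<lambda>x. \<integral>y. norm (case_prod K (x, y)) \<partial>circle_measure)"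
    proof (rule circle_integrable_bounded[of _ B])
      show "norm (\<integral>y. norm (case_prod K (x, y)) \<partial>circle_measure) \<le> B" if "norm x = 1" for x
      proof -
        have "(\<integral>y. norm (K x y) \<partial>circle_measure) \<le> (\<integral>y. B \<partial>circle_measure)"
          by (rule integral_mono_AE) (use int that K in \<open>auto intro: circle_AE_I\<close>)
        then show ?thesis by (simp add: integral_nonneg_AE)
      qed
    qed (auto intro!: circle.borel_measurable_lebesgue_integral)
  qed (auto intro: circle_AE_I int)
qed

definition poisson_integral :: "(complex \<Rightarrow> real) \<Rightarrow> complex \<Rightarrow> real" where
  "poisson_integral h z = (\<integral>\<eta>. poisson_kernel z \<eta> * h \<eta> \<partial>circle_measure)"

text \<open>
  The bound is restricted to the circle, off which Poisson integrals are not controlled. Measurability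
  refers to the plane, on which \<open>circle_measure\<close> is defined.
\<close>

definition bounded_on_circle :: "(complex \<Rightarrow> real) \<Rightarrow> bool" where
  "bounded_on_circle h \<longleftrightarrow> h \<in> borel_measurable borel \<and> (\<exists>B. \<forall>\<zeta>. norm \<zeta> = 1 \<longrightarrow> \<bar>h \<zeta>\<bar> \<le> B)"

lemma bounded_on_circleI:
  assumes "h \<in> borel_measurable borel" "\<And>\<zeta>. norm \<zeta> = 1 \<Longrightarrow> \<bar>h \<zeta>\<bar> \<le> B"
  shows "bounded_on_circle h"
  using assms by (auto simp: bounded_on_circle_def)

lemma bounded_on_circle_const [simp]: "bounded_on_circle (\<lambda>_. c)"
  by (rule bounded_on_circleI[of _ "\<bar>c\<bar>"]) auto

lemma bounded_on_circle_add:
  assumes "bounded_on_circle g" "bounded_on_circle h"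
  shows "bounded_on_circle (\<lambda>\<zeta>. g \<zeta> + h \<zeta>)"
proof -
  obtain A B where "\<forall>\<zeta>. norm \<zeta> = 1 \<longrightarrow> \<bar>g \<zeta>\<bar> \<le> A" "\<forall>\<zeta>. norm \<zeta> = 1 \<longrightarrow> \<bar>h \<zeta>\<bar> \<le> B"
    using assms by (auto simp: bounded_on_circle_def)
  then show ?thesis
    using assms by (intro bounded_on_circleI[of _ "A + B"])
      (auto simp: bounded_on_circle_def intro: order_trans[OF abs_triangle_ineq] add_mono)
qed

lemma bounded_on_circle_sum:
  assumes "\<And>i. i \<in> I \<Longrightarrow> bounded_on_circle (h i)"
  shows "bounded_on_circle (\<lambda>\<zeta>. \<Sum>i\<in>I. h i \<zeta>)"
  using assms by (induction I rule: infinite_finite_induct) (auto intro: bounded_on_circle_add)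

lemma bounded_on_circle_max:
  assumes "bounded_on_circle g" "bounded_on_circle h"
  shows "bounded_on_circle (\<lambda>\<zeta>. max (g \<zeta>) (h \<zeta>))"
proof -
  obtain A B where "\<forall>\<zeta>. norm \<zeta> = 1 \<longrightarrow> \<bar>g \<zeta>\<bar> \<le> A" "\<forall>\<zeta>. norm \<zeta> = 1 \<longrightarrow> \<bar>h \<zeta>\<bar> \<le> B"
    using assms by (auto simp: bounded_on_circle_def)
  then show ?thesis
    using assms by (intro bounded_on_circleI[of _ "max A B"])
      (auto simp: bounded_on_circle_def max_def split: if_splits dest!: spec)
qed

lemma bounded_on_circle_measurable [measurable_dest]:
  "bounded_on_circle h \<Longrightarrow> h \<in> borel_measurable borel"
  by (simp add: bounded_on_circle_def)

lemma bounded_on_circle_integrable: "bounded_on_circle h \<Longrightarrow> integrable circle_measure h"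
  by (auto simp: bounded_on_circle_def intro!: circle_integrable_bounded)

lemma poisson_integrable:
  assumes "bounded_on_circle h" "norm z < 1"
  shows "integrable circle_measure (\<lambda>\<eta>. poisson_kernel z \<eta> * h \<eta>)"
proof -
  obtain B where "\<And>\<zeta>. norm \<zeta> = 1 \<Longrightarrow> norm (h \<zeta>) \<le> B" 
    using assms by (auto simp: bounded_on_circle_def)
  then show ?thesis
    using integrable_poisson[of h B z] assms by (auto simp: bounded_on_circle_def)
qed

lemma poisson_integral_mono:
  assumes "bounded_on_circle g" "bounded_on_circle h" "norm z < 1"
    and "\<And>\<zeta>. norm \<zeta> = 1 \<Longrightarrow> g \<zeta> \<le> h \<zeta>"
  shows "poisson_integral g z \<le> poisson_integral h z"
  unfolding poisson_integral_def
  by (rule integral_mono_AE)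
     (use assms in \<open>auto intro!: poisson_integrable circle_AE_I mult_left_mono poisson_kernel_nonneg\<close>)

lemma poisson_integral_const: "norm z < 1 \<Longrightarrow> poisson_integral (\<lambda>_. c) z = c"
  by (simp add: poisson_integral_def integral_poisson_kernel)

lemma poisson_integral_add:
  assumes "bounded_on_circle g" "bounded_on_circle h" "norm z < 1"
  shows "poisson_integral (\<lambda>\<zeta>. g \<zeta> + h \<zeta>) z = poisson_integral g z + poisson_integral h z"
  unfolding poisson_integral_def using assms
  by (simp add: distrib_left Bochner_Integration.integral_add poisson_integrable)

lemma poisson_integral_sum:
  assumes "\<And>i. i \<in> I \<Longrightarrow> bounded_on_circle (h i)" "norm z < 1"
  shows "poisson_integral (\<lambda>\<zeta>. \<Sum>i\<in>I. h i \<zeta>) z = (\<Sum>i\<in>I. poisson_integral (h i) z)"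
  using assms
  by (induction I rule: infinite_finite_induct)
     (auto simp: poisson_integral_const poisson_integral_add bounded_on_circle_sum)

lemma poisson_integral_nonneg:
  assumes "bounded_on_circle h" "norm z < 1" "\<And>\<zeta>. norm \<zeta> = 1 \<Longrightarrow> 0 \<le> h \<zeta>"
  shows "0 \<le> poisson_integral h z"
  using poisson_integral_mono[of "\<lambda>_. 0" h z] assms by (simp add: poisson_integral_const)

lemma bounded_on_circle_poisson_integral:
  assumes h: "bounded_on_circle h" and r: "0 \<le> r" "r < 1"
  shows "bounded_on_circle (\<lambda>\<zeta>. poisson_integral h (of_real r * \<zeta>))"
proof -
  obtain B where B: "\<And>\<zeta>. norm \<zeta> = 1 \<Longrightarrow> \<bar>h \<zeta>\<bar> \<le> B"
    using h by (auto simp: bounded_on_circle_def)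
  note [measurable] = bounded_on_circle_measurable[OF h]
  show ?thesis
  proof (rule bounded_on_circleI[of _ B])
    show "(\<lambda>\<zeta>. poisson_integral h (of_real r * \<zeta>)) \<in> borel_measurable borel"
      unfolding poisson_integral_def by measurable
    fix \<zeta> :: complex assume \<zeta>: "norm \<zeta> = 1"
    have lt: "norm (of_real r * \<zeta>) < 1" using r \<zeta> by (simp add: norm_mult)
    have "poisson_integral h (of_real r * \<zeta>) \<le> B"
      using poisson_integral_mono[of h "\<lambda>_. B", OF h _ lt] B poisson_integral_const[OF lt, of B]
      by (auto simp: abs_le_iff)
    moreover have "- B \<le> poisson_integral h (of_real r * \<zeta>)"
      using poisson_integral_mono[of "\<lambda>_. -B" h, OF _ h lt] B poisson_integral_const[OF lt, of "-B"]
      by (force simp: abs_le_iff)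
    ultimately show "\<bar>poisson_integral h (of_real r * \<zeta>)\<bar> \<le> B" by auto
  qed
qed

text \<open>
  The kernel is symmetric in the two points of the circle, so integrating it over \<open>\<zeta>\<close> gives 1 just
  as integrating it over \<open>\<eta>\<close> does.
\<close>

lemma integral_poisson_integral:
  assumes h: "bounded_on_circle h" and r: "0 \<le> r" "r < 1"
  shows "(\<integral>\<zeta>. poisson_integral h (of_real r * \<zeta>) \<partial>circle_measure) = (\<integral>\<zeta>. h \<zeta> \<partial>circle_measure)"
proof -
  obtain B where B: "\<And>\<zeta>. norm \<zeta> = 1 \<Longrightarrow> \<bar>h \<zeta>\<bar> \<le> B"
    using h by (auto simp: bounded_on_circle_def)
  note [measurable] = bounded_on_circle_measurable[OF h]
  have lt: "norm (of_real r * \<zeta>) < 1" if "norm \<zeta> = 1" for \<zeta> :: complex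
    using r that by (simp add: norm_mult)
  have "(\<integral>\<zeta>. poisson_integral h (of_real r * \<zeta>) \<partial>circle_measure)
      = (\<integral>\<eta>. (\<integral>\<zeta>. poisson_kernel (of_real r * \<zeta>) \<eta> * h \<eta> \<partial>circle_measure) \<partial>circle_measure)"
    unfolding poisson_integral_def
  proof (rule circle_Fubini[symmetric])
    fix x y :: complex assume *: "norm x = 1" "norm y = 1"
    have "\<bar>poisson_kernel (of_real r * x) y\<bar> \<le> 1 / (1 - r)\<^sup>2"
      using poisson_kernel_le[of "of_real r * x" r y] poisson_kernel_nonneg[of "of_real r * x" y] r *
      by (simp add: norm_mult)
    then show "\<bar>poisson_kernel (of_real r * x) y * h y\<bar> \<le> 1 / (1 - r)\<^sup>2 * B"
      unfolding abs_mult using B[of y] * by (intro mult_mono) auto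
  qed measurable
  also have "\<dots> = (\<integral>\<eta>. h \<eta> \<partial>circle_measure)"
  proof (rule circle_integral_cong)
    fix \<eta> :: complex assume \<eta>: "norm \<eta> = 1"
    have "(\<integral>\<zeta>. poisson_kernel (of_real r * \<zeta>) \<eta> \<partial>circle_measure)
        = (\<integral>\<zeta>. poisson_kernel (of_real r * \<eta>) \<zeta> \<partial>circle_measure)"
      by (rule circle_integral_cong) (use \<eta> poisson_kernel_sym in auto)
    also have "\<dots> = 1" by (rule integral_poisson_kernel[OF lt[OF \<eta>]])
    finally show "(\<integral>\<zeta>. poisson_kernel (of_real r * \<zeta>) \<eta> * h \<eta> \<partial>circle_measure) = h \<eta>" by simp
  qed measurable
  finally show ?thesis .
qed

lemma poisson_integral_semigroup:
  assumes h: "bounded_on_circle h" and s: "0 \<le> s" "s < 1" and z: "norm z < 1"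
  shows "poisson_integral (\<lambda>\<zeta>. poisson_integral h (of_real s * \<zeta>)) z
       = poisson_integral h (of_real s * z)"
proof -
  obtain B where B: "\<And>\<zeta>. norm \<zeta> = 1 \<Longrightarrow> \<bar>h \<zeta>\<bar> \<le> B"
    using h by (auto simp: bounded_on_circle_def)
  note [measurable] = bounded_on_circle_measurable[OF h]
  have "poisson_integral (\<lambda>\<zeta>. poisson_integral h (of_real s * \<zeta>)) z
      = (\<integral>x. (\<integral>\<eta>. poisson_kernel z x * (poisson_kernel (of_real s * x) \<eta> * h \<eta>)
            \<partial>circle_measure) \<partial>circle_measure)"
    unfolding poisson_integral_def by simp
  also have "\<dots> = (\<integral>\<eta>. (\<integral>x. poisson_kernel z x * (poisson_kernel (of_real s * x) \<eta> * h \<eta>)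
            \<partial>circle_measure) \<partial>circle_measure)"
  proof (rule circle_Fubini[symmetric])
    fix x y :: complex assume *: "norm x = 1" "norm y = 1"
    have "\<bar>poisson_kernel (of_real s * x) y\<bar> \<le> 1 / (1 - s)\<^sup>2"
      using poisson_kernel_le[of "of_real s * x" s y] poisson_kernel_nonneg[of "of_real s * x" y] s *
      by (simp add: norm_mult)
    moreover have "\<bar>poisson_kernel z x\<bar> \<le> 1 / (1 - norm z)\<^sup>2"
      using poisson_kernel_le[of z "norm z" x] poisson_kernel_nonneg[of z x] z * by simp
    ultimately show "\<bar>poisson_kernel z x * (poisson_kernel (of_real s * x) y * h y)\<bar>
        \<le> 1 / (1 - norm z)\<^sup>2 * (1 / (1 - s)\<^sup>2 * B)"
      unfolding abs_mult using B[of y] * by (intro mult_mono) auto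
  qed measurable
  also have "\<dots> = (\<integral>\<eta>. poisson_kernel (of_real s * z) \<eta> * h \<eta> \<partial>circle_measure)"
  proof (rule circle_integral_cong)
    fix \<eta> :: complex assume \<eta>: "norm \<eta> = 1"
    have "(\<integral>x. poisson_kernel z x * (poisson_kernel (of_real s * x) \<eta> * h \<eta>) \<partial>circle_measure)
        = (\<integral>x. poisson_kernel (of_real s * x) \<eta> * poisson_kernel z x * h \<eta> \<partial>circle_measure)"
      by (simp add: mult_ac)
    also have "\<dots> = poisson_kernel (of_real s * z) \<eta> * h \<eta>"
      by (simp add: poisson_kernel_semigroup[OF z s \<eta>])
    finally show "(\<integral>x. poisson_kernel z x * (poisson_kernel (of_real s * x) \<eta> * h \<eta>) \<partial>circle_measure)
        = poisson_kernel (of_real s * z) \<eta> * h \<eta>" .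
  qed measurable
  finally show ?thesis unfolding poisson_integral_def .
qed

text \<open>
  Hopf's maximal ergodic theorem for the operator \<open>T h = (\<lambda>\<zeta>. poisson_integral h (r * \<zeta>))\<close>,
  with Garsia's proof. Let \<open>S\<^sub>n\<close> be the sum of the first \<open>n\<close> functions \<open>v\<^sub>k - \<alpha>\<close> and
  \<open>X = max 0 S\<^sub>1 \<dots> S\<^sub>N\<close>. Since \<open>T\<close> is positive and preserves constants,
  \<open>S\<^sub>m\<^sub>+\<^sub>1 = v\<^sub>0 - \<alpha> + T S\<^sub>m \<le> v\<^sub>0 - \<alpha> + T X\<close>. So \<open>X - T X\<close> is at most \<open>v\<^sub>0 - \<alpha>\<close> where
  \<open>X > 0\<close>, and at most 0 elsewhere. The integral of \<open>X - T X\<close>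
  is 0 because \<open>T\<close> preserves integrals.
\<close>

lemma maximal_ergodic_poisson:
  fixes v :: "nat \<Rightarrow> complex \<Rightarrow> real"
  assumes r: "0 \<le> r" "r < 1" and "0 < \<alpha>"
    and v: "\<And>k. bounded_on_circle (v k)"
    and step: "\<And>k \<zeta>. norm \<zeta> = 1 \<Longrightarrow> v (Suc k) \<zeta> = poisson_integral (v k) (of_real r * \<zeta>)"
    and nonneg: "\<And>\<zeta>. norm \<zeta> = 1 \<Longrightarrow> 0 \<le> v 0 \<zeta>"
  shows "measure circle_measure {\<zeta>. \<exists>n\<in>{1..N}. \<alpha> * real n < (\<Sum>k<n. v k \<zeta>)}
    \<le> (\<integral>\<zeta>. v 0 \<zeta> \<partial>circle_measure) / \<alpha>"
proof -
  note [measurable] = bounded_on_circle_measurable[OF v]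
  define S where "S n \<zeta> = (\<Sum>k<n. v k \<zeta> + (- \<alpha>))" for n \<zeta>
  define X where "X = rec_nat (\<lambda>\<zeta>. 0) (\<lambda>n Y \<zeta>. max (Y \<zeta>) (S (Suc n) \<zeta>))"
  have X0: "X 0 \<zeta> = 0" and XS: "X (Suc n) \<zeta> = max (X n \<zeta>) (S (Suc n) \<zeta>)" for n \<zeta>
    by (simp_all add: X_def)
  have S: "bounded_on_circle (S n)" for n
    unfolding S_def by (intro bounded_on_circle_sum bounded_on_circle_add v bounded_on_circle_const)
  have X: "bounded_on_circle (X n)" for n
  proof (induction n)
    case 0
    have "X 0 = (\<lambda>_. 0)" by (simp add: X_def)
    then show ?case by simp
  next
    case (Suc n)
    then have "bounded_on_circle (\<lambda>\<zeta>. max (X n \<zeta>) (S (Suc n) \<zeta>))"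
      by (intro bounded_on_circle_max S)
    then show ?case by (simp only: XS[symmetric])
  qed
  note [measurable] = bounded_on_circle_measurable[OF X]
  have lt: "norm (of_real r * \<zeta>) < 1" if "norm \<zeta> = 1" for \<zeta> :: complex
    using r that by (simp add: norm_mult)
  have X_nonneg: "0 \<le> X n \<zeta>" for n \<zeta>
    by (induction n) (auto simp: X0 XS)
  have X_mono: "X m \<zeta> \<le> X n \<zeta>" if "m \<le> n" for m n \<zeta>
    using that by (induction rule: dec_induct) (auto simp: XS)
  have S_le_X: "S n \<zeta> \<le> X N \<zeta>" if "n \<le> N" for n \<zeta>
  proof (cases n)
    case 0 then show ?thesis using X_nonneg by (simp add: S_def)
  next
    case (Suc m)
    then have "S n \<zeta> \<le> X n \<zeta>" by (simp add: XS)
    then show ?thesis using X_mono[OF that, of \<zeta>] by simp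
  qed
  have X_cases: "X n \<zeta> = 0 \<or> (\<exists>m<n. X n \<zeta> = S (Suc m) \<zeta>)" for n \<zeta>
    by (induction n) (auto simp: X0 XS max_def intro: less_SucI)
  have S_Suc: "S (Suc m) \<zeta> = v 0 \<zeta> - \<alpha> + poisson_integral (S m) (of_real r * \<zeta>)"
    if "norm \<zeta> = 1" for m \<zeta>
  proof -
    have "poisson_integral (S m) (of_real r * \<zeta>) = (\<Sum>k<m. v (Suc k) \<zeta> + (- \<alpha>))"
      unfolding S_def using that lt[OF that] v
      by (subst poisson_integral_sum)
         (auto simp: poisson_integral_add poisson_integral_const step
               simp del: add_uminus_conv_diff intro!: bounded_on_circle_add)
    moreover have "S (Suc m) \<zeta> = v 0 \<zeta> - \<alpha> + (\<Sum>k<m. v (Suc k) \<zeta> + (- \<alpha>))"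
      unfolding S_def by (subst sum.lessThan_Suc_shift) simp
    ultimately show ?thesis by simp
  qed
  define E where "E = {\<zeta>. 0 < X N \<zeta>}"
  have [measurable]: "E \<in> sets borel" unfolding E_def by measurable
  have key: "X N \<zeta> - poisson_integral (X N) (of_real r * \<zeta>) \<le> indicator E \<zeta> * (v 0 \<zeta> - \<alpha>)"
    if \<zeta>: "norm \<zeta> = 1" for \<zeta>
  proof (cases "\<zeta> \<in> E")
    case False
    have "0 \<le> poisson_integral (X N) (of_real r * \<zeta>)"
      by (rule poisson_integral_nonneg[OF X lt[OF \<zeta>] X_nonneg])
    then show ?thesis using False by (simp add: E_def)
  next
    case True
    then obtain m where m: "m < N" "X N \<zeta> = S (Suc m) \<zeta>"
      using X_cases[of N \<zeta>] by (auto simp: E_def)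
    have "poisson_integral (S m) (of_real r * \<zeta>) \<le> poisson_integral (X N) (of_real r * \<zeta>)"
      by (rule poisson_integral_mono[OF S X lt[OF \<zeta>]]) (use S_le_X m in auto)
    then show ?thesis using m S_Suc[OF \<zeta>, of m] True by simp
  qed
  have int0: "integrable circle_measure (\<lambda>\<zeta>. indicator E \<zeta> * v 0 \<zeta>)"
    using integrable_mult_indicator[of E circle_measure "v 0"] bounded_on_circle_integrable[OF v]
    by simp
  have int2: "integrable circle_measure (\<lambda>\<zeta>. indicator E \<zeta> * \<alpha>)"
    by (rule circle_integrable_bounded[of _ "\<bar>\<alpha>\<bar>"]) (auto split: split_indicator)
  have int1: "integrable circle_measure (\<lambda>\<zeta>. poisson_integral (X N) (of_real r * \<zeta>))"
    by (intro bounded_on_circle_integrable bounded_on_circle_poisson_integral X r)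
  have "0 = (\<integral>\<zeta>. X N \<zeta> - poisson_integral (X N) (of_real r * \<zeta>) \<partial>circle_measure)"
    using int1 bounded_on_circle_integrable[OF X]
    by (simp add: integral_poisson_integral[OF X r])
  also have "\<dots> \<le> (\<integral>\<zeta>. indicator E \<zeta> * (v 0 \<zeta> - \<alpha>) \<partial>circle_measure)"
    by (rule integral_mono_AE)
       (use int0 int1 int2 bounded_on_circle_integrable[OF X] key in
         \<open>auto intro!: circle_AE_I simp: right_diff_distrib\<close>)
  also have "\<dots> = (\<integral>\<zeta>. indicator E \<zeta> * v 0 \<zeta> \<partial>circle_measure) - \<alpha> * measure circle_measure E"
    using Bochner_Integration.integral_diff[OF int0 int2]
    by (simp add: right_diff_distrib mult.commute)
  also have "(\<integral>\<zeta>. indicator E \<zeta> * v 0 \<zeta> \<partial>circle_measure) \<le> (\<integral>\<zeta>. v 0 \<zeta> \<partial>circle_measure)"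
    by (rule integral_mono_AE)
       (use int0 bounded_on_circle_integrable[OF v] nonneg in
         \<open>auto intro!: circle_AE_I split: split_indicator\<close>)
  finally have "measure circle_measure E \<le> (\<integral>\<zeta>. v 0 \<zeta> \<partial>circle_measure) / \<alpha>"
    using \<open>0 < \<alpha>\<close> by (simp add: field_simps)
  moreover have "{\<zeta>. \<exists>n\<in>{1..N}. \<alpha> * real n < (\<Sum>k<n. v k \<zeta>)} \<subseteq> E"
  proof
    fix \<zeta> assume "\<zeta> \<in> {\<zeta>. \<exists>n\<in>{1..N}. \<alpha> * real n < (\<Sum>k<n. v k \<zeta>)}"
    then obtain n where "n \<le> N" "0 < S n \<zeta>"
      by (auto simp: S_def sum.distrib sum_subtractf mult.commute)
    then show "\<zeta> \<in> E" using S_le_X[of n \<zeta>] by (auto simp: E_def)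
  qed
  ultimately show ?thesis
    using circle.finite_measure_mono[of "{\<zeta>. \<exists>n\<in>{1..N}. \<alpha> * real n < (\<Sum>k<n. v k \<zeta>)}" E]
    by simp
qed

text \<open>
  Passing from radius \<open>y\<close> to the larger radius \<open>x\<close> with \<open>x\<^sup>2 \<le> y\<close> at most halves the
  numerator \<open>1 - y\<^sup>2\<close> and at most doubles the distance to \<open>\<eta>\<close>, which enters squared.
\<close>

lemma poisson_kernel_harnack:
  assumes "norm \<zeta> = 1" "norm \<eta> = 1" "0 \<le> y" "y \<le> x" "x < 1" "x\<^sup>2 \<le> y"
  shows "poisson_kernel (of_real y * \<zeta>) \<eta> \<le> 8 * poisson_kernel (of_real x * \<zeta>) \<eta>"
proof -
  have ne: "norm (\<eta> - of_real x * \<zeta>) > 0"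
    using assms by (auto simp: norm_mult)
  have "norm (\<eta> - of_real x * \<zeta>) \<le> norm (\<eta> - of_real y * \<zeta>) + norm (of_real (y - x) * \<zeta>)"
    by (rule order_trans[OF _ norm_triangle_ineq]) (simp add: algebra_simps)
  also have "norm (of_real (y - x) * \<zeta>) = x - y"
    unfolding norm_mult norm_of_real using assms by simp
  also have "x - y \<le> 1 - y" using assms by simp
  also have "1 - y \<le> norm (\<eta> - of_real y * \<zeta>)"
    using norm_triangle_ineq2[of \<eta> "of_real y * \<zeta>"] assms by (simp add: norm_mult)
  finally have "norm (\<eta> - of_real x * \<zeta>) \<le> 2 * norm (\<eta> - of_real y * \<zeta>)" by simp
  then have d: "(norm (\<eta> - of_real x * \<zeta>))\<^sup>2 \<le> 4 * (norm (\<eta> - of_real y * \<zeta>))\<^sup>2"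
    using power_mono[of "norm (\<eta> - of_real x * \<zeta>)" _ 2] by (fastforce simp: power_mult_distrib)
  have "(x\<^sup>2)\<^sup>2 \<le> y\<^sup>2" using assms by (intro power_mono) auto
  moreover have "x\<^sup>2 \<le> 1" using assms by (intro power_le_one) auto
  then have "(1 - x\<^sup>2) * (1 + x\<^sup>2) \<le> (1 - x\<^sup>2) * 2" by (intro mult_left_mono) auto
  ultimately have n: "1 - y\<^sup>2 \<le> 2 * (1 - x\<^sup>2)"
    by (simp add: algebra_simps power2_eq_square)
  have ny: "0 \<le> 1 - y\<^sup>2" using assms by (simp add: power_le_one)
  have "(1 - y\<^sup>2) / (norm (\<eta> - of_real y * \<zeta>))\<^sup>2 \<le> (2 * (1 - x\<^sup>2)) / ((norm (\<eta> - of_real x * \<zeta>))\<^sup>2 / 4)"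
    using n d ne ny by (intro frac_le) auto
  then show ?thesis
    using assms by (simp add: poisson_kernel_def norm_mult)
qed

lemma poisson_integral_harnack:
  assumes h: "bounded_on_circle h" "\<And>\<eta>. norm \<eta> = 1 \<Longrightarrow> 0 \<le> h \<eta>"
    and "norm \<zeta> = 1" "0 \<le> y" "y \<le> x" "x < 1" "x\<^sup>2 \<le> y"
  shows "poisson_integral h (of_real y * \<zeta>) \<le> 8 * poisson_integral h (of_real x * \<zeta>)"
proof -
  have lt: "norm (of_real y * \<zeta>) < 1" "norm (of_real x * \<zeta>) < 1"
    using assms by (auto simp: norm_mult)
  have "poisson_integral h (of_real y * \<zeta>)
      \<le> (\<integral>\<eta>. 8 * (poisson_kernel (of_real x * \<zeta>) \<eta> * h \<eta>) \<partial>circle_measure)"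
    unfolding poisson_integral_def
  proof (rule integral_mono_AE)
    show "AE \<eta> in circle_measure. poisson_kernel (of_real y * \<zeta>) \<eta> * h \<eta>
        \<le> 8 * (poisson_kernel (of_real x * \<zeta>) \<eta> * h \<eta>)"
      by (rule circle_AE_I)
         (use assms poisson_kernel_harnack[of \<zeta> _ y x] in
           \<open>auto simp: mult.assoc[symmetric] intro!: mult_right_mono\<close>)
  qed (use poisson_integrable h lt in auto)
  then show ?thesis by (simp add: poisson_integral_def)
qed

text \<open>
  Let \<open>U\<close> be the Poisson integral of \<open>\<bar>F\<bar>\<close>. Then \<open>\<bar>F\<bar> \<le> U\<close>, and by Harnack's inequality
  \<open>U(r\<^sup>n \<zeta>) \<le> 8 U(r\<^sup>k \<zeta>)\<close> whenever \<open>k \<le> n \<le> 2k\<close>. At least half of the indices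
  up to \<open>n\<close> are of this kind, so the average of \<open>U(r\<^sup>k \<zeta>)\<close> over \<open>k \<le> n\<close> is at least
  \<open>U(r\<^sup>n \<zeta>) / 16\<close>. The averages are controlled by the maximal ergodic theorem. The
  bound does not depend on \<open>r\<close> and \<open>N\<close>.
\<close>

lemma weak_type_radii:
  assumes [measurable]: "F \<in> borel_measurable borel" and F: "F analytic_on cball 0 1"
    and r: "0 \<le> r" "r < 1" and \<alpha>: "0 < \<alpha>"
  shows "measure circle_measure {\<zeta>. \<exists>n\<in>{1..N}. 16 * \<alpha> < norm (F (of_real (r ^ n) * \<zeta>))}
    \<le> (\<integral>\<zeta>. norm (F \<zeta>) \<partial>circle_measure) / \<alpha>"
proof -
  define h where "h \<zeta> = norm (F \<zeta>)" for \<zeta>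
  have [measurable]: "h \<in> borel_measurable borel" unfolding h_def by measurable
  obtain B where B: "\<And>x. norm x \<le> 1 \<Longrightarrow> norm (F x) \<le> B"
    using analytic_on_cball_bounded[OF F] by blast
  have h: "bounded_on_circle h"
    by (rule bounded_on_circleI[of _ B]) (auto simp: h_def B)
  have h0: "0 \<le> h \<zeta>" for \<zeta> by (simp add: h_def)
  define v where "v k \<zeta> = poisson_integral h (of_real (r ^ Suc k) * \<zeta>)" for k \<zeta>
  have rk: "0 \<le> r ^ Suc k" "r ^ Suc k < 1" for k
    using r power_Suc_less_one[of r k] by (cases "r = 0"; simp)+
  have v: "bounded_on_circle (v k)" for k
    unfolding v_def by (intro bounded_on_circle_poisson_integral h rk)
  note [measurable] = bounded_on_circle_measurable[OF v]
  have lt: "norm (of_real (r ^ Suc n) * \<zeta>) < 1" if "norm \<zeta> = 1" for \<zeta> :: complex and n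
    using rk[of n] that unfolding norm_mult norm_of_real by simp
  have F_le: "norm (F z) \<le> poisson_integral h z" if z: "norm z < 1" for z
  proof -
    have "F z = (\<integral>\<eta>. F \<eta> * poisson_kernel z \<eta> \<partial>circle_measure)"
      by (rule poisson_formula_circle[symmetric]) (use F z in auto)
    then have "norm (F z) \<le> (\<integral>\<eta>. norm (F \<eta> * poisson_kernel z \<eta>) \<partial>circle_measure)"
      by (simp only: integral_norm_bound)
    also have "\<dots> = poisson_integral h z"
      unfolding poisson_integral_def
      by (rule Bochner_Integration.integral_cong)
         (use z poisson_kernel_nonneg[of z] in \<open>auto simp: h_def norm_mult\<close>)
    finally show ?thesis .
  qed
  have sum_ge: "\<alpha> * real n < (\<Sum>k<n. v k \<zeta>)"
    if \<zeta>: "norm \<zeta> = 1" and n: "1 \<le> n" and big: "16 * \<alpha> < norm (F (of_real (r ^ n) * \<zeta>))" for n \<zeta>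
  proof -
    obtain n' where n': "n = Suc n'" using n by (cases n) auto
    define U where "U = poisson_integral h (of_real (r ^ n) * \<zeta>)"
    have U: "16 * \<alpha> < U"
      using big F_le[OF lt[OF \<zeta>, of n']] by (simp add: U_def n')
    have ge: "U / 8 \<le> v k \<zeta>" if k: "k < n" "n \<le> 2 * Suc k" for k
    proof -
      have "U \<le> 8 * v k \<zeta>"
        unfolding U_def v_def
      proof (rule poisson_integral_harnack[OF h h0 \<zeta>])
        show "r ^ n \<le> r ^ Suc k" using k r by (intro power_decreasing) auto
        show "(r ^ Suc k)\<^sup>2 \<le> r ^ n"
          unfolding power_mult[symmetric] using k r by (intro power_decreasing) auto
      qed (use r rk in auto)
      then show ?thesis by simp
    qed
    have "\<alpha> * real n < (real n / 2) * (U / 8)"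
      using U n by (simp add: field_simps)
    also have "\<dots> \<le> (\<Sum>k\<in>{n - n div 2 - 1..<n}. U / 8)"
      using U \<alpha> n by (auto intro!: mult_right_mono simp: of_nat_diff)
    also have "\<dots> \<le> (\<Sum>k\<in>{n - n div 2 - 1..<n}. v k \<zeta>)"
      by (intro sum_mono ge) auto
    also have "\<dots> \<le> (\<Sum>k<n. v k \<zeta>)"
      by (rule sum_mono2) (use lt \<zeta> h h0 in \<open>auto simp: v_def intro!: poisson_integral_nonneg\<close>)
    finally show ?thesis .
  qed
  have "measure circle_measure {\<zeta>. \<exists>n\<in>{1..N}. 16 * \<alpha> < norm (F (of_real (r ^ n) * \<zeta>))}
      \<le> measure circle_measure {\<zeta>. \<exists>n\<in>{1..N}. \<alpha> * real n < (\<Sum>k<n. v k \<zeta>)}"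
  proof (rule circle.finite_measure_mono_AE)
    show "AE \<zeta> in circle_measure. \<zeta> \<in> {\<zeta>. \<exists>n\<in>{1..N}. 16 * \<alpha> < norm (F (of_real (r ^ n) * \<zeta>))}
        \<longrightarrow> \<zeta> \<in> {\<zeta>. \<exists>n\<in>{1..N}. \<alpha> * real n < (\<Sum>k<n. v k \<zeta>)}"
      by (rule circle_AE_I) (use sum_ge in \<open>force simp del: One_nat_def of_real_power\<close>)
  qed simp
  also have "\<dots> \<le> (\<integral>\<zeta>. v 0 \<zeta> \<partial>circle_measure) / \<alpha>"
  proof (rule maximal_ergodic_poisson[OF r \<alpha> v])
    show "v (Suc k) \<zeta> = poisson_integral (v k) (of_real r * \<zeta>)" if "norm \<zeta> = 1" for k \<zeta>
    proof -
      have "norm (of_real r * \<zeta>) < 1" using that r by (simp add: norm_mult)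
      from poisson_integral_semigroup[OF h rk this, of k]
      show ?thesis by (simp add: v_def[abs_def] mult_ac)
    qed
    show "0 \<le> v 0 \<zeta>" if "norm \<zeta> = 1" for \<zeta>
      unfolding v_def using lt[OF that, of 0] h h0 by (intro poisson_integral_nonneg) auto
  qed
  also have "(\<integral>\<zeta>. v 0 \<zeta> \<partial>circle_measure) = (\<integral>\<zeta>. h \<zeta> \<partial>circle_measure)"
    using integral_poisson_integral[OF h r] by (simp add: v_def)
  finally show ?thesis by (simp add: h_def)
qed

section \<open>Functions in the Hardy space\<close>

lemma disc_analytic_measurable [measurable_dest]:
  assumes "f \<in> disc_analytic"
  shows "f \<in> borel_measurable borel"
proof -
  have "(\<lambda>z. if z \<in> unit_disc then f z else 0) \<in> borel_measurable borel"
    using assms by (intro borel_measurable_continuous_on_if holomorphic_on_imp_continuous_on)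
      (auto simp: disc_analytic_def)
  also have "(\<lambda>z. if z \<in> unit_disc then f z else 0) = f"
    using assms by (auto simp: disc_analytic_def)
  finally show ?thesis .
qed

lemma disc_analytic_isCont:
  assumes "f \<in> disc_analytic" "norm z < 1"
  shows "isCont f z"
  using assms unfolding disc_analytic_def
  by (auto intro: holomorphic_on_imp_continuous_on continuous_on_interior)

lemma disc_analytic_power_series:
  assumes "f \<in> disc_analytic"
  obtains a where "\<And>z. norm z < 1 \<Longrightarrow> (\<lambda>n. a n * z ^ n) sums f z"
proof -
  have "(\<lambda>n. (deriv ^^ n) f 0 / fact n * z ^ n) sums f z" if "norm z < 1" for z
    using holomorphic_power_series[of f 0 1 z] assms that by (simp add: disc_analytic_def)
  then show ?thesis by (rule that)
qed

lemma mean_square_sums: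
  assumes [measurable]: "f \<in> borel_measurable borel"
    and f: "\<And>z. norm z < 1 \<Longrightarrow> (\<lambda>n. a n * z ^ n) sums f z" and r: "0 \<le> r" "r < 1"
  shows "(\<lambda>n. (norm (a n))\<^sup>2 * r ^ (2 * n)) sums
    (\<integral>\<zeta>. (norm (f (of_real r * \<zeta>)))\<^sup>2 \<partial>circle_measure)"
proof -
  obtain x where x: "r < x" "x < 1" using r dense by blast
  have s: "summable (\<lambda>n. norm (a n * of_real r ^ n))"
    by (rule powser_insidea[of _ "complex_of_real x"])
       (use f[of "complex_of_real x"] x r in \<open>auto simp: sums_iff\<close>)
  have "(\<lambda>n. (a n * of_real r ^ n) * cnj (a n * of_real r ^ n)) sums
      (\<integral>\<zeta>. f (of_real r * \<zeta>) * cnj (f (of_real r * \<zeta>)) \<partial>circle_measure)"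
    by (rule circle_integral_power_series[OF _ _ s s])
       (use f[of "of_real r * _"] r in \<open>auto simp: norm_mult power_mult_distrib mult.assoc\<close>)
  moreover have "(a n * of_real r ^ n) * cnj (a n * of_real r ^ n)
      = of_real ((norm (a n))\<^sup>2 * r ^ (2 * n))" for n
  proof -
    have "(a n * of_real r ^ n) * cnj (a n * of_real r ^ n) = (a n * cnj (a n)) * of_real (r ^ n * r ^ n)"
      by simp
    also have "\<dots> = of_real ((norm (a n))\<^sup>2) * of_real (r ^ (2 * n))"
      unfolding complex_norm_square by (simp add: mult_2 power_add)
    finally show ?thesis by simp
  qed
  moreover have "(\<integral>\<zeta>. f (of_real r * \<zeta>) * cnj (f (of_real r * \<zeta>)) \<partial>circle_measure)
      = of_real (\<integral>\<zeta>. (norm (f (of_real r * \<zeta>)))\<^sup>2 \<partial>circle_measure)"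
    unfolding complex_norm_square[symmetric] by (rule integral_complex_of_real)
  ultimately show ?thesis by (simp only: sums_of_real_iff)
qed

text \<open>
  Each partial sum is the limit for \<open>r \<rightarrow> 1\<close> of partial sums of the series for the mean squares.
\<close>

lemma H2_coefficients_summable:
  assumes f: "f \<in> H2" and a: "\<And>z. norm z < 1 \<Longrightarrow> (\<lambda>n. a n * z ^ n) sums f z"
  shows "summable (\<lambda>n. (norm (a n))\<^sup>2)"
proof -
  have [measurable]: "f \<in> borel_measurable borel"
    using f disc_analytic_measurable by (auto simp: H2_def)
  obtain C where "\<forall>r\<in>{0..<1}. (\<integral>\<zeta>. (norm (f (of_real r * \<zeta>)))\<^sup>2 \<partial>circle_measure) \<le> C"
    using f unfolding H2_def bdd_above_def by blast
  then have C: "(\<integral>\<zeta>. (norm (f (of_real r * \<zeta>)))\<^sup>2 \<partial>circle_measure) \<le> C" if "0 \<le> r" "r < 1" for r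
    using that by auto
  show ?thesis
  proof (rule summableI_nonneg_bounded)
    fix N
    have le: "(\<Sum>n<N. (norm (a n))\<^sup>2 * r ^ (2 * n)) \<le> C" if r: "0 \<le> r" "r < 1" for r
    proof -
      note s = mean_square_sums[OF _ a r, simplified]
      have "(\<Sum>n<N. (norm (a n))\<^sup>2 * r ^ (2 * n)) \<le> (\<Sum>n. (norm (a n))\<^sup>2 * r ^ (2 * n))"
        by (rule sum_le_suminf) (use s r in \<open>auto simp: sums_iff\<close>)
      then show ?thesis using s C[OF r] by (auto simp: sums_iff)
    qed
    have "((\<lambda>r. \<Sum>n<N. (norm (a n))\<^sup>2 * r ^ (2 * n)) \<longlongrightarrow> (\<Sum>n<N. (norm (a n))\<^sup>2 * 1 ^ (2 * n)))
        (at_left 1)"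
      by (intro tendsto_intros)
    moreover have "eventually (\<lambda>r. (\<Sum>n<N. (norm (a n))\<^sup>2 * r ^ (2 * n)) \<le> C) (at_left 1)"
      using eventually_at_left_real[of 0 1] by (rule eventually_mono) (auto intro: le)
    ultimately have "(\<Sum>n<N. (norm (a n))\<^sup>2 * 1 ^ (2 * n)) \<le> C"
      by (intro tendsto_upperbound) auto
    then show "(\<Sum>n<N. (norm (a n))\<^sup>2) \<le> C" by simp
  qed auto
qed

lemma mean_square_le:
  assumes "f \<in> borel_measurable borel" "\<And>z. norm z < 1 \<Longrightarrow> (\<lambda>n. a n * z ^ n) sums f z"
    and s: "summable (\<lambda>n. (norm (a n))\<^sup>2)" and r: "0 \<le> r" "r < 1"
  shows "(\<integral>\<zeta>. (norm (f (of_real r * \<zeta>)))\<^sup>2 \<partial>circle_measure) \<le> (\<Sum>n. (norm (a n))\<^sup>2)"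
proof -
  note m = mean_square_sums[OF assms(1,2) r]
  have "(\<Sum>n. (norm (a n))\<^sup>2 * r ^ (2 * n)) \<le> (\<Sum>n. (norm (a n))\<^sup>2)"
    by (rule suminf_le) (use m s r in \<open>auto simp: sums_iff intro!: mult_left_le power_le_one\<close>)
  then show ?thesis using m by (auto simp: sums_iff)
qed

text \<open>
  The weak-type bound is applied to the squares of the dilates \<open>f(r\<^sub>j z)\<close>, where
  \<open>r\<^sub>j \<rightarrow> 1\<close>. Every radius \<open>\<rho>\<close> is a limit of powers of the \<open>r\<^sub>j\<close>, so the set where
  the maximal function exceeds \<open>\<beta>\<close> is contained in the limit inferior of the exceptional sets.
  A Borel superset is all that is needed later, which avoids measurability of an uncountable supremum.
\<close>

lemma maximal_function_weak_type:
  assumes f: "f \<in> disc_analytic"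
    and C: "\<And>r. 0 \<le> r \<Longrightarrow> r < 1 \<Longrightarrow> (\<integral>\<zeta>. (norm (f (of_real r * \<zeta>)))\<^sup>2 \<partial>circle_measure) \<le> C"
    and \<beta>: "0 < \<beta>"
  obtains B where "B \<in> sets borel" "measure circle_measure B \<le> 16 * C / \<beta>\<^sup>2"
    "{\<zeta>. norm \<zeta> = 1 \<and> (\<exists>\<rho>. 0 < \<rho> \<and> \<rho> < 1 \<and> \<beta> < norm (f (of_real \<rho> * \<zeta>)))} \<subseteq> B"
proof -
  note [measurable] = disc_analytic_measurable[OF f]
  \<comment> \<open>with \<open>\<rho> = exp (- t)\<close>, approximating \<open>\<rho>\<close> by a power of \<open>r j\<close> is rounding \<open>t * (j + 1)\<close> to an integer\<close>
  define r where "r j = exp (- 1 / (real j + 1))" for j :: nat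
  have r: "0 < r j" "r j < 1" for j by (auto simp: r_def)
  define F where "F j x = (f (of_real (r j) * x))\<^sup>2" for j x
  have [measurable]: "F j \<in> borel_measurable borel" for j unfolding F_def by measurable
  have F: "F j analytic_on cball 0 1" for j
  proof -
    have "(\<lambda>x::complex. of_real (r j) * x) ` ball 0 (1 / r j) \<subseteq> ball 0 1"
    proof
      fix y :: complex assume "y \<in> (\<lambda>x. of_real (r j) * x) ` ball 0 (1 / r j)"
      then obtain x where x: "y = of_real (r j) * x" "norm x < 1 / r j"
        by (metis imageE mem_ball_0)
      then have "norm y = r j * norm x" using r[of j] by (simp add: norm_mult)
      also have "\<dots> < 1" using x r[of j] by (simp add: field_simps)
      finally show "y \<in> ball 0 1" by simp
    qed
    then have "(f \<circ> (\<lambda>x. of_real (r j) * x)) holomorphic_on ball 0 (1 / r j)"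
      using f by (intro holomorphic_on_compose_gen[of _ _ _ "ball 0 1"] holomorphic_intros)
        (auto simp: disc_analytic_def)
    then have "F j holomorphic_on ball 0 (1 / r j)"
      unfolding F_def o_def by (intro holomorphic_intros)
    moreover have "cball 0 1 \<subseteq> ball (0::complex) (1 / r j)"
    proof
      fix x :: complex assume "x \<in> cball 0 1"
      then have "norm x \<le> 1" by simp
      also have "1 < 1 / r j" using r[of j] by simp
      finally show "x \<in> ball 0 (1 / r j)" by simp
    qed
    ultimately show ?thesis unfolding analytic_on_holomorphic by blast
  qed
  \<comment> \<open>\<open>(j + 1)\<^sup>2\<close> exceeds \<open>t * (j + 1)\<close> for every fixed \<open>t\<close> once \<open>j\<close> is large\<close>
  define E where "E j = {\<zeta>. \<exists>n\<in>{1..(j + 1)\<^sup>2}. 16 * (\<beta>\<^sup>2 / 16) < norm (F j (of_real (r j ^ n) * \<zeta>))}" for j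
  have [measurable]: "E j \<in> sets borel" for j unfolding E_def by measurable
  have mE: "measure circle_measure (E j) \<le> 16 * C / \<beta>\<^sup>2" for j
  proof -
    have "measure circle_measure (E j) \<le> (\<integral>\<zeta>. norm (F j \<zeta>) \<partial>circle_measure) / (\<beta>\<^sup>2 / 16)"
      unfolding E_def by (rule weak_type_radii) (use r[of j] \<beta> F in auto)
    also have "\<dots> \<le> C / (\<beta>\<^sup>2 / 16)"
      using C[of "r j"] r[of j] \<beta> by (intro divide_right_mono) (auto simp: F_def norm_power)
    finally show ?thesis by (simp add: mult.commute)
  qed
  define A where "A j = (\<Inter>i\<in>{j..}. E i)" for j
  have [measurable]: "A j \<in> sets borel" for j unfolding A_def by measurable
  have "(\<lambda>j. measure circle_measure (A j)) \<longlonglongrightarrow> measure circle_measure (\<Union>j. A j)"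
    by (rule circle.finite_Lim_measure_incseq) (auto simp: incseq_def A_def)
  moreover have "measure circle_measure (A j) \<le> 16 * C / \<beta>\<^sup>2" for j
  proof -
    have "A j \<subseteq> E j" by (auto simp: A_def)
    then show ?thesis
      using circle.finite_measure_mono[of "A j" "E j"] mE[of j] by simp
  qed
  ultimately have "measure circle_measure (\<Union>j. A j) \<le> 16 * C / \<beta>\<^sup>2"
    by (intro LIMSEQ_le_const2) auto
  moreover have "\<zeta> \<in> (\<Union>j. A j)"
    if \<zeta>: "norm \<zeta> = 1" and \<rho>: "0 < \<rho>" "\<rho> < 1" and big: "\<beta> < norm (f (of_real \<rho> * \<zeta>))" for \<zeta> \<rho>
  proof -
    define t where "t = - ln \<rho>"
    have t: "0 < t" "\<rho> = exp (- t)" using \<rho> by (auto simp: t_def)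
    define n where "n j = nat \<lfloor>t * (real j + 1)\<rfloor>" for j :: nat
    have nle: "real (n j) \<le> t * (real j + 1)" and nge: "t * (real j + 1) \<le> real (n j) + 1" for j
      using t by (auto simp: n_def)
    have "(\<lambda>j. (real (n j) + 1) / (real j + 1)) \<longlonglongrightarrow> t"
    proof (rule tendsto_sandwich)
      show "eventually (\<lambda>j. t \<le> (real (n j) + 1) / (real j + 1)) sequentially"
        using nge by (auto simp: field_simps)
      show "eventually (\<lambda>j. (real (n j) + 1) / (real j + 1) \<le> t + 1 / (real j + 1)) sequentially"
      proof (intro always_eventually allI)
        fix j
        have "(real (n j) + 1) / (real j + 1) \<le> (t * (real j + 1) + 1) / (real j + 1)"
          using nle[of j] by (intro divide_right_mono) auto
        then show "(real (n j) + 1) / (real j + 1) \<le> t + 1 / (real j + 1)"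
          by (simp add: add_divide_distrib)
      qed
      show "(\<lambda>j. t + 1 / (real j + 1)) \<longlonglongrightarrow> t"
        using tendsto_add[OF tendsto_const LIMSEQ_inverse_real_of_nat, of t]
        by (simp add: inverse_eq_divide add.commute)
    qed auto
    then have "(\<lambda>j. exp (- ((real (n j) + 1) / (real j + 1)))) \<longlonglongrightarrow> \<rho>"
      unfolding t(2) by (intro tendsto_intros)
    moreover have "exp (- ((real (n j) + 1) / (real j + 1))) = r j * r j ^ n j" for j
    proof -
      have "- ((real (n j) + 1) / (real j + 1)) = - 1 / (real j + 1) + real (n j) * (- 1 / (real j + 1))"
        by (simp add: add_divide_distrib)
      then show ?thesis by (simp only: r_def exp_of_nat_mult exp_add)
    qed
    ultimately have "(\<lambda>j. of_real (r j * r j ^ n j) * \<zeta>) \<longlonglongrightarrow> of_real \<rho> * \<zeta>"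
      by (intro tendsto_intros) simp
    moreover have "isCont f (of_real \<rho> * \<zeta>)"
      using f \<zeta> \<rho> by (intro disc_analytic_isCont) (auto simp: norm_mult)
    ultimately have "(\<lambda>j. f (of_real (r j * r j ^ n j) * \<zeta>)) \<longlonglongrightarrow> f (of_real \<rho> * \<zeta>)"
      by (rule isCont_tendsto_compose[rotated])
    then have "(\<lambda>j. norm (f (of_real (r j * r j ^ n j) * \<zeta>))) \<longlonglongrightarrow> norm (f (of_real \<rho> * \<zeta>))"
      by (rule tendsto_norm)
    then have "eventually (\<lambda>j. \<beta> < norm (f (of_real (r j * r j ^ n j) * \<zeta>))) sequentially"
      using big by (rule order_tendstoD)
    moreover have "eventually (\<lambda>j. max t (1 / t) \<le> real j) sequentially"
      using filterlim_real_sequentially by (simp only: filterlim_at_top)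
    ultimately have "eventually (\<lambda>j. \<zeta> \<in> E j) sequentially"
    proof eventually_elim
      case (elim j)
      have "1 \<le> t * (real j + 1)" using elim t by (auto simp: field_simps)
      then have "1 \<le> \<lfloor>t * (real j + 1)\<rfloor>" by (simp add: le_floor_iff)
      then have "1 \<le> n j" unfolding n_def by linarith
      moreover have "real (n j) \<le> real ((j + 1)\<^sup>2)"
      proof -
        have "t * (real j + 1) \<le> (real j + 1) * (real j + 1)"
          using elim by (intro mult_right_mono) auto
        then show ?thesis using nle[of j] by (simp add: power2_eq_square algebra_simps)
      qed
      then have "n j \<le> (j + 1)\<^sup>2" by (simp only: of_nat_le_iff)
      moreover have "\<beta>\<^sup>2 < norm (F j (of_real (r j ^ n j) * \<zeta>))"
        using elim \<beta> unfolding F_def norm_power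
        by (intro power_strict_mono) (auto simp: mult_ac)
      ultimately show ?case unfolding E_def by auto
    qed
    then obtain J where "\<And>j. J \<le> j \<Longrightarrow> \<zeta> \<in> E j" by (auto simp: eventually_sequentially)
    then show ?thesis by (auto simp: A_def)
  qed
  ultimately show ?thesis
    by (intro that[of "\<Union>j. A j"]) auto
qed

section \<open>Radial boundary values\<close>

definition radial_interval :: "nat \<Rightarrow> real set" where
  "radial_interval n = {1 - 1 / (real n + 1)<..<1}"

text \<open>
  The Cauchy criterion for the existence of the radial limit, phrased with countably many conditions.
  The intervals are indexed by natural numbers so that the set is visibly Borel.
\<close>

definition radially_Cauchy :: "(complex \<Rightarrow> complex) \<Rightarrow> complex set" where
  "radially_Cauchy f = {\<zeta>. norm \<zeta> = 1 \<and> (\<forall>k::nat. \<exists>n. \<forall>\<rho>\<in>radial_interval n. \<forall>\<sigma>\<in>radial_interval n.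
     norm (f (of_real \<rho> * \<zeta>) - f (of_real \<sigma> * \<zeta>)) \<le> 1 / (real k + 1))}"

lemma radial_intervalD:
  assumes "\<rho> \<in> radial_interval n"
  shows "0 < \<rho>" "\<rho> < 1"
proof -
  have "1 / (real n + 1) \<le> 1" by simp
  moreover have "1 - 1 / (real n + 1) < \<rho>" "\<rho> < 1"
    using assms by (auto simp: radial_interval_def)
  ultimately show "0 < \<rho>" "\<rho> < 1" by linarith+
qed

lemma eventually_radial_interval: "eventually (\<lambda>\<rho>. \<rho> \<in> radial_interval n) (at_left 1)"
  unfolding radial_interval_def greaterThanLessThan_iff
  using eventually_at_left_real[of "1 - 1 / (real n + 1)" 1] by simp

lemma radial_sequence: "eventually (\<lambda>j. 1 - 1 / (real j + 2) \<in> radial_interval n) sequentially"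
proof -
  have "1 - 1 / (real j + 2) \<in> radial_interval n" if "n \<le> j" for j
    using that by (auto simp: radial_interval_def field_simps)
  then show ?thesis by (auto simp: eventually_sequentially)
qed

lemma radial_sequence_at_left: "filterlim (\<lambda>j. 1 - 1 / (real j + 2)) (at_left (1::real)) sequentially"
proof -
  have "(\<lambda>j. 1 - 1 / (real j + 2)) \<longlonglongrightarrow> 1" by real_asymp
  moreover have "eventually (\<lambda>j. 1 - 1 / (real j + 2) \<in> {..<1::real}) sequentially"
    by (auto simp: field_simps)
  ultimately show ?thesis by (simp add: filterlim_at)
qed

lemma radial_interval_eventually:
  assumes "eventually P (at_left (1::real))"
  obtains n where "\<And>\<rho>. \<rho> \<in> radial_interval n \<Longrightarrow> P \<rho>"
proof -
  obtain b where b: "b < 1" "\<And>y. b < y \<Longrightarrow> y < 1 \<Longrightarrow> P y"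
    using assms eventually_at_left[of 0 "1::real" P] by auto
  obtain n where "1 / (real n + 1) < 1 - b"
    using reals_Archimedean[of "1 - b"] b(1) by (auto simp: inverse_eq_divide add.commute)
  then show ?thesis using b(2) by (intro that[of n]) (auto simp: radial_interval_def)
qed

lemma radially_Cauchy_iff:
  assumes "norm \<zeta> = 1"
  shows "\<zeta> \<in> radially_Cauchy f \<longleftrightarrow> (\<exists>l. ((\<lambda>r. f (of_real r * \<zeta>)) \<longlongrightarrow> l) (at_left (1::real)))"
proof
  assume \<zeta>: "\<zeta> \<in> radially_Cauchy f"
  define s where "s j = f (of_real (1 - 1 / (real j + 2)) * \<zeta>)" for j :: nat
  have osc: "\<exists>n. \<forall>\<rho>\<in>radial_interval n. \<forall>\<sigma>\<in>radial_interval n.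
      norm (f (of_real \<rho> * \<zeta>) - f (of_real \<sigma> * \<zeta>)) < e" if e: "0 < e" for e
  proof -
    obtain k where k: "1 / (real k + 1) < e"
      using reals_Archimedean[OF e] by (auto simp: inverse_eq_divide add.commute)
    from \<zeta> obtain n where "\<forall>\<rho>\<in>radial_interval n. \<forall>\<sigma>\<in>radial_interval n.
        norm (f (of_real \<rho> * \<zeta>) - f (of_real \<sigma> * \<zeta>)) \<le> 1 / (real k + 1)"
      unfolding radially_Cauchy_def by blast
    with k show ?thesis by (meson le_less_trans)
  qed
  have "Cauchy s"
  proof (rule CauchyI)
    fix e :: real assume "0 < e"
    from osc[OF this] obtain n where n: "\<forall>\<rho>\<in>radial_interval n. \<forall>\<sigma>\<in>radial_interval n.
        norm (f (of_real \<rho> * \<zeta>) - f (of_real \<sigma> * \<zeta>)) < e" by blast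
    obtain J where "\<And>j. J \<le> j \<Longrightarrow> 1 - 1 / (real j + 2) \<in> radial_interval n"
      using radial_sequence[of n] by (auto simp: eventually_sequentially)
    with n show "\<exists>M. \<forall>m\<ge>M. \<forall>n\<ge>M. norm (s m - s n) < e"
      unfolding s_def by blast
  qed
  then obtain l where l: "s \<longlonglongrightarrow> l" using Cauchy_convergent convergent_def by blast
  have "((\<lambda>r. f (of_real r * \<zeta>)) \<longlongrightarrow> l) (at_left (1::real))"
  proof (rule tendstoI)
    fix e :: real assume e: "0 < e"
    then have "0 < e / 2" by simp
    from osc[OF this] obtain n where n: "\<forall>\<rho>\<in>radial_interval n. \<forall>\<sigma>\<in>radial_interval n.
        norm (f (of_real \<rho> * \<zeta>) - f (of_real \<sigma> * \<zeta>)) < e / 2" by blast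
    have "eventually (\<lambda>j. dist (s j) l < e / 2) sequentially"
      using l e by (intro tendstoD) auto
    with radial_sequence[of n]
    have "eventually (\<lambda>j. dist (s j) l < e / 2 \<and> 1 - 1 / (real j + 2) \<in> radial_interval n) sequentially"
      by eventually_elim auto
    then obtain j where j: "dist (s j) l < e / 2" "1 - 1 / (real j + 2) \<in> radial_interval n"
      using eventually_happens by fastforce
    show "eventually (\<lambda>r. dist (f (of_real r * \<zeta>)) l < e) (at_left 1)"
      using eventually_radial_interval[of n]
    proof eventually_elim
      case (elim r)
      then have "dist (f (of_real r * \<zeta>)) (s j) < e / 2"
        unfolding s_def dist_norm using n j(2) by blast
      then show ?case using j(1) dist_triangle_half_l[of "s j" "f (of_real r * \<zeta>)" e l]
        by (metis dist_commute dist_triangle_half_r)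
    qed
  qed
  then show "\<exists>l. ((\<lambda>r. f (of_real r * \<zeta>)) \<longlongrightarrow> l) (at_left (1::real))" by blast
next
  assume "\<exists>l. ((\<lambda>r. f (of_real r * \<zeta>)) \<longlongrightarrow> l) (at_left (1::real))"
  then obtain l where l: "((\<lambda>r. f (of_real r * \<zeta>)) \<longlongrightarrow> l) (at_left (1::real))" by blast
  have "\<exists>n. \<forall>\<rho>\<in>radial_interval n. \<forall>\<sigma>\<in>radial_interval n.
     norm (f (of_real \<rho> * \<zeta>) - f (of_real \<sigma> * \<zeta>)) \<le> 1 / (real k + 1)" for k :: nat
  proof -
    have "eventually (\<lambda>r. dist (f (of_real r * \<zeta>)) l < 1 / (real k + 1) / 2) (at_left 1)"
      using l by (rule tendstoD) simp
    then obtain n where "\<And>\<rho>. \<rho> \<in> radial_interval n \<Longrightarrow>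
        dist (f (of_real \<rho> * \<zeta>)) l < 1 / (real k + 1) / 2"
      using radial_interval_eventually by blast
    then show ?thesis
      by (metis dist_norm dist_triangle_half_l less_imp_le)
  qed
  then show "\<zeta> \<in> radially_Cauchy f" using assms by (auto simp: radially_Cauchy_def)
qed

text \<open>
  For fixed indices the condition defines an intersection, over all pairs of radii, of closed subsets
  of the circle.
\<close>

lemma radially_Cauchy_borel:
  assumes f: "f \<in> disc_analytic"
  shows "radially_Cauchy f \<in> sets borel"
proof -
  define K where "K k n = {\<zeta>\<in>sphere 0 1. \<forall>\<rho>\<in>radial_interval n. \<forall>\<sigma>\<in>radial_interval n.
     norm (f (of_real \<rho> * \<zeta>) - f (of_real \<sigma> * \<zeta>)) \<le> 1 / (real k + 1)}" for k n :: nat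
  have cont: "continuous_on (sphere 0 1) (\<lambda>\<zeta>. f (of_real \<rho> * \<zeta>))" if "\<rho> \<in> radial_interval n" for \<rho> n
  proof (rule continuous_on_compose2[where g=f and t="ball 0 1"])
    show "continuous_on (ball 0 1) f"
      using f by (auto simp: disc_analytic_def holomorphic_on_imp_continuous_on)
    show "(\<lambda>\<zeta>. of_real \<rho> * \<zeta>) ` sphere 0 1 \<subseteq> ball (0::complex) 1"
      using radial_intervalD[OF that] by (auto simp: norm_mult)
  qed (intro continuous_intros)
  have "closed (K k n)" for k n
  proof -
    have "K k n = sphere 0 1 \<inter> (\<Inter>\<rho>\<in>radial_interval n. \<Inter>\<sigma>\<in>radial_interval n.
        {\<zeta>\<in>sphere 0 1. norm (f (of_real \<rho> * \<zeta>) - f (of_real \<sigma> * \<zeta>)) \<le> 1 / (real k + 1)})"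
      unfolding K_def by auto
    also have "closed \<dots>"
      by (intro closed_Int closed_INT ballI closed_sphere continuous_closed_preimage_constant
            continuous_on_closed_Collect_le continuous_intros cont) auto
    finally show ?thesis .
  qed
  then have [measurable]: "K k n \<in> sets borel" for k n by (simp add: borel_closed)
  have "radially_Cauchy f = (\<Inter>k. \<Union>n. K k n)"
    by (auto simp: radially_Cauchy_def K_def)
  also have "\<dots> \<in> sets borel" by measurable
  finally show ?thesis .
qed

text \<open>
  Points of divergence matter here as well: a null set with respect to \<open>circle_measure\<close>
  need not be Borel. On the circle \<open>boundary\<close> takes one constant value there, and otherwise it is a limit along a
  fixed sequence of radii.
\<close>

lemma boundary_measurable:
  assumes f: "f \<in> disc_analytic"
  shows "boundary f \<in> borel_measurable borel"
proof -
  note [measurable] = disc_analytic_measurable[OF f] radially_Cauchy_borel[OF f]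
  \<comment> \<open>the value of \<open>Lim\<close> where there is no limit\<close>
  define d where "d = (THE l::complex. False)"
  define g where "g \<zeta> = (if norm \<zeta> < 1 then f \<zeta> else if 1 < norm \<zeta> then 0
     else if \<zeta> \<in> radially_Cauchy f then lim (\<lambda>j. f (of_real (1 - 1 / (real j + 2)) * \<zeta>)) else d)" for \<zeta>
  have "boundary f \<zeta> = g \<zeta>" for \<zeta>
  proof -
    consider "norm \<zeta> < 1" | "1 < norm \<zeta>" | "norm \<zeta> = 1" by linarith
    then show ?thesis
    proof cases
      case 1
      have "((\<lambda>r. of_real r * \<zeta>) \<longlongrightarrow> of_real 1 * \<zeta>) (at_left (1::real))"
        by (intro tendsto_intros)
      then have "((\<lambda>r. f (of_real r * \<zeta>)) \<longlongrightarrow> f \<zeta>) (at_left (1::real))"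
        using isCont_tendsto_compose[OF disc_analytic_isCont[OF f 1]] by simp
      then show ?thesis using 1 by (simp add: boundary_def g_def tendsto_Lim)
    next
      case 2
      have "eventually (\<lambda>r. f (of_real r * \<zeta>) = 0) (at_left (1::real))"
      proof (rule eventually_mono[OF eventually_at_left_real[of "1 / norm \<zeta>" 1]])
        fix r assume r: "r \<in> {1 / norm \<zeta><..<1}"
        have n0: "0 < norm \<zeta>" using 2 by linarith
        then have "0 < 1 / norm \<zeta>" by simp
        also have "1 / norm \<zeta> < r" using r by simp
        finally have "0 < r" .
        moreover have "1 < r * norm \<zeta>"
          using mult_strict_right_mono[OF \<open>1 / norm \<zeta> < r\<close> n0] n0 by simp
        ultimately have "1 \<le> norm (of_real r * \<zeta>)"
          by (simp add: norm_mult)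
        then show "f (of_real r * \<zeta>) = 0" using f by (auto simp: disc_analytic_def)
      qed (use 2 in \<open>simp add: divide_less_eq\<close>)
      then have "((\<lambda>r. f (of_real r * \<zeta>)) \<longlongrightarrow> 0) (at_left (1::real))"
        by (rule tendsto_eventually)
      then show ?thesis using 2 by (simp add: boundary_def g_def tendsto_Lim)
    next
      case 3
      show ?thesis
      proof (cases "\<zeta> \<in> radially_Cauchy f")
        case True
        then obtain l where l: "((\<lambda>r. f (of_real r * \<zeta>)) \<longlongrightarrow> l) (at_left (1::real))"
          using radially_Cauchy_iff[OF 3] by blast
        have "(\<lambda>j. f (of_real (1 - 1 / (real j + 2)) * \<zeta>)) \<longlonglongrightarrow> l"
          using filterlim_compose[OF l radial_sequence_at_left] .
        then show ?thesis using 3 True l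
          by (simp add: boundary_def g_def tendsto_Lim limI)
      next
        case False
        then have "(\<lambda>l. ((\<lambda>r. f (of_real r * \<zeta>)) \<longlongrightarrow> l) (at_left (1::real))) = (\<lambda>_. False)"
          using radially_Cauchy_iff[OF 3] by auto
        then show ?thesis using 3 False by (simp add: boundary_def t2_space_class.Lim_def g_def d_def)
      qed
    qed
  qed
  moreover have "g \<in> borel_measurable borel" unfolding g_def by measurable
  ultimately show ?thesis by (simp cong: measurable_cong)
qed

definition taylor_remainder :: "(complex \<Rightarrow> complex) \<Rightarrow> (nat \<Rightarrow> complex) \<Rightarrow> nat \<Rightarrow> complex \<Rightarrow> complex" where
  "taylor_remainder f a N z = (if norm z < 1 then f z - (\<Sum>n<N. a n * z ^ n) else 0)"

lemma taylor_remainder_disc_analytic: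
  assumes "f \<in> disc_analytic"
  shows "taylor_remainder f a N \<in> disc_analytic"
proof -
  have "(\<lambda>z. f z - (\<Sum>n<N. a n * z ^ n)) holomorphic_on ball 0 1"
    using assms by (intro holomorphic_intros) (auto simp: disc_analytic_def)
  then have "taylor_remainder f a N holomorphic_on ball 0 1"
    by (rule holomorphic_transform) (auto simp: taylor_remainder_def)
  then show ?thesis by (auto simp: disc_analytic_def taylor_remainder_def)
qed

lemma taylor_remainder_mean_square:
  assumes f: "f \<in> H2" and a: "\<And>z. norm z < 1 \<Longrightarrow> (\<lambda>n. a n * z ^ n) sums f z"
    and r: "0 \<le> r" "r < 1"
  shows "(\<integral>\<zeta>. (norm (taylor_remainder f a N (of_real r * \<zeta>)))\<^sup>2 \<partial>circle_measure)
    \<le> (\<Sum>n. (norm (a (n + N)))\<^sup>2)"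
proof -
  have fd: "f \<in> disc_analytic" using f by (simp add: H2_def)
  note s = H2_coefficients_summable[OF f a, simplified]
  define c where "c n = (if n \<in> {..<N} then 0 else a n)" for n
  have c: "(\<lambda>n. c n * z ^ n) sums taylor_remainder f a N z" if "norm z < 1" for z
  proof -
    have "(\<lambda>n. if n \<in> {..<N} then 0 else a n * z ^ n) sums (f z - (\<Sum>n<N. a n * z ^ n))"
      by (rule sums_If_finite_set'[OF a[OF that]]) (auto simp: sum_negf)
    moreover have "(\<lambda>n. if n \<in> {..<N} then 0 else a n * z ^ n) = (\<lambda>n. c n * z ^ n)"
      by (auto simp: c_def)
    ultimately show ?thesis using that by (simp add: taylor_remainder_def)
  qed
  have cs: "(\<lambda>n. if n \<in> {..<N} then 0 else (norm (a n))\<^sup>2) sums (\<Sum>n. (norm (a (n + N)))\<^sup>2)"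
    by (rule sums_If_finite_set'[OF summable_sums[OF s]])
       (auto simp: sum_negf suminf_minus_initial_segment[OF s])
  moreover have "(\<lambda>n. if n \<in> {..<N} then 0 else (norm (a n))\<^sup>2) = (\<lambda>n. (norm (c n))\<^sup>2)"
    by (auto simp: c_def)
  ultimately have cs: "(\<lambda>n. (norm (c n))\<^sup>2) sums (\<Sum>n. (norm (a (n + N)))\<^sup>2)" by simp
  show ?thesis
    using mean_square_le[OF disc_analytic_measurable[OF taylor_remainder_disc_analytic[OF fd]] c
        sums_summable[OF cs] r] cs by (simp add: sums_iff)
qed

text \<open>
  A Taylor polynomial is continuous up to the circle, so the oscillation of \<open>f\<close> along a radius is that of
  the Taylor remainder, hence at most twice the maximal function of the remainder. By the weak-type
  bound this exceeds a given number only on a set whose measure tends to 0 with the mean square of the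
  remainder.
\<close>

theorem Fatou_H2:
  assumes f: "f \<in> H2"
  shows "AE \<zeta> in circle_measure. \<zeta> \<in> radially_Cauchy f"
proof -
  have fd: "f \<in> disc_analytic" using f by (simp add: H2_def)
  obtain a where a: "\<And>z. norm z < 1 \<Longrightarrow> (\<lambda>n. a n * z ^ n) sums f z"
    using disc_analytic_power_series[OF fd] by blast
  define tail where "tail N = (\<Sum>n. (norm (a (n + N)))\<^sup>2)" for N
  have tail: "tail \<longlonglongrightarrow> 0"
    unfolding tail_def using suminf_exist_split2[OF H2_coefficients_summable[OF f a]] by simp
  \<comment> \<open>the oscillation picks up two errors at each of the two radii, one from the remainder and one from the polynomial\<close>
  define \<beta> where "\<beta> k = 1 / (real k + 1) / 4" for k :: nat
  have \<beta>: "0 < \<beta> k" for k by (simp add: \<beta>_def)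
  have \<beta>4: "4 * \<beta> k = 1 / (real k + 1)" for k
  proof -
    have "4 * (x / 4) = x" for x :: real by simp
    then show ?thesis unfolding \<beta>_def .
  qed
  define P where "P k N B \<longleftrightarrow> B \<in> sets borel \<and> measure circle_measure B \<le> 16 * tail N / (\<beta> k)\<^sup>2 \<and>
      {\<zeta>. norm \<zeta> = 1 \<and> (\<exists>\<rho>. 0 < \<rho> \<and> \<rho> < 1 \<and>
        \<beta> k < norm (taylor_remainder f a N (of_real \<rho> * \<zeta>)))} \<subseteq> B" for k N B
  have "\<exists>B. P k N B" for k N
  proof -
    obtain B where "B \<in> sets borel" "measure circle_measure B \<le> 16 * tail N / (\<beta> k)\<^sup>2"
      "{\<zeta>. norm \<zeta> = 1 \<and> (\<exists>\<rho>. 0 < \<rho> \<and> \<rho> < 1 \<and>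
        \<beta> k < norm (taylor_remainder f a N (of_real \<rho> * \<zeta>)))} \<subseteq> B"
      by (rule maximal_function_weak_type[OF taylor_remainder_disc_analytic[OF fd], where C="tail N" and \<beta>="\<beta> k"])
         (use taylor_remainder_mean_square[OF f a] \<beta> in \<open>auto simp: tail_def\<close>)
    then show ?thesis unfolding P_def by blast
  qed
  then obtain B where "\<And>k N. P k N (B k N)" by metis
  then have B: "\<And>k N. B k N \<in> sets borel"
      "\<And>k N. measure circle_measure (B k N) \<le> 16 * tail N / (\<beta> k)\<^sup>2"
      "\<And>k N. {\<zeta>. norm \<zeta> = 1 \<and> (\<exists>\<rho>. 0 < \<rho> \<and> \<rho> < 1 \<and>
        \<beta> k < norm (taylor_remainder f a N (of_real \<rho> * \<zeta>)))} \<subseteq> B k N"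
    unfolding P_def by blast+
  note [measurable] = B(1)
  have null: "(\<Inter>N. B k N) \<in> null_sets circle_measure" for k
  proof -
    have "(\<lambda>N. 16 * tail N / (\<beta> k)\<^sup>2) \<longlonglongrightarrow> 16 * 0 / (\<beta> k)\<^sup>2"
      using \<beta>[of k] by (intro tendsto_intros tail) auto
    moreover have "measure circle_measure (\<Inter>N. B k N) \<le> 16 * tail N / (\<beta> k)\<^sup>2" for N
      using circle.finite_measure_mono[of "\<Inter>N. B k N" "B k N"] B(2)[of k N] by force
    ultimately have "measure circle_measure (\<Inter>N. B k N) \<le> 16 * 0 / (\<beta> k)\<^sup>2"
      by (intro LIMSEQ_le_const) auto
    then have "measure circle_measure (\<Inter>N. B k N) = 0"
      by (intro antisym measure_nonneg) simp
    then show ?thesis by (simp add: null_sets_def circle.emeasure_eq_measure)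
  qed
  have "AE \<zeta> in circle_measure. \<forall>k. \<zeta> \<notin> (\<Inter>N. B k N)"
    unfolding AE_all_countable by (intro allI AE_not_in null)
  with AE_circle_norm show ?thesis
  proof eventually_elim
    case (elim \<zeta>)
    have "\<exists>n. \<forall>\<rho>\<in>radial_interval n. \<forall>\<sigma>\<in>radial_interval n.
       norm (f (of_real \<rho> * \<zeta>) - f (of_real \<sigma> * \<zeta>)) \<le> 1 / (real k + 1)" for k
    proof -
      obtain N where N: "\<zeta> \<notin> B k N" using elim by blast
      define p where "p z = (\<Sum>n<N. a n * z ^ n)" for z
      have small: "norm (f (of_real \<rho> * \<zeta>) - p (of_real \<rho> * \<zeta>)) \<le> \<beta> k"
        if "0 < \<rho>" "\<rho> < 1" for \<rho>
      proof -
        have "norm (of_real \<rho> * \<zeta>) < 1" using that elim by (simp add: norm_mult)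
        moreover have "\<not> \<beta> k < norm (taylor_remainder f a N (of_real \<rho> * \<zeta>))"
          using N B(3)[of k N] that elim(1) by blast
        ultimately show ?thesis by (simp add: taylor_remainder_def p_def)
      qed
      have "((\<lambda>\<rho>. p (of_real \<rho> * \<zeta>)) \<longlongrightarrow> p (of_real 1 * \<zeta>)) (at_left (1::real))"
        unfolding p_def by (intro tendsto_intros)
      then have "eventually (\<lambda>\<rho>. dist (p (of_real \<rho> * \<zeta>)) (p \<zeta>) < \<beta> k) (at_left (1::real))"
        using \<beta>[of k] by (intro tendstoD) auto
      then obtain n where n: "\<And>\<rho>. \<rho> \<in> radial_interval n \<Longrightarrow> dist (p (of_real \<rho> * \<zeta>)) (p \<zeta>) < \<beta> k"
        using radial_interval_eventually by blast
      have near: "norm (f (of_real \<rho> * \<zeta>) - p \<zeta>) \<le> 2 * \<beta> k" if "\<rho> \<in> radial_interval n" for \<rho>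
        using small[OF radial_intervalD[OF that]] n[OF that]
          norm_triangle_ineq[of "f (of_real \<rho> * \<zeta>) - p (of_real \<rho> * \<zeta>)" "p (of_real \<rho> * \<zeta>) - p \<zeta>"]
        by (simp add: dist_norm)
      have "norm (f (of_real \<rho> * \<zeta>) - f (of_real \<sigma> * \<zeta>)) \<le> 1 / (real k + 1)"
        if "\<rho> \<in> radial_interval n" "\<sigma> \<in> radial_interval n" for \<rho> \<sigma>
        using near[OF that(1)] near[OF that(2)]
          norm_triangle_ineq4[of "f (of_real \<rho> * \<zeta>) - p \<zeta>" "f (of_real \<sigma> * \<zeta>) - p \<zeta>"]
        by (simp add: \<beta>4[symmetric])
      then show ?thesis by blast
    qed
    then show ?case using elim(1) by (auto simp: radially_Cauchy_def)
  qed
qed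

lemma boundary_tendsto:
  assumes "f \<in> H2"
  shows "AE \<zeta> in circle_measure. ((\<lambda>r. f (of_real r * \<zeta>)) \<longlongrightarrow> boundary f \<zeta>) (at_left (1::real))"
  using AE_circle_norm Fatou_H2[OF assms]
proof eventually_elim
  case (elim \<zeta>)
  then obtain l where "((\<lambda>r. f (of_real r * \<zeta>)) \<longlongrightarrow> l) (at_left (1::real))"
    using radially_Cauchy_iff by blast
  then show ?case unfolding boundary_def using tendsto_Lim[of "at_left (1::real)"] by force
qed

text \<open>
  Fatou's lemma, applied to the squares of the Taylor remainder along a sequence of radii tending to 1.
\<close>

lemma boundary_minus_taylor_polynomial:
  assumes f: "f \<in> H2" and a: "\<And>z. norm z < 1 \<Longrightarrow> (\<lambda>n. a n * z ^ n) sums f z"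
  shows "integrable circle_measure (\<lambda>\<zeta>. (norm (boundary f \<zeta> - (\<Sum>n<N. a n * \<zeta> ^ n)))\<^sup>2)" (is ?I)
    and "(\<integral>\<zeta>. (norm (boundary f \<zeta> - (\<Sum>n<N. a n * \<zeta> ^ n)))\<^sup>2 \<partial>circle_measure)
           \<le> (\<Sum>n. (norm (a (n + N)))\<^sup>2)" (is ?L)
proof -
  have fd: "f \<in> disc_analytic" using f by (simp add: H2_def)
  note [measurable] = boundary_measurable[OF fd]
    disc_analytic_measurable[OF taylor_remainder_disc_analytic[OF fd]]
  define T where "T = (\<Sum>n. (norm (a (n + N)))\<^sup>2)"
  have T: "0 \<le> T" unfolding T_def
    using summable_ignore_initial_segment[OF H2_coefficients_summable[OF f a]]
    by (intro suminf_nonneg) auto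
  define r where "r j = 1 - 1 / (real j + 2)" for j :: nat
  have r: "0 \<le> r j" "r j < 1" for j by (auto simp: r_def field_simps)
  define u where "u j \<zeta> = (norm (taylor_remainder f a N (of_real (r j) * \<zeta>)))\<^sup>2" for j \<zeta>
  have [measurable]: "u j \<in> borel_measurable borel" for j unfolding u_def by measurable
  define w where "w \<zeta> = (norm (boundary f \<zeta> - (\<Sum>n<N. a n * \<zeta> ^ n)))\<^sup>2" for \<zeta>
  have [measurable]: "w \<in> borel_measurable borel" unfolding w_def by measurable
  have "AE \<zeta> in circle_measure. (\<lambda>j. ennreal (u j \<zeta>)) \<longlonglongrightarrow> ennreal (w \<zeta>)"
    using AE_circle_norm boundary_tendsto[OF f]
  proof eventually_elim
    case (elim \<zeta>)
    have "(\<lambda>j. f (of_real (r j) * \<zeta>)) \<longlonglongrightarrow> boundary f \<zeta>"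
      unfolding r_def using filterlim_compose[OF elim(2) radial_sequence_at_left] .
    moreover have "r \<longlonglongrightarrow> 1" unfolding r_def by real_asymp
    ultimately have "(\<lambda>j. (norm (f (of_real (r j) * \<zeta>) - (\<Sum>n<N. a n * (of_real (r j) * \<zeta>) ^ n)))\<^sup>2)
        \<longlonglongrightarrow> (norm (boundary f \<zeta> - (\<Sum>n<N. a n * (of_real 1 * \<zeta>) ^ n)))\<^sup>2"
      by (intro tendsto_intros)
    moreover have "norm (of_real (r j) * \<zeta>) < 1" for j
      using r[of j] elim by (simp add: norm_mult)
    ultimately show ?case
      by (intro tendsto_ennrealI) (simp add: u_def w_def taylor_remainder_def)
  qed
  then have "AE \<zeta> in circle_measure. ennreal (w \<zeta>) = liminf (\<lambda>j. ennreal (u j \<zeta>))"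
    by eventually_elim (simp add: lim_imp_Liminf)
  then have "(\<integral>\<^sup>+\<zeta>. ennreal (w \<zeta>) \<partial>circle_measure)
      = (\<integral>\<^sup>+\<zeta>. liminf (\<lambda>j. ennreal (u j \<zeta>)) \<partial>circle_measure)"
    by (rule nn_integral_cong_AE)
  also have "\<dots> \<le> liminf (\<lambda>j. \<integral>\<^sup>+\<zeta>. ennreal (u j \<zeta>) \<partial>circle_measure)"
    by (rule nn_integral_liminf) measurable
  also have "\<dots> \<le> liminf (\<lambda>j. ennreal T)"
  proof (rule Liminf_mono, rule always_eventually, rule allI)
    fix j
    obtain D where D: "\<And>z. norm z \<le> r j \<Longrightarrow> norm (taylor_remainder f a N z) \<le> D"
    proof -
      have "continuous_on (cball 0 (r j)) (taylor_remainder f a N)"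
        using taylor_remainder_disc_analytic[OF fd, of a N] r[of j]
        by (auto simp: disc_analytic_def intro!: holomorphic_on_imp_continuous_on
              intro: holomorphic_on_subset)
      then have "bounded (taylor_remainder f a N ` cball 0 (r j))"
        by (simp add: compact_continuous_image compact_imp_bounded)
      then show ?thesis unfolding bounded_iff using that by (metis imageI mem_cball_0)
    qed
    have "integrable circle_measure (u j)"
    proof (rule circle_integrable_bounded[of _ "D\<^sup>2"])
      show "norm (u j \<zeta>) \<le> D\<^sup>2" if "norm \<zeta> = 1" for \<zeta>
        using D[of "of_real (r j) * \<zeta>"] that r[of j]
        by (auto simp: u_def norm_mult intro!: power_mono)
    qed simp
    then have "(\<integral>\<^sup>+\<zeta>. ennreal (u j \<zeta>) \<partial>circle_measure) = ennreal (\<integral>\<zeta>. u j \<zeta> \<partial>circle_measure)"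
      by (rule nn_integral_eq_integral) (simp add: u_def)
    also have "\<dots> \<le> ennreal T"
      unfolding T_def u_def by (intro ennreal_leI taylor_remainder_mean_square[OF f a r])
    finally show "(\<integral>\<^sup>+\<zeta>. ennreal (u j \<zeta>) \<partial>circle_measure) \<le> ennreal T" .
  qed
  finally have le: "(\<integral>\<^sup>+\<zeta>. ennreal (w \<zeta>) \<partial>circle_measure) \<le> ennreal T"
    by (simp add: Liminf_const)
  have int: "integrable circle_measure w"
  proof (rule integrableI_bounded)
    have "(\<integral>\<^sup>+\<zeta>. ennreal (norm (w \<zeta>)) \<partial>circle_measure) \<le> ennreal T"
      using le by (simp add: w_def)
    then show "(\<integral>\<^sup>+\<zeta>. ennreal (norm (w \<zeta>)) \<partial>circle_measure) < \<infinity>"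
      by (simp add: order.strict_trans1)
  qed simp
  have "ennreal (\<integral>\<zeta>. w \<zeta> \<partial>circle_measure) \<le> ennreal T"
    using le by (subst nn_integral_eq_integral[symmetric, OF int]) (auto simp: w_def)
  then have "(\<integral>\<zeta>. w \<zeta> \<partial>circle_measure) \<le> T" using T by simp
  with int show ?I ?L by (simp_all add: w_def[abs_def] T_def)
qed

section \<open>Reproducing property and conjugate Toeplitz operators\<close>

text \<open>
  The integral of \<open>(\<bar>u\<bar> - t \<bar>v\<bar>)\<^sup>2\<close> is nonnegative for every real \<open>t\<close>.
\<close>

lemma circle_Cauchy_Schwarz:
  fixes u v :: "complex \<Rightarrow> complex"
  assumes [measurable]: "u \<in> borel_measurable borel" "v \<in> borel_measurable borel"
    and u: "integrable circle_measure (\<lambda>\<zeta>. (norm (u \<zeta>))\<^sup>2)"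
    and v: "integrable circle_measure (\<lambda>\<zeta>. (norm (v \<zeta>))\<^sup>2)"
  shows "integrable circle_measure (\<lambda>\<zeta>. u \<zeta> * v \<zeta>)"
    and "(norm (\<integral>\<zeta>. u \<zeta> * v \<zeta> \<partial>circle_measure))\<^sup>2
      \<le> (\<integral>\<zeta>. (norm (u \<zeta>))\<^sup>2 \<partial>circle_measure) * (\<integral>\<zeta>. (norm (v \<zeta>))\<^sup>2 \<partial>circle_measure)"
proof -
  show int: "integrable circle_measure (\<lambda>\<zeta>. u \<zeta> * v \<zeta>)"
  proof (rule Bochner_Integration.integrable_bound[OF Bochner_Integration.integrable_add[OF u v]])
    have "norm (u \<zeta> * v \<zeta>) \<le> norm ((norm (u \<zeta>))\<^sup>2 + (norm (v \<zeta>))\<^sup>2)" for \<zeta>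
    proof -
      have "0 \<le> (norm (u \<zeta>) - norm (v \<zeta>))\<^sup>2" "0 \<le> norm (u \<zeta>) * norm (v \<zeta>)" by simp_all
      then have "norm (u \<zeta>) * norm (v \<zeta>) \<le> (norm (u \<zeta>))\<^sup>2 + (norm (v \<zeta>))\<^sup>2"
        unfolding power2_diff by linarith
      then show ?thesis by (simp add: norm_mult)
    qed
    then show "AE \<zeta> in circle_measure. norm (u \<zeta> * v \<zeta>) \<le> norm ((norm (u \<zeta>))\<^sup>2 + (norm (v \<zeta>))\<^sup>2)"
      by simp
  qed measurable
  define A where "A = (\<integral>\<zeta>. (norm (u \<zeta>))\<^sup>2 \<partial>circle_measure)"
  define B where "B = (\<integral>\<zeta>. (norm (v \<zeta>))\<^sup>2 \<partial>circle_measure)"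
  define I where "I = (\<integral>\<zeta>. norm (u \<zeta> * v \<zeta>) \<partial>circle_measure)"
  have I: "norm (\<integral>\<zeta>. u \<zeta> * v \<zeta> \<partial>circle_measure) \<le> I"
    unfolding I_def by (rule integral_norm_bound)
  have I0: "0 \<le> I" and B0: "0 \<le> B" unfolding I_def B_def by simp_all
  have quad: "0 \<le> A - 2 * t * I + t\<^sup>2 * B" for t
  proof -
    have "0 \<le> (\<integral>\<zeta>. (norm (u \<zeta>) - t * norm (v \<zeta>))\<^sup>2 \<partial>circle_measure)" by simp
    also have "\<dots> = (\<integral>\<zeta>. (norm (u \<zeta>))\<^sup>2 - 2 * t * norm (u \<zeta> * v \<zeta>) + t\<^sup>2 * (norm (v \<zeta>))\<^sup>2 \<partial>circle_measure)"
      by (intro Bochner_Integration.integral_cong refl)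
         (simp add: power2_diff power_mult_distrib norm_mult mult_ac)
    also have "\<dots> = A - 2 * t * I + t\<^sup>2 * B"
      using u v integrable_norm[OF int] unfolding A_def B_def I_def
      by (simp del: integrable_norm)
    finally show ?thesis .
  qed
  have "I\<^sup>2 \<le> A * B"
  proof (cases "B = 0")
    case True
    have "I = 0"
    proof (rule ccontr)
      assume "I \<noteq> 0"
      then have "2 * ((A + 1) / (2 * I)) * I = A + 1" by simp
      then show False using quad[of "(A + 1) / (2 * I)"] True by simp
    qed
    then show ?thesis using True by simp
  next
    case False
    have "0 \<le> A - 2 * (I / B) * I + (I / B)\<^sup>2 * B" by (rule quad)
    also have "\<dots> = A - I\<^sup>2 / B" using False by (simp add: field_simps power2_eq_square)
    finally show ?thesis using False B0 by (simp add: field_simps)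
  qed
  then show "(norm (\<integral>\<zeta>. u \<zeta> * v \<zeta> \<partial>circle_measure))\<^sup>2
      \<le> (\<integral>\<zeta>. (norm (u \<zeta>))\<^sup>2 \<partial>circle_measure) * (\<integral>\<zeta>. (norm (v \<zeta>))\<^sup>2 \<partial>circle_measure)"
    using power_mono[OF I, of 2] by (simp add: A_def B_def)
qed

definition szego_kernel :: "complex \<Rightarrow> complex \<Rightarrow> complex" where
  "szego_kernel w z = (if z \<in> unit_disc then 1 / (1 - cnj w * z) else 0)"

lemma szego_denominator:
  fixes w z :: complex
  assumes "norm w < 1" "norm z \<le> 1"
  shows "1 - norm w \<le> norm (1 - w * z)" "1 - w * z \<noteq> 0"
proof -
  have "norm (w * z) \<le> norm w" using assms by (simp add: norm_mult mult_left_le)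
  then show *: "1 - norm w \<le> norm (1 - w * z)"
    using norm_triangle_ineq2[of 1 "w * z"] by simp
  show "1 - w * z \<noteq> 0" using * assms by (metis diff_gt_0_iff_gt norm_zero not_le)
qed

lemma HinfE:
  assumes "f \<in> Hinf"
  obtains B where "\<And>z. norm z < 1 \<Longrightarrow> norm (f z) \<le> B"
proof -
  obtain B where "\<forall>x\<in>f ` unit_disc. norm x \<le> B"
    using assms unfolding Hinf_def bounded_iff by blast
  then show ?thesis by (intro that[of B]) auto
qed

lemma HinfI:
  assumes "f \<in> disc_analytic" "\<And>z. norm z < 1 \<Longrightarrow> norm (f z) \<le> B"
  shows "f \<in> Hinf"
  using assms unfolding Hinf_def bounded_iff by (auto intro!: exI[of _ B])

lemma H2I:
  assumes "f \<in> disc_analytic"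
    and "\<And>r. 0 \<le> r \<Longrightarrow> r < 1 \<Longrightarrow> (\<integral>\<zeta>. (norm (f (of_real r * \<zeta>)))\<^sup>2 \<partial>circle_measure) \<le> C"
  shows "f \<in> H2"
  using assms unfolding H2_def bdd_above_def by (auto intro!: exI[of _ C])

lemma Hinf_imp_H2:
  assumes "f \<in> Hinf"
  shows "f \<in> H2"
proof -
  have fd: "f \<in> disc_analytic" using assms by (simp add: Hinf_def)
  note [measurable] = disc_analytic_measurable[OF fd]
  obtain B where B: "\<And>z. norm z < 1 \<Longrightarrow> norm (f z) \<le> B"
    using HinfE[OF assms] by blast
  have "(\<integral>\<zeta>. (norm (f (of_real r * \<zeta>)))\<^sup>2 \<partial>circle_measure) \<le> B\<^sup>2" if r: "0 \<le> r" "r < 1" for r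
  proof -
    have b: "(norm (f (of_real r * \<zeta>)))\<^sup>2 \<le> B\<^sup>2" if "norm \<zeta> = 1" for \<zeta>
      using B[of "of_real r * \<zeta>"] r that by (auto simp: norm_mult intro!: power_mono)
    have "(\<integral>\<zeta>. (norm (f (of_real r * \<zeta>)))\<^sup>2 \<partial>circle_measure) \<le> (\<integral>\<zeta>. B\<^sup>2 \<partial>circle_measure)"
      by (rule integral_mono_AE)
         (use b in \<open>auto intro!: circle_AE_I circle_integrable_bounded[of _ "B\<^sup>2"]\<close>)
    then show ?thesis by simp
  qed
  then show ?thesis by (rule H2I[OF fd])
qed

lemma szego_kernel_Hinf:
  assumes w: "norm w < 1"
  shows "(\<lambda>z. c * szego_kernel w z) \<in> Hinf"
proof -
  have nz: "1 - cnj w * z \<noteq> 0" "1 - norm w \<le> norm (1 - cnj w * z)" if "norm z < 1" for z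
    using szego_denominator[of "cnj w" z] w that by simp_all
  have "(\<lambda>z. c * (1 / (1 - cnj w * z))) holomorphic_on ball 0 1"
    by (intro holomorphic_intros) (use nz in auto)
  then have "(\<lambda>z. c * szego_kernel w z) holomorphic_on ball 0 1"
    by (rule holomorphic_transform) (auto simp: szego_kernel_def)
  moreover have "norm (c * szego_kernel w z) \<le> norm c * (1 / (1 - norm w))" if "norm z < 1" for z
    unfolding norm_mult using nz[OF that] w that
    by (intro mult_left_mono) (auto simp: szego_kernel_def norm_divide intro!: divide_left_mono mult_pos_pos)
  ultimately show ?thesis
    by (intro HinfI) (auto simp: disc_analytic_def szego_kernel_def)
qed

lemma boundary_szego_kernel:
  assumes w: "norm w < 1" and \<zeta>: "norm \<zeta> = 1"
  shows "boundary (\<lambda>z. c * szego_kernel w z) \<zeta> = c / (1 - cnj w * \<zeta>)"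
proof -
  have "((\<lambda>r. c / (1 - cnj w * (of_real r * \<zeta>))) \<longlongrightarrow> c / (1 - cnj w * (of_real 1 * \<zeta>)))
      (at_left (1::real))"
    by (intro tendsto_intros) (use szego_denominator[of "cnj w" \<zeta>] w \<zeta> in auto)
  moreover have "eventually (\<lambda>r. c / (1 - cnj w * (of_real r * \<zeta>)) = c * szego_kernel w (of_real r * \<zeta>))
      (at_left (1::real))"
    by (rule eventually_mono[OF eventually_at_left_real[of 0 1]])
       (use \<zeta> in \<open>auto simp: szego_kernel_def norm_mult\<close>)
  ultimately have "((\<lambda>r. c * szego_kernel w (of_real r * \<zeta>)) \<longlongrightarrow> c / (1 - cnj w * \<zeta>)) (at_left (1::real))"
    by (subst tendsto_cong[symmetric]) auto
  then show ?thesis unfolding boundary_def by (intro tendsto_Lim) auto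
qed

lemma boundary_square_integrable:
  assumes "f \<in> H2"
  shows "integrable circle_measure (\<lambda>\<zeta>. (norm (boundary f \<zeta>))\<^sup>2)"
proof -
  obtain a where "\<And>z. norm z < 1 \<Longrightarrow> (\<lambda>n. a n * z ^ n) sums f z"
    using disc_analytic_power_series assms by (auto simp: H2_def)
  from boundary_minus_taylor_polynomial(1)[OF assms this, of 0] show ?thesis by simp
qed

lemma szego_square_integrable:
  assumes "norm w < 1"
  shows "integrable circle_measure (\<lambda>\<zeta>. (norm (1 / (1 - w * cnj \<zeta>)))\<^sup>2)"
proof (rule circle_integrable_bounded[of _ "(1 / (1 - norm w))\<^sup>2"])
  show "norm ((norm (1 / (1 - w * cnj \<zeta>)))\<^sup>2) \<le> (1 / (1 - norm w))\<^sup>2" if "norm \<zeta> = 1" for \<zeta>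
    using szego_denominator[OF assms, of "cnj \<zeta>"] assms that
    by (auto simp: norm_divide norm_power intro!: power_mono divide_left_mono mult_pos_pos)
qed measurable

text \<open>
  Cauchy's formula holds for the Taylor polynomials, and these approximate the boundary function in the
  mean square.
\<close>

lemma H2_reproducing:
  assumes f: "f \<in> H2" and w: "norm w < 1"
  shows "integrable circle_measure (\<lambda>\<zeta>. boundary f \<zeta> * (1 / (1 - w * cnj \<zeta>)))"
    and "(\<integral>\<zeta>. boundary f \<zeta> * (1 / (1 - w * cnj \<zeta>)) \<partial>circle_measure) = f w"
proof -
  have fd: "f \<in> disc_analytic" using f by (simp add: H2_def)
  note [measurable] = boundary_measurable[OF fd]
  obtain a where a: "\<And>z. norm z < 1 \<Longrightarrow> (\<lambda>n. a n * z ^ n) sums f z"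
    using disc_analytic_power_series[OF fd] by blast
  define k where "k \<zeta> = 1 / (1 - w * cnj \<zeta>)" for \<zeta>
  have [measurable]: "k \<in> borel_measurable borel" unfolding k_def by measurable
  have k: "integrable circle_measure (\<lambda>\<zeta>. (norm (k \<zeta>))\<^sup>2)"
    unfolding k_def by (rule szego_square_integrable[OF w])
  define p where "p N z = (\<Sum>n<N. a n * z ^ n)" for N z
  have [measurable]: "p N \<in> borel_measurable borel" for N unfolding p_def by measurable
  define tail where "tail N = (\<Sum>n. (norm (a (n + N)))\<^sup>2)" for N
  have tail: "tail \<longlonglongrightarrow> 0"
    unfolding tail_def using suminf_exist_split2[OF H2_coefficients_summable[OF f a]] by simp
  show int: "integrable circle_measure (\<lambda>\<zeta>. boundary f \<zeta> * (1 / (1 - w * cnj \<zeta>)))"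
    using circle_Cauchy_Schwarz(1)[of "boundary f" k] boundary_square_integrable[OF f] k
    by (simp add: k_def)
  define K where "K = (\<integral>\<zeta>. (norm (k \<zeta>))\<^sup>2 \<partial>circle_measure)"
  have K0: "0 \<le> K" by (simp add: K_def)
  have est: "(norm ((\<integral>\<zeta>. boundary f \<zeta> * k \<zeta> \<partial>circle_measure) - p N w))\<^sup>2 \<le> tail N * K" for N
  proof -
    note D = boundary_minus_taylor_polynomial[OF f a, of N, folded p_def tail_def]
    have pint: "integrable circle_measure (\<lambda>\<zeta>. p N \<zeta> * k \<zeta>)"
    proof (rule circle_Cauchy_Schwarz(1)[OF _ _ _ k])
      show "integrable circle_measure (\<lambda>\<zeta>. (norm (p N \<zeta>))\<^sup>2)"
      proof (rule circle_integrable_bounded[of _ "(\<Sum>n<N. norm (a n))\<^sup>2"])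
        show "norm ((norm (p N \<zeta>))\<^sup>2) \<le> (\<Sum>n<N. norm (a n))\<^sup>2" if "norm \<zeta> = 1" for \<zeta>
          unfolding p_def using that
          by (auto simp: norm_power norm_mult intro!: power_mono sum_norm_le)
      qed measurable
    qed measurable
    have pN: "(\<integral>\<zeta>. p N \<zeta> * k \<zeta> \<partial>circle_measure) = p N w"
    proof -
      have "p N analytic_on cball 0 1" unfolding p_def by (intro analytic_intros)
      from cauchy_formula_circle[OF _ this w] show ?thesis by (simp add: k_def)
    qed
    have "(\<integral>\<zeta>. boundary f \<zeta> * k \<zeta> \<partial>circle_measure) - p N w
        = (\<integral>\<zeta>. (boundary f \<zeta> - p N \<zeta>) * k \<zeta> \<partial>circle_measure)"
      using Bochner_Integration.integral_diff[OF int[folded k_def] pint] pN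
      by (simp add: left_diff_distrib)
    then have "(norm ((\<integral>\<zeta>. boundary f \<zeta> * k \<zeta> \<partial>circle_measure) - p N w))\<^sup>2
        \<le> (\<integral>\<zeta>. (norm (boundary f \<zeta> - p N \<zeta>))\<^sup>2 \<partial>circle_measure) * K"
      using circle_Cauchy_Schwarz(2)[OF _ _ D(1) k] by (simp add: K_def)
    also have "\<dots> \<le> tail N * K" using D(2) K0 by (intro mult_right_mono)
    finally show ?thesis .
  qed
  have "(\<lambda>N. (norm ((\<integral>\<zeta>. boundary f \<zeta> * k \<zeta> \<partial>circle_measure) - p N w))\<^sup>2) \<longlonglongrightarrow> 0"
  proof (rule tendsto_sandwich[OF _ _ tendsto_const])
    show "(\<lambda>N. tail N * K) \<longlonglongrightarrow> 0" using tendsto_mult_left_zero[OF tail] .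
  qed (use est in auto)
  moreover have "(\<lambda>N. p N w) \<longlonglongrightarrow> f w"
    using a[OF w] by (simp add: sums_def p_def)
  then have "(\<lambda>N. (norm ((\<integral>\<zeta>. boundary f \<zeta> * k \<zeta> \<partial>circle_measure) - p N w))\<^sup>2)
      \<longlonglongrightarrow> (norm ((\<integral>\<zeta>. boundary f \<zeta> * k \<zeta> \<partial>circle_measure) - f w))\<^sup>2"
    by (intro tendsto_intros)
  ultimately have "(norm ((\<integral>\<zeta>. boundary f \<zeta> * k \<zeta> \<partial>circle_measure) - f w))\<^sup>2 = 0"
    using LIMSEQ_unique by blast
  then show "(\<integral>\<zeta>. boundary f \<zeta> * (1 / (1 - w * cnj \<zeta>)) \<partial>circle_measure) = f w"
    by (simp add: k_def)
qed

lemma H2_mult: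
  assumes \<phi>: "\<phi> \<in> Hinf" and u: "u \<in> H2"
  shows "(\<lambda>z. \<phi> z * u z) \<in> H2"
proof -
  have d: "\<phi> \<in> disc_analytic" "u \<in> disc_analytic" using assms by (auto simp: Hinf_def H2_def)
  note [measurable] = d[THEN disc_analytic_measurable]
  obtain B where B: "\<And>z. norm z < 1 \<Longrightarrow> norm (\<phi> z) \<le> B"
    using HinfE[OF \<phi>] by blast
  obtain C where "\<forall>r\<in>{0..<1}. (\<integral>\<zeta>. (norm (u (of_real r * \<zeta>)))\<^sup>2 \<partial>circle_measure) \<le> C"
    using u unfolding H2_def bdd_above_def by blast
  then have C: "(\<integral>\<zeta>. (norm (u (of_real r * \<zeta>)))\<^sup>2 \<partial>circle_measure) \<le> C" if "0 \<le> r" "r < 1" for r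
    using that by auto
  have "(\<integral>\<zeta>. (norm (\<phi> (of_real r * \<zeta>) * u (of_real r * \<zeta>)))\<^sup>2 \<partial>circle_measure) \<le> B\<^sup>2 * C"
    if r: "0 \<le> r" "r < 1" for r
  proof -
    have lt: "norm (of_real r * \<zeta>) \<le> r" "norm (of_real r * \<zeta>) < 1" if "norm \<zeta> = 1" for \<zeta> :: complex
      using r that by (auto simp: norm_mult)
    have "continuous_on (cball 0 r) u"
      using d(2) r by (auto simp: disc_analytic_def
          intro!: holomorphic_on_imp_continuous_on elim!: holomorphic_on_subset)
    then have "bounded (u ` cball 0 r)"
      by (simp add: compact_continuous_image compact_imp_bounded)
    then obtain D where D: "\<And>z. norm z \<le> r \<Longrightarrow> norm (u z) \<le> D"
      unfolding bounded_iff by (metis imageI mem_cball_0)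
    have int: "integrable circle_measure (\<lambda>\<zeta>. (norm (u (of_real r * \<zeta>)))\<^sup>2)"
      by (rule circle_integrable_bounded[of _ "D\<^sup>2"]) (use D lt in \<open>auto intro!: power_mono\<close>)
    have le: "(norm (\<phi> (of_real r * \<zeta>) * u (of_real r * \<zeta>)))\<^sup>2 \<le> B\<^sup>2 * (norm (u (of_real r * \<zeta>)))\<^sup>2"
      if "norm \<zeta> = 1" for \<zeta>
      unfolding norm_mult power_mult_distrib
      by (intro mult_right_mono power_mono B lt that) auto
    have "(\<integral>\<zeta>. (norm (\<phi> (of_real r * \<zeta>) * u (of_real r * \<zeta>)))\<^sup>2 \<partial>circle_measure)
        \<le> (\<integral>\<zeta>. B\<^sup>2 * (norm (u (of_real r * \<zeta>)))\<^sup>2 \<partial>circle_measure)"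
    proof (rule integral_mono_AE)
      show i2: "integrable circle_measure (\<lambda>\<zeta>. B\<^sup>2 * (norm (u (of_real r * \<zeta>)))\<^sup>2)"
        using int by simp
      show "integrable circle_measure (\<lambda>\<zeta>. (norm (\<phi> (of_real r * \<zeta>) * u (of_real r * \<zeta>)))\<^sup>2)"
        by (rule Bochner_Integration.integrable_bound[OF i2])
           (use le in \<open>auto intro!: circle_AE_I\<close>)
    qed (use le in \<open>auto intro!: circle_AE_I\<close>)
    also have "\<dots> \<le> B\<^sup>2 * C" using C[OF r] by (simp add: mult_left_mono)
    finally show ?thesis .
  qed
  moreover have "(\<lambda>z. \<phi> z * u z) \<in> disc_analytic"
    using d by (auto simp: disc_analytic_def intro!: holomorphic_intros)
  ultimately show ?thesis by (intro H2I[of _ "B\<^sup>2 * C"])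
qed

lemma boundary_mult:
  assumes "\<phi> \<in> Hinf" "u \<in> H2"
  shows "AE \<zeta> in circle_measure. boundary (\<lambda>z. \<phi> z * u z) \<zeta> = boundary \<phi> \<zeta> * boundary u \<zeta>"
  using boundary_tendsto[OF Hinf_imp_H2[OF assms(1)]] boundary_tendsto[OF assms(2)]
proof eventually_elim
  case (elim \<zeta>)
  show ?case
    using tendsto_Lim[OF _ tendsto_mult[OF elim]] by (simp add: boundary_def)
qed

lemma boundary_norm_le:
  assumes \<phi>: "\<phi> \<in> Hinf" and B: "\<And>z. norm z < 1 \<Longrightarrow> norm (\<phi> z) \<le> B"
  shows "AE \<zeta> in circle_measure. norm (boundary \<phi> \<zeta>) \<le> B"
  using AE_circle_norm boundary_tendsto[OF Hinf_imp_H2[OF \<phi>]]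
proof eventually_elim
  case (elim \<zeta>)
  have "eventually (\<lambda>r. norm (\<phi> (of_real r * \<zeta>)) \<le> B) (at_left (1::real))"
    by (rule eventually_mono[OF eventually_at_left_real[of 0 1]])
       (use elim B in \<open>auto simp: norm_mult\<close>)
  then show ?case
    using tendsto_upperbound[OF tendsto_norm[OF elim(2)]] by simp
qed

text \<open>
  Orthogonality to the boundary functions of the Cauchy kernels expresses \<open>g w\<close> as an integral of
  \<open>h\<close>, so at most one function meets the description of the projection.
\<close>

lemma riesz_projection_eqI:
  assumes [measurable]: "h \<in> borel_measurable borel"
    and h: "integrable circle_measure (\<lambda>\<zeta>. (norm (h \<zeta>))\<^sup>2)"
    and g: "g \<in> H2" "\<And>u. u \<in> H2 \<Longrightarrow> L2_inner (\<lambda>\<zeta>. h \<zeta> - boundary g \<zeta>) (boundary u) = 0"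
  shows "riesz_projection h = g"
proof -
  have val: "g w = (\<integral>\<zeta>. h \<zeta> * (1 / (1 - w * cnj \<zeta>)) \<partial>circle_measure)"
    if w: "norm w < 1" and g: "g \<in> H2"
      "\<And>u. u \<in> H2 \<Longrightarrow> L2_inner (\<lambda>\<zeta>. h \<zeta> - boundary g \<zeta>) (boundary u) = 0" for w g
  proof -
    define s where "s = (\<lambda>z. 1 * szego_kernel w z)"
    have s: "s \<in> Hinf" unfolding s_def by (rule szego_kernel_Hinf[OF w])
    have [measurable]: "boundary g \<in> borel_measurable borel" "boundary s \<in> borel_measurable borel"
      using g(1) s by (auto intro!: boundary_measurable simp: H2_def Hinf_def)
    have hint: "integrable circle_measure (\<lambda>\<zeta>. h \<zeta> * (1 / (1 - w * cnj \<zeta>)))"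
      by (rule circle_Cauchy_Schwarz(1)[OF _ _ h szego_square_integrable[OF w]]) measurable
    have "0 = L2_inner (\<lambda>\<zeta>. h \<zeta> - boundary g \<zeta>) (boundary s)"
      using g(2)[OF Hinf_imp_H2[OF s]] by simp
    also have "\<dots> = (\<integral>\<zeta>. h \<zeta> * (1 / (1 - w * cnj \<zeta>)) - boundary g \<zeta> * (1 / (1 - w * cnj \<zeta>))
        \<partial>circle_measure)"
      unfolding L2_inner_def
    proof (rule circle_integral_cong)
      fix \<zeta> :: complex assume "norm \<zeta> = 1"
      then have "boundary s \<zeta> = 1 / (1 - cnj w * \<zeta>)"
        unfolding s_def by (rule boundary_szego_kernel[OF w])
      then show "(h \<zeta> - boundary g \<zeta>) * cnj (boundary s \<zeta>)
          = h \<zeta> * (1 / (1 - w * cnj \<zeta>)) - boundary g \<zeta> * (1 / (1 - w * cnj \<zeta>))"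
        by (simp add: left_diff_distrib diff_divide_distrib)
    qed measurable
    also have "\<dots> = (\<integral>\<zeta>. h \<zeta> * (1 / (1 - w * cnj \<zeta>)) \<partial>circle_measure) - g w"
      using H2_reproducing[OF g(1) w] hint by (subst Bochner_Integration.integral_diff) auto
    finally show ?thesis by simp
  qed
  show ?thesis
    unfolding riesz_projection_def
  proof (rule the_equality)
    fix g' assume g': "g' \<in> H2 \<and> (\<forall>u\<in>H2. L2_inner (\<lambda>\<zeta>. h \<zeta> - boundary g' \<zeta>) (boundary u) = 0)"
    show "g' = g"
    proof
      fix w show "g' w = g w"
        using val[of w g] val[of w g'] g g' by (cases "norm w < 1") (auto simp: H2_def disc_analytic_def)
    qed
  qed (use g in auto)
qed

lemma boundary_zero: "boundary (\<lambda>z. 0) \<zeta> = 0"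
  unfolding boundary_def by (rule tendsto_Lim) auto

lemma zero_H2: "(\<lambda>z. 0) \<in> H2"
  by (auto simp: H2_def disc_analytic_def)

lemma conj_toeplitz_zero_symbol: "conj_toeplitz (\<lambda>z. 0) f = (\<lambda>z. 0)"
proof -
  have "riesz_projection (\<lambda>\<zeta>. 0) = (\<lambda>z. 0)"
    by (rule riesz_projection_eqI) (auto simp: zero_H2 boundary_zero L2_inner_def)
  then show ?thesis by (simp add: conj_toeplitz_def boundary_zero)
qed

text \<open>
  Pairing with \<open>u\<close> reduces the claim to the reproducing property of \<open>\<phi> u\<close> and of \<open>u\<close> at
  \<open>w\<close>: both sides give the conjugate of \<open>\<phi>(w) u(w)\<close>.
\<close>

theorem conj_toeplitz_szego_kernel:
  assumes \<phi>: "\<phi> \<in> Hinf" and w: "norm w < 1"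
  shows "conj_toeplitz \<phi> (szego_kernel w) = (\<lambda>z. cnj (\<phi> w) * szego_kernel w z)"
  unfolding conj_toeplitz_def
proof (rule riesz_projection_eqI)
  have s: "szego_kernel w \<in> Hinf" using szego_kernel_Hinf[OF w, of 1] by simp
  have bs: "boundary (szego_kernel w) \<zeta> = 1 / (1 - cnj w * \<zeta>)" if "norm \<zeta> = 1" for \<zeta>
    using boundary_szego_kernel[OF w that, of 1] by simp
  have [measurable]: "boundary (szego_kernel w) \<in> borel_measurable borel"
      "boundary \<phi> \<in> borel_measurable borel"
    using s \<phi> by (auto intro!: boundary_measurable simp: Hinf_def)
  show "(\<lambda>\<zeta>. cnj (boundary \<phi> \<zeta>) * boundary (szego_kernel w) \<zeta>) \<in> borel_measurable borel"
    by measurable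
  obtain B where B: "\<And>z. norm z < 1 \<Longrightarrow> norm (\<phi> z) \<le> B"
    using HinfE[OF \<phi>] by blast
  have bB: "AE \<zeta> in circle_measure. norm (boundary \<phi> \<zeta>) \<le> B"
    using boundary_norm_le[OF \<phi>] B by blast
  show "integrable circle_measure (\<lambda>\<zeta>. (norm (cnj (boundary \<phi> \<zeta>) * boundary (szego_kernel w) \<zeta>))\<^sup>2)"
  proof (rule Bochner_Integration.integrable_bound)
    show "integrable circle_measure (\<lambda>\<zeta>. B\<^sup>2 * (norm (boundary (szego_kernel w) \<zeta>))\<^sup>2)"
      using boundary_square_integrable[OF Hinf_imp_H2[OF s]] by simp
    show "AE \<zeta> in circle_measure. norm ((norm (cnj (boundary \<phi> \<zeta>) * boundary (szego_kernel w) \<zeta>))\<^sup>2)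
        \<le> norm (B\<^sup>2 * (norm (boundary (szego_kernel w) \<zeta>))\<^sup>2)"
      using bB
      by eventually_elim (auto simp: norm_mult power_mult_distrib intro!: mult_right_mono power_mono)
  qed measurable
  show "(\<lambda>z. cnj (\<phi> w) * szego_kernel w z) \<in> H2"
    by (intro Hinf_imp_H2 szego_kernel_Hinf w)
  fix u assume u: "u \<in> H2"
  have [measurable]: "boundary u \<in> borel_measurable borel"
      "boundary (\<lambda>z. cnj (\<phi> w) * szego_kernel w z) \<in> borel_measurable borel"
      "boundary (\<lambda>z. \<phi> z * u z) \<in> borel_measurable borel"
    using u H2_mult[OF \<phi> u] szego_kernel_Hinf[OF w, of "cnj (\<phi> w)"]
    by (auto intro!: boundary_measurable simp: H2_def Hinf_def)
  note r1 = H2_reproducing[OF H2_mult[OF \<phi> u] w] and r2 = H2_reproducing[OF u w]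
  have "L2_inner (\<lambda>\<zeta>. cnj (boundary \<phi> \<zeta>) * boundary (szego_kernel w) \<zeta>
        - boundary (\<lambda>z. cnj (\<phi> w) * szego_kernel w z) \<zeta>) (boundary u)
      = (\<integral>\<zeta>. cnj (boundary (\<lambda>z. \<phi> z * u z) \<zeta> * (1 / (1 - w * cnj \<zeta>))
            - \<phi> w * (boundary u \<zeta> * (1 / (1 - w * cnj \<zeta>)))) \<partial>circle_measure)"
    unfolding L2_inner_def
  proof (rule integral_cong_AE)
    show "AE \<zeta> in circle_measure. (cnj (boundary \<phi> \<zeta>) * boundary (szego_kernel w) \<zeta>
        - boundary (\<lambda>z. cnj (\<phi> w) * szego_kernel w z) \<zeta>) * cnj (boundary u \<zeta>)
      = cnj (boundary (\<lambda>z. \<phi> z * u z) \<zeta> * (1 / (1 - w * cnj \<zeta>))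
            - \<phi> w * (boundary u \<zeta> * (1 / (1 - w * cnj \<zeta>))))"
      using AE_circle_norm boundary_mult[OF \<phi> u]
    proof eventually_elim
      case (elim \<zeta>)
      show ?case
        unfolding bs[OF elim(1)] boundary_szego_kernel[OF w elim(1)] elim(2)
        by (simp add: left_diff_distrib right_diff_distrib diff_divide_distrib mult_ac)
    qed
  qed measurable
  also have "\<dots> = cnj (\<integral>\<zeta>. boundary (\<lambda>z. \<phi> z * u z) \<zeta> * (1 / (1 - w * cnj \<zeta>))
            - \<phi> w * (boundary u \<zeta> * (1 / (1 - w * cnj \<zeta>))) \<partial>circle_measure)"
    by (rule Bochner_Integration.integral_cnj)
  also have "(\<integral>\<zeta>. boundary (\<lambda>z. \<phi> z * u z) \<zeta> * (1 / (1 - w * cnj \<zeta>))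
            - \<phi> w * (boundary u \<zeta> * (1 / (1 - w * cnj \<zeta>))) \<partial>circle_measure)
      = \<phi> w * u w - \<phi> w * u w"
    by (subst Bochner_Integration.integral_diff[OF r1(1) integrable_mult_right])
       (simp_all only: r1(2) r2 integral_mult_right_zero)
  finally show "L2_inner (\<lambda>\<zeta>. cnj (boundary \<phi> \<zeta>) * boundary (szego_kernel w) \<zeta>
        - boundary (\<lambda>z. cnj (\<phi> w) * szego_kernel w z) \<zeta>) (boundary u) = 0"
    by simp
qed

section \<open>Geometry of Hilbert spaces of analytic functions\<close>

context analytic_hilbert_space
begin

lemma ip_zero_left: "h \<in> H \<Longrightarrow> ip (\<lambda>z. 0) h = 0"
  using ip_scale[OF zero_mem, of h 0] by simp

lemma sum_mem:
  assumes "\<And>i. i \<in> I \<Longrightarrow> x i \<in> H"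
  shows "(\<lambda>z. \<Sum>i\<in>I. c i * x i z) \<in> H"
  using assms
proof (induction I rule: infinite_finite_induct)
  case (insert i I)
  then show ?case using add_mem[OF scale_mem[of "x i" "c i"]] by simp
qed (simp_all add: zero_mem)

lemma ip_sum_left:
  assumes "\<And>i. i \<in> I \<Longrightarrow> x i \<in> H" "y \<in> H"
  shows "ip (\<lambda>z. \<Sum>i\<in>I. c i * x i z) y = (\<Sum>i\<in>I. c i * ip (x i) y)"
  using assms
proof (induction I rule: infinite_finite_induct)
  case (insert i I)
  have "ip (\<lambda>z. c i * x i z + (\<Sum>i\<in>I. c i * x i z)) y
      = ip (\<lambda>z. c i * x i z) y + ip (\<lambda>z. \<Sum>i\<in>I. c i * x i z) y"
    using insert by (intro ip_add scale_mem sum_mem) auto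
  then show ?case using insert by (simp add: ip_scale)
qed (simp_all add: ip_zero_left)

lemma ip_sum_right:
  assumes "\<And>i. i \<in> I \<Longrightarrow> x i \<in> H" "y \<in> H"
  shows "ip y (\<lambda>z. \<Sum>i\<in>I. c i * x i z) = (\<Sum>i\<in>I. cnj (c i) * ip y (x i))"
proof -
  have "ip y (\<lambda>z. \<Sum>i\<in>I. c i * x i z) = cnj (ip (\<lambda>z. \<Sum>i\<in>I. c i * x i z) y)"
    by (intro ip_cnj sum_mem assms) auto
  also have "\<dots> = (\<Sum>i\<in>I. cnj (c i) * cnj (ip (x i) y))"
    using assms by (simp add: ip_sum_left)
  also have "\<dots> = (\<Sum>i\<in>I. cnj (c i) * ip y (x i))"
    using assms by (intro sum.cong refl) (simp add: ip_cnj[of _ y])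
  finally show ?thesis .
qed

lemma ip_scale_right: "f \<in> H \<Longrightarrow> h \<in> H \<Longrightarrow> ip h (\<lambda>z. c * f z) = cnj c * ip h f"
  using ip_cnj[OF scale_mem, of f h c] ip_cnj[of f h] by (simp add: ip_scale)

lemma ip_add_right:
  "f \<in> H \<Longrightarrow> g \<in> H \<Longrightarrow> h \<in> H \<Longrightarrow> ip h (\<lambda>z. f z + g z) = ip h f + ip h g"
  using ip_cnj[OF add_mem, of f g h] ip_cnj[of f h] ip_cnj[of g h] by (simp add: ip_add)

lemma diff_mem: "f \<in> H \<Longrightarrow> g \<in> H \<Longrightarrow> (\<lambda>z. f z - g z) \<in> H"
  using add_mem[OF _ scale_mem[of g "-1"], of f] by simp

lemma ip_diff_left:
  "f \<in> H \<Longrightarrow> g \<in> H \<Longrightarrow> h \<in> H \<Longrightarrow> ip (\<lambda>z. f z - g z) h = ip f h - ip g h"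
  using ip_add[OF _ scale_mem[of g "-1"], of f h] ip_scale[of g h "-1"] by simp

lemma ip_self_real: "f \<in> H \<Longrightarrow> ip f f = of_real (Re (ip f f))"
  using ip_cnj[of f f] by (metis Reals_cnj_iff of_real_Re)

lemma norm_square_add_scale:
  assumes "f \<in> H" "g \<in> H"
  shows "Re (ip (\<lambda>z. f z + c * g z) (\<lambda>z. f z + c * g z))
       = Re (ip f f) + 2 * Re (cnj c * ip f g) + (norm c)\<^sup>2 * Re (ip g g)"
proof -
  have "ip (\<lambda>z. f z + c * g z) (\<lambda>z. f z + c * g z)
      = ip f f + cnj c * ip f g + c * ip g f + c * cnj c * ip g g"
    using assms by (simp add: ip_add ip_add_right ip_scale ip_scale_right add_mem scale_mem algebra_simps)
  moreover have "Re (c * ip g f) = Re (cnj c * ip f g)"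
    using ip_cnj[OF assms] by (simp add: algebra_simps)
  moreover have "Re (c * cnj c * ip g g) = (norm c)\<^sup>2 * Re (ip g g)"
    by (simp add: complex_norm_square[symmetric] flip: of_real_power)
  ultimately show ?thesis by simp
qed

lemma Cauchy_Schwarz:
  assumes "f \<in> H" "g \<in> H"
  shows "norm (ip f g) \<le> ip_norm ip f * ip_norm ip g"
proof -
  define n where "n = Re (ip g g)"
  have n0: "0 \<le> n" using ip_nonneg[OF assms(2)] by (simp add: n_def)
  have "(norm (ip f g))\<^sup>2 \<le> Re (ip f f) * n"
  proof (cases "n = 0")
    case True
    then have "ip g g = 0" using ip_self_real[OF assms(2)] by (simp add: n_def)
    then have "g = (\<lambda>z. 0)" using ip_definite assms by blast
    then have "ip f g = 0" using ip_cnj[of g f] ip_zero_left assms by simp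
    then show ?thesis using True by simp
  next
    case False
    define c where "c = - ip f g / of_real n"
    have "0 \<le> Re (ip (\<lambda>z. f z + c * g z) (\<lambda>z. f z + c * g z))"
      by (intro ip_nonneg add_mem scale_mem assms)
    also have "\<dots> = Re (ip f f) + 2 * Re (cnj c * ip f g) + (norm c)\<^sup>2 * n"
      unfolding n_def by (rule norm_square_add_scale[OF assms])
    also have "Re (cnj c * ip f g) = - (norm (ip f g))\<^sup>2 / n"
    proof -
      have "cnj c * ip f g = - (ip f g * cnj (ip f g)) / of_real n"
        by (simp add: c_def)
      also have "\<dots> = of_real (- (norm (ip f g))\<^sup>2 / n)"
        unfolding complex_norm_square[symmetric] by simp
      finally show ?thesis by (simp only: Re_complex_of_real)
    qed
    also have "(norm c)\<^sup>2 * n = (norm (ip f g))\<^sup>2 / n"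
      using False by (simp add: c_def norm_divide power_divide power2_eq_square)
    finally have "(norm (ip f g))\<^sup>2 / n \<le> Re (ip f f)" by simp
    then show ?thesis using False n0 by (simp add: field_simps)
  qed
  also have "\<dots> = (ip_norm ip f * ip_norm ip g)\<^sup>2"
    using ip_nonneg[OF assms(1)] ip_nonneg[OF assms(2)]
    by (simp add: ip_norm_def power_mult_distrib n_def)
  finally show ?thesis
    by (rule power2_le_imp_le) (use ip_nonneg assms in \<open>simp add: ip_norm_def\<close>)
qed

text \<open>
  Riesz representation of a bounded linear functional on a subspace. The functional is given by its
  graph \<open>V\<close>, because it is only known on formal linear combinations. The representing vector is
  the limit of a minimising sequence of \<open>\<parallel>x\<parallel>\<^sup>2 - 2 Re a\<close>: the parallelogram law makes the sequence
  Cauchy, since the linear term cancels in it, and the first variation at the minimum identifies the limit.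
\<close>

lemma Riesz_representation_graph:
  assumes V: "\<And>x a. (x, a) \<in> V \<Longrightarrow> x \<in> H" "V \<noteq> {}"
    and add: "\<And>x a y b. (x, a) \<in> V \<Longrightarrow> (y, b) \<in> V \<Longrightarrow> ((\<lambda>z. x z + y z), a + b) \<in> V"
    and scale: "\<And>x a c. (x, a) \<in> V \<Longrightarrow> ((\<lambda>z. c * x z), c * a) \<in> V"
    and bound: "\<And>x a. (x, a) \<in> V \<Longrightarrow> (norm a)\<^sup>2 \<le> C * Re (ip x x)" and "0 \<le> C"
  obtains g where "g \<in> H" "\<And>x a. (x, a) \<in> V \<Longrightarrow> ip x g = a"
proof -
  define J where "J = (\<lambda>(x, a). Re (ip x x) - 2 * Re a)"
  have J_ge: "- C \<le> J (x, a)" if xa: "(x, a) \<in> V" for x a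
  proof -
    define n where "n = Re (ip x x)"
    have n0: "0 \<le> n" using ip_nonneg V(1)[OF xa] by (simp add: n_def)
    have "(2 * norm a)\<^sup>2 \<le> 4 * (C * n)" using bound[OF xa] by (simp add: power_mult_distrib n_def)
    also have "\<dots> \<le> (C + n)\<^sup>2"
      using zero_le_power2[of "C - n"] by (simp add: power2_eq_square algebra_simps)
    finally have "2 * norm a \<le> C + n"
      by (rule power2_le_imp_le) (use \<open>0 \<le> C\<close> n0 in simp)
    then show ?thesis using complex_Re_le_cmod[of a] by (simp add: J_def n_def)
  qed
  then have bdd: "bdd_below (J ` V)" by (auto simp: bdd_below_def intro!: exI[of _ "-C"])
  define m where "m = Inf (J ` V)"
  have m_le: "m \<le> J p" if "p \<in> V" for p
    unfolding m_def using bdd that by (simp add: cInf_lower)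
  have "\<exists>p\<in>V. J p < m + 1 / (real n + 1)" for n :: nat
  proof -
    have "Inf (J ` V) < m + 1 / (real n + 1)" by (simp add: m_def)
    then show ?thesis using cInf_lessD[of "J ` V"] V(2) by blast
  qed
  then obtain P where P: "\<And>n. P n \<in> V" "\<And>n. J (P n) < m + 1 / (real n + 1)" by metis
  define X where "X n = fst (P n)" for n
  define A where "A n = snd (P n)" for n
  have XA: "(X n, A n) \<in> V" "J (X n, A n) < m + 1 / (real n + 1)" for n
    using P by (simp_all add: X_def A_def)
  have XH: "X n \<in> H" for n using V(1)[OF XA(1)] .
  have parallelogram: "Re (ip (\<lambda>z. X i z - X j z) (\<lambda>z. X i z - X j z))
      \<le> 2 * (1 / (real i + 1)) + 2 * (1 / (real j + 1))" for i j
  proof -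
    define s where "s = (\<lambda>z. X i z + X j z)"
    have sH: "s \<in> H" unfolding s_def by (intro add_mem XH)
    have "((\<lambda>z. (1/2) * s z), (1/2) * (A i + A j)) \<in> V"
      unfolding s_def by (intro scale add XA)
    from m_le[OF this]
    have "m \<le> Re (ip (\<lambda>z. (1/2) * s z) (\<lambda>z. (1/2) * s z)) - 2 * Re ((1/2) * (A i + A j))"
      by (simp only: J_def prod.case)
    also have "ip (\<lambda>z. (1/2) * s z) (\<lambda>z. (1/2) * s z) = (1/2) * (cnj (1/2) * ip s s)"
      by (simp only: ip_scale[OF sH scale_mem[OF sH]] ip_scale_right[OF sH sH])
    also have "Re ((1/2) * (cnj (1/2) * ip s s)) = Re (ip s s) / 4" by simp
    also have "2 * Re ((1/2) * (A i + A j)) = Re (A i) + Re (A j)" by simp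
    also have "Re (ip s s) = Re (ip (X i) (X i)) + 2 * Re (ip (X i) (X j)) + Re (ip (X j) (X j))"
      using norm_square_add_scale[OF XH XH, of i 1 j] by (simp add: s_def)
    finally have mid: "4 * m \<le> Re (ip (X i) (X i)) + 2 * Re (ip (X i) (X j)) + Re (ip (X j) (X j))
        - 4 * (Re (A i) + Re (A j))" by (simp add: field_simps)
    have "Re (ip (\<lambda>z. X i z - X j z) (\<lambda>z. X i z - X j z))
        = Re (ip (X i) (X i)) - 2 * Re (ip (X i) (X j)) + Re (ip (X j) (X j))"
      using norm_square_add_scale[OF XH XH, of i "-1" j] by simp
    moreover have "Re (ip (X i) (X i)) - 2 * Re (A i) < m + 1 / (real i + 1)"
      "Re (ip (X j) (X j)) - 2 * Re (A j) < m + 1 / (real j + 1)"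
      using XA(2)[of i] XA(2)[of j] by (simp_all only: J_def prod.case)
    moreover have "y \<le> 2 * di + 2 * dj"
      if "y = ni - 2 * p + nj" "ni - 2 * ai < m + di" "nj - 2 * aj < m + dj"
        "4 * m \<le> ni + 2 * p + nj - 4 * (ai + aj)" for y ni nj p ai aj di dj :: real
    proof -
      have "y \<le> 2 * ni + 2 * nj - 4 * m - 4 * ai - 4 * aj" using that(1,4) by (simp add: algebra_simps)
      then show ?thesis using that(2,3) by (simp add: algebra_simps)
    qed
    ultimately show ?thesis using mid by blast
  qed
  have "\<exists>g\<in>H. (\<lambda>n. ip_norm ip (\<lambda>z. X n z - g z)) \<longlonglongrightarrow> 0"
  proof (rule complete[OF XH])
    fix e :: real assume e: "0 < e"
    obtain N where N: "1 / (real N + 1) < e\<^sup>2 / 4"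
      using reals_Archimedean[of "e\<^sup>2 / 4"] e by (auto simp: inverse_eq_divide add.commute)
    have "ip_norm ip (\<lambda>z. X i z - X j z) < e" if "N \<le> i" "N \<le> j" for i j
    proof -
      have le: "1 / (real i + 1) \<le> 1 / (real N + 1)" "1 / (real j + 1) \<le> 1 / (real N + 1)"
        using that by (auto intro!: divide_left_mono)
      have "Re (ip (\<lambda>z. X i z - X j z) (\<lambda>z. X i z - X j z)) \<le> 2 * (1 / (real i + 1)) + 2 * (1 / (real j + 1))"
        using parallelogram[of i j] by simp
      also have "\<dots> < e\<^sup>2" using le N by linarith
      finally show ?thesis using e by (simp add: ip_norm_def real_less_lsqrt ip_nonneg diff_mem XH)
    qed
    then show "\<exists>N. \<forall>m\<ge>N. \<forall>n\<ge>N. ip_norm ip (\<lambda>z. X m z - X n z) < e" by blast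
  qed
  then obtain g where g: "g \<in> H" "(\<lambda>n. ip_norm ip (\<lambda>z. X n z - g z)) \<longlonglongrightarrow> 0" by blast
  have lim: "(\<lambda>n. ip (X n) y) \<longlonglongrightarrow> ip g y" if y: "y \<in> H" for y
  proof -
    have "(\<lambda>n. ip_norm ip (\<lambda>z. X n z - g z) * ip_norm ip y) \<longlonglongrightarrow> 0"
      using tendsto_mult_left_zero[OF g(2)] .
    then have "(\<lambda>n. ip (X n) y - ip g y) \<longlonglongrightarrow> 0"
    proof (rule Lim_null_comparison[rotated])
      show "eventually (\<lambda>n. norm (ip (X n) y - ip g y) \<le> ip_norm ip (\<lambda>z. X n z - g z) * ip_norm ip y) sequentially"
        using Cauchy_Schwarz[OF diff_mem[OF XH g(1)] y] y XH g(1) by (simp add: ip_diff_left)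
    qed
    then show ?thesis by (rule Lim_null[THEN iffD2])
  qed
  have re: "Re (ip g y) = Re a" if ya: "(y, a) \<in> V" for y a
  proof -
    have y: "y \<in> H" using V(1)[OF ya] .
    define d where "d = Re (ip g y) - Re a"
    define q where "q = Re (ip y y)"
    have ineq: "0 \<le> 2 * t * d + t\<^sup>2 * q" for t
    proof -
      have "m \<le> m + 1 / (real n + 1) + 2 * t * (Re (ip (X n) y) - Re a) + t\<^sup>2 * q" for n
      proof -
        have "((\<lambda>z. X n z + of_real t * y z), A n + of_real t * a) \<in> V"
          by (intro add XA scale ya)
        then have "m \<le> J ((\<lambda>z. X n z + of_real t * y z), A n + of_real t * a)" by (rule m_le)
        also have "\<dots> = J (X n, A n) + 2 * t * (Re (ip (X n) y) - Re a) + t\<^sup>2 * q"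
          unfolding J_def using norm_square_add_scale[OF XH y, of n "of_real t"]
          by (simp add: q_def algebra_simps)
        finally show ?thesis using XA(2)[of n] by simp
      qed
      moreover have "(\<lambda>n. m + 1 / (real n + 1) + 2 * t * (Re (ip (X n) y) - Re a) + t\<^sup>2 * q)
          \<longlonglongrightarrow> m + 0 + 2 * t * (Re (ip g y) - Re a) + t\<^sup>2 * q"
      proof (intro tendsto_intros lim y)
        show "(\<lambda>n. 1 / (real n + 1)) \<longlonglongrightarrow> 0"
          using LIMSEQ_inverse_real_of_nat by (simp add: inverse_eq_divide add.commute)
      qed
      ultimately have "m \<le> m + 0 + 2 * t * (Re (ip g y) - Re a) + t\<^sup>2 * q"
        by (intro LIMSEQ_le_const) auto
      then show ?thesis by (simp add: d_def)
    qed
    have q0: "0 \<le> q" using ip_nonneg[OF y] by (simp add: q_def)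
    \<comment> \<open>the minimiser would be \<open>- d / q\<close>; the shift by 1 covers \<open>q = 0\<close>\<close>
    define t where "t = - d / (q + 1)"
    have t: "t * (q + 1) = - d" using q0 by (simp add: t_def)
    have "0 \<le> (q + 1)\<^sup>2 * (2 * t * d + t\<^sup>2 * q)" by (intro mult_nonneg_nonneg ineq) simp
    also have "\<dots> = 2 * (q + 1) * d * (t * (q + 1)) + (t * (q + 1))\<^sup>2 * q"
      by (simp add: power2_eq_square algebra_simps)
    also have "\<dots> = - (d\<^sup>2 * (q + 2))" unfolding t by (simp add: power2_eq_square algebra_simps)
    finally have "d\<^sup>2 * (q + 2) \<le> 0" by simp
    then have "d\<^sup>2 \<le> 0" using q0 by (simp add: mult_le_0_iff)
    then show ?thesis by (simp add: d_def)
  qed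
  have "ip y g = a" if ya: "(y, a) \<in> V" for y a
  proof -
    have y: "y \<in> H" using V(1)[OF ya] .
    have "Re (ip g (\<lambda>z. \<i> * y z)) = Re (\<i> * a)" by (rule re[OF scale[OF ya]])
    then have "Im (ip g y) = - Im a" using y g(1) by (simp add: ip_scale_right)
    moreover have "ip y g = cnj (ip g y)" by (rule ip_cnj[OF g(1) y])
    ultimately show ?thesis using re[OF ya] by (simp add: complex_eq_iff)
  qed
  then show ?thesis using g(1) that by blast
qed

end

section \<open>Cauchy kernels in a de Branges-Rovnyak space\<close>

lemma szego_sum_analytic:
  assumes "finite S" "S \<subseteq> unit_disc"
  shows "(\<lambda>z. \<Sum>w\<in>S. c w / (1 - cnj w * z)) analytic_on cball 0 1"
proof (intro analytic_intros)
  fix w z assume "w \<in> S" "z \<in> cball (0::complex) 1"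
  then show "1 - cnj w * z \<noteq> 0"
    using szego_denominator(2)[of "cnj w" z] assms by auto
qed

lemma analytic_on_cball_square_integrable:
  assumes [measurable]: "F \<in> borel_measurable borel" and "F analytic_on cball (0::complex) 1"
  shows "integrable circle_measure (\<lambda>\<zeta>. (norm (F \<zeta>))\<^sup>2)"
proof -
  obtain B where B: "\<And>z. norm z \<le> 1 \<Longrightarrow> norm (F z) \<le> B"
    using analytic_on_cball_bounded assms(2) by blast
  show ?thesis
    by (rule circle_integrable_bounded[of _ "B\<^sup>2"]) (use B in \<open>auto intro!: power_mono\<close>)
qed

text \<open>
  By Cauchy's formula, pairing with a combination of Cauchy kernels evaluates \<open>X\<close> at the nodes.
\<close>

lemma szego_sum_pairing:
  assumes [measurable]: "X \<in> borel_measurable borel" and X: "X analytic_on cball 0 1"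
    and S: "finite S" "S \<subseteq> unit_disc"
  shows "(\<integral>\<zeta>. X \<zeta> * cnj (\<Sum>w\<in>S. c w / (1 - cnj w * \<zeta>)) \<partial>circle_measure)
       = (\<Sum>w\<in>S. cnj (c w) * X w)"
proof -
  have int: "integrable circle_measure (\<lambda>\<zeta>. X \<zeta> * (1 / (1 - w * cnj \<zeta>)))" if "w \<in> S" for w
    using that S
    by (intro circle_Cauchy_Schwarz(1) analytic_on_cball_square_integrable X szego_square_integrable) auto
  have "(\<integral>\<zeta>. X \<zeta> * cnj (\<Sum>w\<in>S. c w / (1 - cnj w * \<zeta>)) \<partial>circle_measure)
      = (\<integral>\<zeta>. (\<Sum>w\<in>S. cnj (c w) * (X \<zeta> * (1 / (1 - w * cnj \<zeta>)))) \<partial>circle_measure)"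
    by (intro Bochner_Integration.integral_cong refl) (simp add: sum_distrib_left mult_ac)
  also have "\<dots> = (\<Sum>w\<in>S. \<integral>\<zeta>. cnj (c w) * (X \<zeta> * (1 / (1 - w * cnj \<zeta>))) \<partial>circle_measure)"
    by (rule Bochner_Integration.integral_sum) (rule integrable_mult_right[OF int])
  also have "\<dots> = (\<Sum>w\<in>S. cnj (c w) * X w)"
  proof (rule sum.cong[OF refl])
    fix w assume "w \<in> S"
    then have "norm w < 1" using S by auto
    from cauchy_formula_circle[OF assms(1) X this]
    have "(\<integral>\<zeta>. X \<zeta> * (1 / (1 - w * cnj \<zeta>)) \<partial>circle_measure) = X w" by simp
    then show "(\<integral>\<zeta>. cnj (c w) * (X \<zeta> * (1 / (1 - w * cnj \<zeta>))) \<partial>circle_measure) = cnj (c w) * X w"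
      by (simp only: integral_mult_right_zero)
  qed
  finally show ?thesis .
qed

lemma integral_norm_square_complex:
  "(\<integral>\<zeta>. F \<zeta> * cnj (F \<zeta>) \<partial>circle_measure) = of_real (\<integral>\<zeta>. (norm (F \<zeta>))\<^sup>2 \<partial>circle_measure)"
  unfolding complex_norm_square[symmetric] by (rule integral_complex_of_real)

text \<open>
  Let \<open>F = \<Sum>c\<^sub>w k\<^sub>w\<close> and \<open>G = \<Sum>c\<^sub>w cnj(b w) k\<^sub>w\<close>, the image of \<open>F\<close> under the
  adjoint of multiplication by \<open>b\<close>. The quadratic form on the right is \<open>\<parallel>F\<parallel>\<^sup>2 - \<parallel>G\<parallel>\<^sup>2\<close>. The
  identity \<open>\<parallel>G\<parallel>\<^sup>2 = \<langle>b G, F\<rangle>\<close> and the Cauchy-Schwarz inequality give \<open>\<parallel>G\<parallel> \<le> \<parallel>b F\<parallel>\<close>;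
  the bound on \<open>\<bar>b\<bar>\<^sup>2 + \<bar>h\<bar>\<^sup>2\<close> gives \<open>\<parallel>F\<parallel>\<^sup>2 - \<parallel>b F\<parallel>\<^sup>2 \<ge> \<parallel>h F\<parallel>\<^sup>2\<close>; and a value of \<open>h F\<close>
  at \<open>l\<close> is bounded by its norm.
\<close>

lemma dBR_kernel_dominates_smooth:
  assumes [measurable]: "b \<in> borel_measurable borel" "h \<in> borel_measurable borel"
    and b: "b analytic_on cball 0 1" and h: "h analytic_on cball 0 1"
    and le: "\<And>\<zeta>. norm \<zeta> = 1 \<Longrightarrow> (norm (b \<zeta>))\<^sup>2 + (norm (h \<zeta>))\<^sup>2 \<le> 1"
    and S: "finite S" "S \<subseteq> unit_disc" and l: "norm l < 1"
  shows "(norm (h l * (\<Sum>w\<in>S. c w / (1 - cnj w * l))))\<^sup>2 * (1 - (norm l)\<^sup>2)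
    \<le> Re (\<Sum>w\<in>S. \<Sum>v\<in>S. c w * cnj (c v) * ((1 - cnj (b w) * b v) / (1 - cnj w * v)))"
proof -
  define F where "F z = (\<Sum>w\<in>S. c w / (1 - cnj w * z))" for z
  define G where "G z = (\<Sum>w\<in>S. (c w * cnj (b w)) / (1 - cnj w * z))" for z
  have [measurable]: "F \<in> borel_measurable borel" "G \<in> borel_measurable borel"
    unfolding F_def G_def by measurable
  have F: "F analytic_on cball 0 1" unfolding F_def by (rule szego_sum_analytic[OF S])
  have G: "G analytic_on cball 0 1" unfolding G_def by (rule szego_sum_analytic[OF S])
  define A where "A = (\<integral>\<zeta>. (norm (F \<zeta>))\<^sup>2 \<partial>circle_measure)"
  define B where "B = (\<integral>\<zeta>. (norm (G \<zeta>))\<^sup>2 \<partial>circle_measure)"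
  define D where "D = (\<integral>\<zeta>. (norm (b \<zeta> * F \<zeta>))\<^sup>2 \<partial>circle_measure)"
  define E where "E = (\<integral>\<zeta>. (norm (h \<zeta> * F \<zeta>))\<^sup>2 \<partial>circle_measure)"
  have A: "of_real A = (\<Sum>v\<in>S. cnj (c v) * F v)"
    using szego_sum_pairing[OF _ F S, of c]
    by (simp only: F_def[symmetric] integral_norm_square_complex A_def \<open>F \<in> borel_measurable borel\<close>)
  have "of_real B = (\<Sum>v\<in>S. cnj (c v * cnj (b v)) * G v)"
    using szego_sum_pairing[OF _ G S, of "\<lambda>w. c w * cnj (b w)"]
    by (simp only: G_def[symmetric] integral_norm_square_complex B_def \<open>G \<in> borel_measurable borel\<close>)
  then have B: "of_real B = (\<Sum>v\<in>S. cnj (c v) * (b v * G v))" by (simp add: mult_ac)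
  have bG: "(\<lambda>\<zeta>. b \<zeta> * G \<zeta>) \<in> borel_measurable borel" by measurable
  have B': "of_real B = (\<integral>\<zeta>. G \<zeta> * (b \<zeta> * cnj (F \<zeta>)) \<partial>circle_measure)"
    unfolding B szego_sum_pairing[OF bG analytic_on_mult[OF b G] S, of c, folded F_def, symmetric]
    by (intro Bochner_Integration.integral_cong refl) (simp add: mult_ac)
  have sqD: "integrable circle_measure (\<lambda>\<zeta>. (norm (b \<zeta> * F \<zeta>))\<^sup>2)"
    and sqE: "integrable circle_measure (\<lambda>\<zeta>. (norm (h \<zeta> * F \<zeta>))\<^sup>2)"
    and sqF: "integrable circle_measure (\<lambda>\<zeta>. (norm (F \<zeta>))\<^sup>2)"
    and sqG: "integrable circle_measure (\<lambda>\<zeta>. (norm (G \<zeta>))\<^sup>2)"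
    by (intro analytic_on_cball_square_integrable analytic_on_mult b h F G; measurable)+
  have B0: "0 \<le> B" and D0: "0 \<le> D" by (simp_all add: B_def D_def)
  have "(norm (complex_of_real B))\<^sup>2 \<le> B * (\<integral>\<zeta>. (norm (b \<zeta> * cnj (F \<zeta>)))\<^sup>2 \<partial>circle_measure)"
    unfolding B' unfolding B_def
    by (rule circle_Cauchy_Schwarz(2)) (use sqG sqD in \<open>auto simp: norm_mult\<close>)
  also have "(\<integral>\<zeta>. (norm (b \<zeta> * cnj (F \<zeta>)))\<^sup>2 \<partial>circle_measure) = D"
    by (simp add: D_def norm_mult)
  finally have "B * B \<le> B * D" by (simp add: power2_eq_square)
  then have BD: "B \<le> D" using B0 D0 by (cases "B = 0") auto
  have DE: "D + E \<le> A"
  proof -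
    have "D + E = (\<integral>\<zeta>. (norm (b \<zeta> * F \<zeta>))\<^sup>2 + (norm (h \<zeta> * F \<zeta>))\<^sup>2 \<partial>circle_measure)"
      using sqD sqE by (simp add: D_def E_def)
    also have "\<dots> \<le> A"
      unfolding A_def
    proof (rule integral_mono_AE)
      show "AE \<zeta> in circle_measure. (norm (b \<zeta> * F \<zeta>))\<^sup>2 + (norm (h \<zeta> * F \<zeta>))\<^sup>2 \<le> (norm (F \<zeta>))\<^sup>2"
      proof (rule circle_AE_I)
        fix \<zeta> :: complex assume "norm \<zeta> = 1"
        then have "((norm (b \<zeta>))\<^sup>2 + (norm (h \<zeta>))\<^sup>2) * (norm (F \<zeta>))\<^sup>2 \<le> 1 * (norm (F \<zeta>))\<^sup>2"
          by (intro mult_right_mono le) auto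
        then show "(norm (b \<zeta> * F \<zeta>))\<^sup>2 + (norm (h \<zeta> * F \<zeta>))\<^sup>2 \<le> (norm (F \<zeta>))\<^sup>2"
          by (simp add: norm_mult power_mult_distrib distrib_right)
      qed
    qed (use sqD sqE sqF in auto)
    finally show ?thesis .
  qed
  have point: "(norm (h l * F l))\<^sup>2 * (1 - (norm l)\<^sup>2) \<le> E"
  proof -
    define k where "k \<zeta> = 1 / (1 - l * cnj \<zeta>)" for \<zeta>
    have [measurable]: "k \<in> borel_measurable borel" unfolding k_def by measurable
    have l2: "0 < 1 - (norm l)\<^sup>2" using l by (simp add: power_less_one_iff)
    have "of_real (\<integral>\<zeta>. (norm (k \<zeta>))\<^sup>2 \<partial>circle_measure)
        = (\<integral>\<zeta>. (1 / (1 - cnj l * \<zeta>)) / (1 - l * cnj \<zeta>) \<partial>circle_measure)"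
      unfolding integral_norm_square_complex[symmetric] by (simp add: k_def mult_ac)
    also have "\<dots> = 1 / (1 - cnj l * l)"
    proof (rule cauchy_formula_circle[OF _ _ l])
      show "(\<lambda>\<zeta>. 1 / (1 - cnj l * \<zeta>)) analytic_on cball 0 1"
        using szego_sum_analytic[of "{l}" "\<lambda>_. 1"] l by simp
    qed measurable
    also have "\<dots> = of_real (1 / (1 - (norm l)\<^sup>2))"
      using complex_norm_square[of l] by (simp add: mult.commute)
    finally have k2: "(\<integral>\<zeta>. (norm (k \<zeta>))\<^sup>2 \<partial>circle_measure) = 1 / (1 - (norm l)\<^sup>2)"
      by (simp only: of_real_eq_iff)
    have "h l * F l = (\<integral>\<zeta>. h \<zeta> * F \<zeta> * k \<zeta> \<partial>circle_measure)"
      using cauchy_formula_circle[OF _ analytic_on_mult[OF h F] l] by (simp add: k_def)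
    then have "(norm (h l * F l))\<^sup>2 \<le> E * (1 / (1 - (norm l)\<^sup>2))"
      unfolding E_def k2[symmetric]
      using circle_Cauchy_Schwarz(2)[OF _ _ sqE, of k] szego_square_integrable[OF l]
      by (simp add: k_def)
    then show ?thesis using l2 by (simp add: field_simps)
  qed
  have "(\<Sum>w\<in>S. \<Sum>v\<in>S. c w * cnj (c v) * ((1 - cnj (b w) * b v) / (1 - cnj w * v)))
      = (\<Sum>v\<in>S. \<Sum>w\<in>S. c w * cnj (c v) * ((1 - cnj (b w) * b v) / (1 - cnj w * v)))"
    by (rule sum.swap)
  also have "\<dots> = (\<Sum>v\<in>S. cnj (c v) * F v - cnj (c v) * (b v * G v))"
    unfolding F_def G_def sum_distrib_left sum_subtractf[symmetric]
    by (intro sum.cong refl) (simp add: diff_divide_distrib right_diff_distrib mult_ac)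
  also have "\<dots> = of_real (A - B)" by (simp add: sum_subtractf A B)
  finally show ?thesis
    using point BD DE unfolding F_def by simp
qed

text \<open>
  The dilates \<open>b(r z)\<close> and \<open>h(r z)\<close> are analytic across the circle, and for \<open>r \<rightarrow> 1\<close> the
  inequality for them passes to the limit, as it involves finitely many points of the disc only.
\<close>

lemma dBR_kernel_dominates:
  assumes b: "b \<in> disc_analytic" and h: "h \<in> disc_analytic"
    and le: "\<And>z. norm z < 1 \<Longrightarrow> (norm (b z))\<^sup>2 + (norm (h z))\<^sup>2 \<le> 1"
    and S: "finite S" "S \<subseteq> unit_disc" and l: "norm l < 1"
  shows "(norm (h l * (\<Sum>w\<in>S. c w / (1 - cnj w * l))))\<^sup>2 * (1 - (norm l)\<^sup>2)
    \<le> Re (\<Sum>w\<in>S. \<Sum>v\<in>S. c w * cnj (c v) * ((1 - cnj (b w) * b v) / (1 - cnj w * v)))"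
proof -
  note [measurable] = disc_analytic_measurable[OF b] disc_analytic_measurable[OF h]
  define F where "F = (\<Sum>w\<in>S. c w / (1 - cnj w * l))"
  have lim: "((\<lambda>r. f (of_real r * z)) \<longlongrightarrow> f z) (at_left (1::real))"
    if f: "f \<in> disc_analytic" and z: "norm z < 1" for f z
  proof -
    have "((\<lambda>r. of_real r * z) \<longlongrightarrow> of_real 1 * z) (at_left (1::real))"
      by (intro tendsto_intros)
    then show ?thesis using isCont_tendsto_compose[OF disc_analytic_isCont[OF f z]] by simp
  qed
  have ana: "(\<lambda>z. f (of_real r * z)) analytic_on cball 0 1"
    if f: "f \<in> disc_analytic" and r: "0 < r" "r < 1" for f r
  proof -
    have "f analytic_on ball 0 1"
      using f by (simp add: disc_analytic_def analytic_on_open)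
    moreover have "of_real r * z \<in> ball (0::complex) 1" if "z \<in> cball 0 1" for z
    proof -
      have "r * norm z \<le> r" using that r by (intro mult_left_le) auto
      then have "r * norm z < 1" using r by linarith
      then show ?thesis using r by (simp add: norm_mult)
    qed
    ultimately have "(f \<circ> (\<lambda>z. of_real r * z)) analytic_on cball 0 1"
      by (intro analytic_on_compose_gen[where T="ball 0 1"] analytic_intros)
    then show ?thesis by (simp add: o_def)
  qed
  have "(norm (h (of_real r * l) * F))\<^sup>2 * (1 - (norm l)\<^sup>2)
     \<le> Re (\<Sum>w\<in>S. \<Sum>v\<in>S. c w * cnj (c v) *
           ((1 - cnj (b (of_real r * w)) * b (of_real r * v)) / (1 - cnj w * v)))"
    if r: "0 < r" "r < 1" for r
    unfolding F_def
    by (rule dBR_kernel_dominates_smooth[OF _ _ ana[OF b r] ana[OF h r] _ S l])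
       (use r in \<open>auto intro!: le simp: norm_mult\<close>)
  then have "eventually (\<lambda>r. (norm (h (of_real r * l) * F))\<^sup>2 * (1 - (norm l)\<^sup>2)
     \<le> Re (\<Sum>w\<in>S. \<Sum>v\<in>S. c w * cnj (c v) *
           ((1 - cnj (b (of_real r * w)) * b (of_real r * v)) / (1 - cnj w * v)))) (at_left (1::real))"
    by (intro eventually_mono[OF eventually_at_left_real[of 0 1]]) auto
  moreover have "((\<lambda>r. (norm (h (of_real r * l) * F))\<^sup>2 * (1 - (norm l)\<^sup>2))
      \<longlongrightarrow> (norm (h l * F))\<^sup>2 * (1 - (norm l)\<^sup>2)) (at_left (1::real))"
    by (intro tendsto_intros lim h l)
  moreover have "((\<lambda>r. Re (\<Sum>w\<in>S. \<Sum>v\<in>S. c w * cnj (c v) *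
           ((1 - cnj (b (of_real r * w)) * b (of_real r * v)) / (1 - cnj w * v))))
     \<longlongrightarrow> Re (\<Sum>w\<in>S. \<Sum>v\<in>S. c w * cnj (c v) * ((1 - cnj (b w) * b v) / (1 - cnj w * v))))
     (at_left (1::real))"
  proof (intro tendsto_intros lim b)
    fix w v assume "w \<in> S" "v \<in> S"
    then show w: "norm w < 1" and v: "norm v < 1" using S(2) by auto
    show "1 - cnj w * v \<noteq> 0" using szego_denominator(2)[of "cnj w" v] w v by simp
  qed
  ultimately show ?thesis
    unfolding F_def by (intro tendsto_le) auto
qed

text \<open>
  The functional that sends a combination of the kernels of the space to the same combination of the values
  \<open>k\<^sub>w(l)\<close> is bounded by \<open>dBR_kernel_dominates\<close>. The element representing it has the
  value \<open>k\<^sub>l(w)\<close> at \<open>w\<close>.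
\<close>

theorem szego_kernel_mem_dBR:
  assumes dBR: "de_Branges_Rovnyak_space b H ip"
    and b: "b \<in> disc_analytic" and h: "h \<in> disc_analytic"
    and le: "\<And>z. norm z < 1 \<Longrightarrow> (norm (b z))\<^sup>2 + (norm (h z))\<^sup>2 \<le> 1"
    and l: "norm l < 1" "h l \<noteq> 0"
  shows "szego_kernel l \<in> H"
proof -
  interpret analytic_hilbert_space H ip
    using dBR by (simp add: de_Branges_Rovnyak_space_def)
  have K: "dBR_kernel b w \<in> H" "f w = ip f (dBR_kernel b w)" if "norm w < 1" "f \<in> H" for w f
    using dBR that by (auto simp: de_Branges_Rovnyak_space_def reproducing_kernel_def)
  have KH: "dBR_kernel b w \<in> H" if "norm w < 1" for w
    using K(1)[OF that zero_mem] .
  define x where "x S c = (\<lambda>z. \<Sum>w\<in>S. c w * dBR_kernel b w z)" for S and c :: "complex \<Rightarrow> complex"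
  define a where "a S c = (\<Sum>w\<in>S. c w / (1 - cnj w * l))" for S and c :: "complex \<Rightarrow> complex"
  define V where "V = {(x S c, a S c) | S c. finite S \<and> S \<subseteq> unit_disc}"
  define \<epsilon> where "\<epsilon> = (norm (h l))\<^sup>2 * (1 - (norm l)\<^sup>2)"
  have l2: "0 < 1 - (norm l)\<^sup>2" using l by (simp add: power_less_one_iff)
  have \<epsilon>: "0 < \<epsilon>" unfolding \<epsilon>_def using l l2 by (intro mult_pos_pos) auto
  have VH: "y \<in> H" if "(y, d) \<in> V" for y d
    using that by (auto simp: V_def x_def intro!: sum_mem KH)
  have Vne: "V \<noteq> {}" unfolding V_def by blast
  have Vadd: "((\<lambda>z. y z + y' z), d + d') \<in> V" if yd: "(y, d) \<in> V" "(y', d') \<in> V" for y d y' d'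
  proof -
    obtain S c where S: "y = x S c" "d = a S c" "finite S" "S \<subseteq> unit_disc"
      using yd(1) by (auto simp: V_def)
    obtain S' c' where S': "y' = x S' c'" "d' = a S' c'" "finite S'" "S' \<subseteq> unit_disc"
      using yd(2) by (auto simp: V_def)
    define c'' where "c'' w = (if w \<in> S then c w else 0) + (if w \<in> S' then c' w else 0)" for w
    have "(\<Sum>w\<in>S \<union> S'. c'' w * q w) = (\<Sum>w\<in>S. c w * q w) + (\<Sum>w\<in>S'. c' w * q w)" for q
    proof -
      have "(\<Sum>w\<in>S \<union> S'. c'' w * q w) = (\<Sum>w\<in>S \<union> S'. if w \<in> S then c w * q w else 0)
          + (\<Sum>w\<in>S \<union> S'. if w \<in> S' then c' w * q w else 0)"
        unfolding sum.distrib[symmetric] by (intro sum.cong refl) (auto simp: c''_def distrib_right)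
      also have "\<dots> = (\<Sum>w\<in>S. c w * q w) + (\<Sum>w\<in>S'. c' w * q w)"
        using S S' by (simp add: sum.inter_restrict[symmetric] Int_absorb1 Int_absorb2 Int_commute)
      finally show ?thesis .
    qed
    from this[of "\<lambda>w. 1 / (1 - cnj w * l)"] this[of "\<lambda>w. dBR_kernel b w z" for z]
    have "(\<lambda>z. y z + y' z) = x (S \<union> S') c''" "d + d' = a (S \<union> S') c''"
      by (simp_all add: x_def a_def S S')
    then show ?thesis using S S' by (auto simp: V_def)
  qed
  have Vscale: "((\<lambda>z. k * y z), k * d) \<in> V" if yd: "(y, d) \<in> V" for y d k
  proof -
    obtain S c where S: "y = x S c" "d = a S c" "finite S" "S \<subseteq> unit_disc"
      using yd(1) by (auto simp: V_def)
    have "(\<lambda>z. k * y z) = x S (\<lambda>w. k * c w)" "k * d = a S (\<lambda>w. k * c w)"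
      by (simp_all add: x_def a_def S sum_distrib_left mult.assoc)
    then show ?thesis using S by (auto simp: V_def)
  qed
  have Vbound: "(norm d)\<^sup>2 \<le> 1 / \<epsilon> * Re (ip y y)" if yd: "(y, d) \<in> V" for y d
  proof -
    obtain S c where S: "y = x S c" "d = a S c" "finite S" "S \<subseteq> unit_disc"
      using yd(1) by (auto simp: V_def)
    have lt: "norm w < 1" if "w \<in> S" for w using that S by auto
    have "ip y y = (\<Sum>w\<in>S. c w * ip (dBR_kernel b w) y)"
      unfolding S(1) by (subst x_def, rule ip_sum_left) (auto simp: x_def intro!: sum_mem KH lt)
    also have "\<dots> = (\<Sum>w\<in>S. \<Sum>v\<in>S. c w * cnj (c v) * ((1 - cnj (b w) * b v) / (1 - cnj w * v)))"
    proof (rule sum.cong[OF refl])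
      fix w assume w: "w \<in> S"
      have "ip (dBR_kernel b w) y = (\<Sum>v\<in>S. cnj (c v) * ip (dBR_kernel b w) (dBR_kernel b v))"
        unfolding S(1) x_def by (rule ip_sum_right) (auto intro!: KH lt w)
      also have "\<dots> = (\<Sum>v\<in>S. cnj (c v) * dBR_kernel b w v)"
        by (intro sum.cong refl arg_cong2[of _ _ _ _ "(*)"] K(2)[symmetric] KH lt w)
      finally show "c w * ip (dBR_kernel b w) y
          = (\<Sum>v\<in>S. c w * cnj (c v) * ((1 - cnj (b w) * b v) / (1 - cnj w * v)))"
        using lt by (simp add: sum_distrib_left dBR_kernel_def mult.assoc cong: sum.cong)
    qed
    finally have "(norm (h l * d))\<^sup>2 * (1 - (norm l)\<^sup>2) \<le> Re (ip y y)"
      using dBR_kernel_dominates[OF b h le S(3,4) l(1), of c] by (simp add: S(2) a_def)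
    then have "\<epsilon> * (norm d)\<^sup>2 \<le> Re (ip y y)"
      by (simp add: \<epsilon>_def norm_mult power_mult_distrib mult_ac)
    then show ?thesis using \<epsilon> by (simp add: field_simps)
  qed
  obtain g where g: "g \<in> H" "\<And>y d. (y, d) \<in> V \<Longrightarrow> ip y g = d"
  proof (rule Riesz_representation_graph[of V "1 / \<epsilon>"])
    show "0 \<le> 1 / \<epsilon>" using \<epsilon> by simp
  qed (erule VH | rule Vne | erule (1) Vadd | erule Vscale | erule Vbound | blast)+
  have "g w = szego_kernel l w" for w
  proof (cases "norm w < 1")
    case True
    have "(dBR_kernel b w, 1 / (1 - cnj w * l)) = (x {w} (\<lambda>_. 1), a {w} (\<lambda>_. 1))"
      by (simp add: x_def a_def)
    also have "\<dots> \<in> V"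
      unfolding V_def mem_Collect_eq
      by (rule exI[of _ "{w}"], rule exI[of _ "\<lambda>_. 1"]) (use True in simp)
    finally have "ip (dBR_kernel b w) g = 1 / (1 - cnj w * l)" by (rule g(2))
    moreover have "ip g (dBR_kernel b w) = cnj (ip (dBR_kernel b w) g)"
      by (rule ip_cnj[OF KH[OF True] g(1)])
    ultimately show ?thesis
      using K(2)[OF True g(1)] True by (simp add: szego_kernel_def mult.commute)
  next
    case False
    then show ?thesis using g(1) analytic by (auto simp: szego_kernel_def disc_analytic_def)
  qed
  then have "g = szego_kernel l" by blast
  then show ?thesis using g(1) by simp
qed

section \<open>Operators with many eigenvectors\<close>

context analytic_hilbert_space
begin

text \<open>
  Gram-Schmidt: subtract from the residual for the first \<open>n\<close> vectors its component along
  the residual of \<open>k n\<close>.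
\<close>

lemma orthogonal_residual:
  fixes k :: "nat \<Rightarrow> complex \<Rightarrow> complex"
  assumes k: "\<And>i. k i \<in> H"
  shows "x \<in> H \<Longrightarrow> \<exists>c. \<forall>j<n. ip (\<lambda>z. x z - (\<Sum>i<n. c i * k i z)) (k j) = 0"
proof (induction n arbitrary: x)
  case 0
  then show ?case by simp
next
  case (Suc n)
  obtain c where c: "\<And>j. j < n \<Longrightarrow> ip (\<lambda>z. x z - (\<Sum>i<n. c i * k i z)) (k j) = 0"
    using Suc.IH[OF Suc.prems] by blast
  obtain d where d: "\<And>j. j < n \<Longrightarrow> ip (\<lambda>z. k n z - (\<Sum>i<n. d i * k i z)) (k j) = 0"
    using Suc.IH[OF k] by blast
  define s where "s = (\<lambda>z. \<Sum>i<n. d i * k i z)"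
  define y where "y = (\<lambda>z. x z - (\<Sum>i<n. c i * k i z))"
  define u where "u = (\<lambda>z. k n z - s z)"
  have sH: "s \<in> H" unfolding s_def by (intro sum_mem k)
  have yH: "y \<in> H" unfolding y_def by (intro diff_mem sum_mem k Suc.prems)
  have uH: "u \<in> H" unfolding u_def by (intro diff_mem k sH)
  define \<alpha> where "\<alpha> = ip y u / ip u u"
  define y' where "y' = (\<lambda>z. y z - \<alpha> * u z)"
  have y'H: "y' \<in> H" unfolding y'_def by (intro diff_mem scale_mem yH uH)
  have y': "ip y' v = ip y v - \<alpha> * ip u v" if "v \<in> H" for v
    unfolding y'_def using that by (simp add: ip_diff_left scale_mem ip_scale yH uH)
  have orth: "ip y' (k j) = 0" if "j < n" for j
    using y'[OF k] c[OF that] d[OF that] by (simp add: y_def u_def s_def)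
  have "ip y' u = 0"
  proof (cases "ip u u = 0")
    case True
    then have "u = (\<lambda>z. 0)" using ip_definite uH by blast
    then show ?thesis using ip_cnj[OF zero_mem y'H] ip_zero_left[OF y'H] by simp
  next
    case False
    then show ?thesis using y'[OF uH] by (simp add: \<alpha>_def)
  qed
  moreover have "ip y' s = 0"
    unfolding s_def using orth by (subst ip_sum_right) (auto intro: k y'H)
  moreover have "ip y' (k n) = ip y' u + ip y' s"
    using ip_add_right[OF uH sH y'H] by (simp add: u_def)
  ultimately have orth': "ip y' (k j) = 0" if "j < Suc n" for j
    using orth that by (cases "j = n") auto
  have y'_eq: "y' = (\<lambda>z. x z - (\<Sum>i<Suc n. (if i = n then \<alpha> else c i - \<alpha> * d i) * k i z))"
  proof
    fix z
    have "(\<Sum>i<n. (if i = n then \<alpha> else c i - \<alpha> * d i) * k i z)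
        = (\<Sum>i<n. c i * k i z) - \<alpha> * (\<Sum>i<n. d i * k i z)"
      unfolding sum_distrib_left sum_subtractf[symmetric]
      by (intro sum.cong refl) (simp add: left_diff_distrib)
    then show "y' z = x z - (\<Sum>i<Suc n. (if i = n then \<alpha> else c i - \<alpha> * d i) * k i z)"
      by (simp add: y'_def y_def u_def s_def right_diff_distrib)
  qed
  show ?case
    by (rule exI[of _ "\<lambda>i. if i = n then \<alpha> else c i - \<alpha> * d i"])
       (use orth' in \<open>simp only: y'_eq[symmetric]\<close>, blast)
qed

text \<open>
  Let \<open>X\<^sub>n\<close> be the orthonormal sequence obtained from the eigenvectors. The spans of
  the first \<open>n\<close> eigenvectors are invariant under \<open>T\<close>, so \<open>T X\<^sub>m\<close> is orthogonal to
  \<open>X\<^sub>n\<close> for \<open>m < n\<close>, while \<open>\<langle>T X\<^sub>n, X\<^sub>n\<rangle> = \<mu>\<^sub>n\<close>. Hence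
  \<open>\<parallel>T X\<^sub>n - T X\<^sub>m\<parallel> \<ge> \<bar>\<mu>\<^sub>n\<bar> \<ge> \<delta>\<close>, and no subsequence of \<open>T X\<^sub>n\<close> converges.
\<close>

lemma not_compact_if_eigenvalues_away_from_0:
  fixes k :: "nat \<Rightarrow> complex \<Rightarrow> complex" and \<mu> :: "nat \<Rightarrow> complex"
  assumes k: "\<And>i. k i \<in> H"
    and indep: "\<And>n c. k n \<noteq> (\<lambda>z. \<Sum>i<n. c i * k i z)"
    and eigen: "\<And>i. T (k i) = (\<lambda>z. \<mu> i * k i z)"
    and \<mu>: "\<And>i. \<delta> \<le> norm (\<mu> i)" "0 < \<delta>"
  shows "\<not> compact_operator_on H ip T"
proof
  assume compact: "compact_operator_on H ip T"
  have TH: "T f \<in> H" if "f \<in> H" for f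
    using compact that by (simp add: compact_operator_on_def)
  have Tadd: "T (\<lambda>z. f z + g z) = (\<lambda>z. T f z + T g z)" if "f \<in> H" "g \<in> H" for f g
    using compact that by (simp add: compact_operator_on_def)
  have Tscale: "T (\<lambda>z. c * f z) = (\<lambda>z. c * T f z)" if "f \<in> H" for f c
    using compact that by (simp add: compact_operator_on_def)
  have Tsum: "T (\<lambda>z. \<Sum>i<n. a i * k i z) = (\<lambda>z. \<Sum>i<n. a i * (\<mu> i * k i z))" for n a
  proof (induction n)
    case 0
    show ?case using Tscale[OF zero_mem, of 0] by simp
  next
    case (Suc n)
    have "(\<lambda>z. \<Sum>i<n. a i * k i z) \<in> H" by (intro sum_mem k)
    from Tadd[OF this scale_mem[OF k, of "a n" n]] show ?case
      using Suc by (simp add: Tscale[OF k] eigen)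
  qed
  have "\<exists>c. \<forall>j<n. ip (\<lambda>z. k n z - (\<Sum>i<n. c i * k i z)) (k j) = 0" for n
    by (rule orthogonal_residual[OF k k])
  from choice[OF allI, OF this] obtain c
    where "\<forall>n. \<forall>j<n. ip (\<lambda>z. k n z - (\<Sum>i<n. c n i * k i z)) (k j) = 0"
    by (rule exE)
  then have c: "ip (\<lambda>z. k n z - (\<Sum>i<n. c n i * k i z)) (k j) = 0" if "j < n" for n j
    using that by simp
  define e where "e n = (\<lambda>z. k n z - (\<Sum>i<n. c n i * k i z))" for n
  have eH: "e n \<in> H" for n unfolding e_def by (intro diff_mem sum_mem k)
  have e_orth: "ip (e n) (k j) = 0" if "j < n" for n j
    using c[OF that] by (simp add: e_def)
  have e_orth': "ip (k j) (e n) = 0" if "j < n" for n j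
    using ip_cnj[OF eH[of n] k[of j]] e_orth[OF that] by simp
  define N where "N n = ip_norm ip (e n)" for n
  have N2: "ip (e n) (e n) = of_real ((N n)\<^sup>2)" for n
    using ip_self_real[OF eH] ip_nonneg[OF eH] by (simp add: N_def ip_norm_def)
  have N: "0 < N n" for n
  proof (rule ccontr)
    assume "\<not> 0 < N n"
    then have "N n = 0" using ip_nonneg[OF eH[of n]] by (simp add: N_def ip_norm_def)
    then have "e n = (\<lambda>z. 0)" using N2[of n] ip_definite[OF eH] by simp
    then have "k n = (\<lambda>z. \<Sum>i<n. c n i * k i z)"
      unfolding e_def by (metis (no_types, lifting) eq_iff_diff_eq_0)
    then show False using indep by blast
  qed
  define s where "s n = complex_of_real (1 / N n)" for n
  define X where "X n = (\<lambda>z. s n * e n z)" for n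
  have XH: "X n \<in> H" for n unfolding X_def by (intro scale_mem eH)
  have X1: "ip_norm ip (X n) = 1" for n
  proof -
    have "ip (X n) (X n) = s n * (cnj (s n) * ip (e n) (e n))"
      unfolding X_def by (simp add: ip_scale ip_scale_right scale_mem eH)
    also have "\<dots> = 1" using N[of n] by (simp add: N2 s_def power2_eq_square)
    finally show ?thesis by (simp add: ip_norm_def)
  qed
  have kX: "ip (k j) (X n) = 0" if "j < n" for j n
    unfolding X_def using e_orth'[OF that] by (simp add: ip_scale_right eH k)
  define a where "a n i = (if i = n then 1 else - c n i) * s n" for n i
  have X_sum: "X n = (\<lambda>z. \<Sum>i<Suc n. a n i * k i z)" for n
  proof
    fix z
    have "(\<Sum>i<n. a n i * k i z) = - s n * (\<Sum>i<n. c n i * k i z)"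
      unfolding sum_distrib_left by (intro sum.cong refl) (simp add: a_def)
    then show "X n z = (\<Sum>i<Suc n. a n i * k i z)"
      by (simp add: X_def e_def a_def right_diff_distrib)
  qed
  have TX: "T (X n) = (\<lambda>z. \<Sum>i<Suc n. (a n i * \<mu> i) * k i z)" for n
    unfolding X_sum Tsum by (simp add: mult.assoc)
  have ip_TX: "ip (T (X n)) (X m) = (\<Sum>i<Suc n. (a n i * \<mu> i) * ip (k i) (X m))" for n m
    unfolding TX by (rule ip_sum_left[OF k XH])
  have off: "ip (T (X m)) (X n) = 0" if "m < n" for m n
    unfolding ip_TX using that by (intro sum.neutral) (auto intro!: kX)
  have diag: "ip (T (X n)) (X n) = \<mu> n" for n
  proof -
    have "ip (X n) (X n) = ip (\<lambda>z. \<Sum>i<Suc n. a n i * k i z) (X n)"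
      by (rule arg_cong[OF X_sum, of "\<lambda>x. ip x (X n)"])
    also have "\<dots> = (\<Sum>i<Suc n. a n i * ip (k i) (X n))"
      by (rule ip_sum_left[OF k XH])
    also have "\<dots> = a n n * ip (k n) (X n)" using kX[of _ n] by simp
    finally have "a n n * ip (k n) (X n) = 1"
      using X1[of n] ip_self_real[OF XH, of n] by (simp add: ip_norm_def)
    moreover have "ip (T (X n)) (X n) = \<mu> n * (a n n * ip (k n) (X n))"
      unfolding ip_TX using kX[of _ n] by (simp add: mult_ac)
    ultimately show ?thesis by simp
  qed
  have "(\<forall>n. X n \<in> H) \<and> (\<exists>C. \<forall>n. ip_norm ip (X n) \<le> C)"
    using XH X1 by (auto intro!: exI[of _ 1])
  then obtain r g where r: "strict_mono (r :: nat \<Rightarrow> nat)" and g: "g \<in> H"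
    and lim: "(\<lambda>n. ip_norm ip (\<lambda>z. T (X (r n)) z - g z)) \<longlonglongrightarrow> 0"
    using compact unfolding compact_operator_on_def by blast
  obtain M where M: "\<And>n. M \<le> n \<Longrightarrow> ip_norm ip (\<lambda>z. T (X (r n)) z - g z) < \<delta> / 2"
    using order_tendstoD(2)[OF lim, of "\<delta> / 2"] \<mu>(2) by (auto simp: eventually_sequentially)
  define p where "p = r M"
  define q where "q = r (Suc M)"
  have pq: "p < q" using r by (simp add: p_def q_def strict_mono_Suc_iff)
  have small: "norm (ip (\<lambda>z. T (X i) z - g z) (X q)) < \<delta> / 2"
    if "ip_norm ip (\<lambda>z. T (X i) z - g z) < \<delta> / 2" for i
    using Cauchy_Schwarz[OF diff_mem[OF TH[OF XH] g] XH, of i q] X1[of q] that by simp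
  have "\<mu> q = ip (\<lambda>z. T (X q) z - g z) (X q) - ip (\<lambda>z. T (X p) z - g z) (X q)"
    by (simp add: ip_diff_left TH XH g diag off[OF pq])
  then have "norm (\<mu> q) \<le> norm (ip (\<lambda>z. T (X q) z - g z) (X q)) + norm (ip (\<lambda>z. T (X p) z - g z) (X q))"
    by (metis norm_triangle_ineq4)
  also have "\<dots> < \<delta> / 2 + \<delta> / 2"
    using M[of M] M[of "Suc M"] by (intro add_strict_mono small) (auto simp: p_def q_def)
  finally show False using \<mu>(1)[of q] by simp
qed

end

text \<open>
  Pair a linear relation with a polynomial that vanishes at all nodes but the last one.
\<close>

lemma szego_kernels_independent:
  fixes l :: "nat \<Rightarrow> complex"
  assumes "inj l" and l: "\<And>i. norm (l i) < 1"
  shows "szego_kernel (l n) \<noteq> (\<lambda>z. \<Sum>i<n. c i * szego_kernel (l i) z)"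
proof
  assume eq: "szego_kernel (l n) = (\<lambda>z. \<Sum>i<n. c i * szego_kernel (l i) z)"
  define d where "d i = (if i = n then -1 else c i)" for i
  define S where "S = l ` {..n}"
  define d' where "d' w = d (inv l w)" for w
  have S: "finite S" "S \<subseteq> unit_disc" using l by (auto simp: S_def)
  have sumS: "(\<Sum>w\<in>S. f w) = (\<Sum>i\<le>n. f (l i))" for f :: "complex \<Rightarrow> complex"
    unfolding S_def by (rule sum.reindex_cong[of l]) (use assms(1) in \<open>auto intro: inj_on_subset\<close>)
  have d': "d' (l i) = d i" for i using assms(1) by (simp add: d'_def)
  define F where "F z = (\<Sum>w\<in>S. d' w / (1 - cnj w * z))" for z
  have F_disc: "F z = 0" if "z \<in> ball 0 1" for z
  proof -
    have "F z = (\<Sum>i<n. c i / (1 - cnj (l i) * z)) - 1 / (1 - cnj (l n) * z)"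
      unfolding F_def sumS d' by (simp add: d_def lessThan_Suc_atMost[symmetric])
    also have "\<dots> = 0" using fun_cong[OF eq, of z] that by (simp add: szego_kernel_def)
    finally show ?thesis .
  qed
  have F_circle: "F \<zeta> = 0" if "norm \<zeta> = 1" for \<zeta>
  proof (rule continuous_constant_on_closure[where S="ball 0 1" and f=F and x=\<zeta>])
    have "F analytic_on cball 0 1" unfolding F_def by (rule szego_sum_analytic[OF S])
    then show "continuous_on (closure (ball 0 1)) F"
      using analytic_imp_holomorphic holomorphic_on_imp_continuous_on by fastforce
  qed (use F_disc that in auto)
  define X where "X z = (\<Prod>i<n. z - l i)" for z
  have [measurable]: "X \<in> borel_measurable borel" unfolding X_def by measurable
  have X: "X analytic_on cball 0 1" unfolding X_def by (intro analytic_intros)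
  have [measurable]: "F \<in> borel_measurable borel" unfolding F_def by measurable
  have "(\<Sum>w\<in>S. cnj (d' w) * X w) = (\<integral>\<zeta>. X \<zeta> * cnj (F \<zeta>) \<partial>circle_measure)"
    unfolding F_def by (rule szego_sum_pairing[OF _ X S, symmetric]) measurable
  also have "\<dots> = (\<integral>\<zeta>. 0 \<partial>circle_measure)"
    by (rule circle_integral_cong) (use F_circle in auto)
  finally have "(\<Sum>i\<le>n. cnj (d i) * X (l i)) = 0" unfolding sumS d' by simp
  moreover have "X (l i) = 0" if "i < n" for i using that by (auto simp: X_def)
  ultimately have "X (l n) = 0" by (simp add: d_def lessThan_Suc_atMost[symmetric])
  then show False using assms(1) by (auto simp: X_def inj_eq)
qed

section \<open>Non-extreme functions\<close>

lemma Hinf_ball_norm_le: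
  assumes "f \<in> Hinf_ball" "norm z < 1"
  shows "norm (f z) \<le> 1"
proof -
  have "bounded (f ` unit_disc)" using assms by (simp add: Hinf_ball_def Hinf_def)
  then have "bdd_above ((\<lambda>z. norm (f z)) ` unit_disc)"
    unfolding bounded_iff bdd_above_def by auto
  then have "norm (f z) \<le> Hinf_norm f"
    unfolding Hinf_norm_def using assms(2) by (intro cSUP_upper) auto
  then show ?thesis using assms(1) by (simp add: Hinf_ball_def)
qed

text \<open>
  If \<open>b\<close> lies inside the segment from \<open>f\<close> to \<open>g\<close>, then a small multiple \<open>h\<close> of
  \<open>f - g\<close> keeps both \<open>b + h\<close> and \<open>b - h\<close> on the segment. Averaging \<open>\<bar>b + h\<bar>\<^sup>2 \<le> 1\<close> and
  \<open>\<bar>b - h\<bar>\<^sup>2 \<le> 1\<close> gives the bound.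
\<close>

lemma non_extreme_companion:
  assumes b: "b \<in> Hinf_ball" and ne: "\<not> extreme_in_Hinf_ball b"
  obtains h where "h \<in> disc_analytic" "h \<noteq> (\<lambda>z. 0)"
    "\<And>z. norm z < 1 \<Longrightarrow> (norm (b z))\<^sup>2 + (norm (h z))\<^sup>2 \<le> 1"
proof -
  obtain f g u where fg: "f \<in> Hinf_ball" "g \<in> Hinf_ball" "f \<noteq> g" and u: "0 < u" "u < 1"
    and beq: "b = (\<lambda>z. complex_of_real (1 - u) * f z + complex_of_real u * g z)"
    using assms unfolding extreme_in_Hinf_ball_def by blast
  define t where "t = min u (1 - u)"
  have t: "0 < t" "t \<le> u" "t \<le> 1 - u" using u by (auto simp: t_def)
  define h where "h z = of_real t * (f z - g z)" for z
  have "h \<in> disc_analytic"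
    using fg unfolding h_def Hinf_ball_def Hinf_def disc_analytic_def
    by (auto intro!: holomorphic_intros)
  moreover have "h \<noteq> (\<lambda>z. 0)"
  proof
    assume "h = (\<lambda>z. 0)"
    then have "of_real t * (f z - g z) = 0" for z unfolding h_def by (rule fun_cong)
    then have "f z = g z" for z using t(1) by simp
    then show False using fg(3) by blast
  qed
  moreover have "(norm (b z))\<^sup>2 + (norm (h z))\<^sup>2 \<le> 1" if z: "norm z < 1" for z
  proof -
    have convex: "norm (of_real x * f z + of_real y * g z) \<le> 1" if "0 \<le> x" "0 \<le> y" "x + y = 1" for x y
    proof -
      have "norm (of_real x * f z + of_real y * g z) \<le> x * norm (f z) + y * norm (g z)"
        by (rule order_trans[OF norm_triangle_ineq]) (use that in \<open>simp add: norm_mult\<close>)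
      also have "\<dots> \<le> x * 1 + y * 1"
        using fg that z by (intro add_mono mult_left_mono Hinf_ball_norm_le)
      finally show ?thesis using that by simp
    qed
    have "b z + h z = of_real (1 - u + t) * f z + of_real (u - t) * g z"
      "b z - h z = of_real (1 - u - t) * f z + of_real (u + t) * g z"
      unfolding beq h_def by (simp_all add: algebra_simps)
    then have "norm (b z + h z) \<le> 1" "norm (b z - h z) \<le> 1"
      using convex[of "1 - u + t" "u - t"] convex[of "1 - u - t" "u + t"] t u by simp_all
    then have "(norm (b z + h z))\<^sup>2 \<le> 1" "(norm (b z - h z))\<^sup>2 \<le> 1"
      by (simp_all add: power_le_one)
    moreover have "(norm (b z + h z))\<^sup>2 + (norm (b z - h z))\<^sup>2 = 2 * (norm (b z))\<^sup>2 + 2 * (norm (h z))\<^sup>2"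
      unfolding cmod_power2 by (simp add: power2_eq_square algebra_simps)
    ultimately show ?thesis by simp
  qed
  ultimately show ?thesis by (rule that)
qed

text \<open>
  By analytic continuation the product of the two functions is nonzero at some point; near it, by
  continuity, \<open>\<bar>\<phi>\<bar>\<close> stays above half of its value there.
\<close>

lemma common_nonzero_points:
  assumes \<phi>: "\<phi> \<in> disc_analytic" "\<phi> \<noteq> (\<lambda>z. 0)" and h: "h \<in> disc_analytic" "h \<noteq> (\<lambda>z. 0)"
  obtains l :: "nat \<Rightarrow> complex" and \<delta> where "inj l" "0 < \<delta>"
    "\<And>i. norm (l i) < 1" "\<And>i. h (l i) \<noteq> 0" "\<And>i. \<delta> \<le> norm (\<phi> (l i))"
proof -
  have hol: "\<phi> holomorphic_on ball 0 1" "h holomorphic_on ball 0 1"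
    using \<phi> h by (auto simp: disc_analytic_def)
  then have cont: "continuous_on (ball 0 1) \<phi>" "continuous_on (ball 0 1) h"
    by (auto intro: holomorphic_on_imp_continuous_on)
  obtain z0 where z0: "\<phi> z0 \<noteq> 0" using \<phi>(2) by blast
  have z0d: "z0 \<in> ball 0 1" using z0 \<phi>(1) by (auto simp: disc_analytic_def)
  define U where "U = {z \<in> ball 0 1. \<phi> z \<noteq> 0}"
  have U: "open U"
    unfolding U_def using continuous_open_preimage[OF cont(1) open_ball, of "- {0}"]
    by (simp add: vimage_def Int_def open_Compl)
  have "\<exists>z\<in>U. h z \<noteq> 0"
  proof (rule ccontr)
    assume "\<not> (\<exists>z\<in>U. h z \<noteq> 0)"
    then have zero: "\<And>z. z \<in> U \<Longrightarrow> h z = 0" by blast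
    have "h w = 0" if "w \<in> ball 0 1" for w
    proof (rule analytic_continuation_open[of U "ball 0 1" h "\<lambda>_. 0"])
      show "U \<noteq> {}" using z0 z0d by (auto simp: U_def)
    qed (use U zero that hol in \<open>auto simp: U_def\<close>)
    then have "h = (\<lambda>z. 0)" using h(1) by (auto simp: disc_analytic_def fun_eq_iff)
    then show False using h(2) by blast
  qed
  then obtain w where w: "w \<in> ball 0 1" "\<phi> w \<noteq> 0" "h w \<noteq> 0" by (auto simp: U_def)
  define \<delta> where "\<delta> = norm (\<phi> w) / 2"
  define W where "W = {z \<in> ball 0 1. \<delta> < norm (\<phi> z)} \<inter> {z \<in> ball 0 1. h z \<noteq> 0}"
  have "open {z \<in> ball 0 1. \<delta> < norm (\<phi> z)}"
    using continuous_open_preimage[OF continuous_on_norm[OF cont(1)] open_ball, of "{\<delta><..}"]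
    by (simp add: vimage_def Int_def)
  moreover have "open {z \<in> ball 0 1. h z \<noteq> 0}"
    using continuous_open_preimage[OF cont(2) open_ball, of "- {0}"]
    by (simp add: vimage_def Int_def open_Compl)
  ultimately have "open W" unfolding W_def by (rule open_Int)
  moreover have "w \<in> W" using w by (simp add: W_def \<delta>_def)
  ultimately have "infinite W"
    using finite_imp_not_open by blast
  then obtain l :: "nat \<Rightarrow> complex" where l: "inj l" "range l \<subseteq> W"
    using infinite_countable_subset by blast
  have "l i \<in> W" for i using l(2) by blast
  then show ?thesis
    using w l(1) by (intro that[of l \<delta>]) (auto simp: W_def \<delta>_def less_imp_le)
qed

theorem theorem3p1:
  fixes b \<phi> :: "complex \<Rightarrow> complex"
    and H :: "(complex \<Rightarrow> complex) set"
    and ip :: "(complex \<Rightarrow> complex) \<Rightarrow> (complex \<Rightarrow> complex) \<Rightarrow> complex"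
  assumes "b \<in> Hinf_ball"
    and "\<not> extreme_in_Hinf_ball b"
    and "de_Branges_Rovnyak_space b H ip"
    and "\<phi> \<in> Hinf"
  shows "compact_operator_on H ip (conj_toeplitz \<phi>) \<longleftrightarrow> \<phi> = (\<lambda>z. 0)"
proof
  interpret analytic_hilbert_space H ip
    using assms(3) by (simp add: de_Branges_Rovnyak_space_def)
  show "\<phi> = (\<lambda>z. 0)" if compact: "compact_operator_on H ip (conj_toeplitz \<phi>)"
  proof (rule ccontr)
    assume \<phi>: "\<phi> \<noteq> (\<lambda>z. 0)"
    obtain h where h: "h \<in> disc_analytic" "h \<noteq> (\<lambda>z. 0)"
      "\<And>z. norm z < 1 \<Longrightarrow> (norm (b z))\<^sup>2 + (norm (h z))\<^sup>2 \<le> 1"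
      using non_extreme_companion[OF assms(1,2)] by blast
    have d: "b \<in> disc_analytic" "\<phi> \<in> disc_analytic"
      using assms(1,4) by (auto simp: Hinf_ball_def Hinf_def)
    obtain l \<delta> where l: "inj (l :: nat \<Rightarrow> complex)" "0 < \<delta>"
      "\<And>i. norm (l i) < 1" "\<And>i. h (l i) \<noteq> 0" "\<And>i. \<delta> \<le> norm (\<phi> (l i))"
      using common_nonzero_points[OF d(2) \<phi> h(1,2)] by blast
    have "\<not> compact_operator_on H ip (conj_toeplitz \<phi>)"
    proof (rule not_compact_if_eigenvalues_away_from_0[where k="\<lambda>i. szego_kernel (l i)"])
      show "szego_kernel (l i) \<in> H" for i
        by (rule szego_kernel_mem_dBR[OF assms(3) d(1) h(1,3) l(3,4)])
      show "szego_kernel (l n) \<noteq> (\<lambda>z. \<Sum>i<n. c i * szego_kernel (l i) z)" for n c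
        by (rule szego_kernels_independent[OF l(1,3)])
      show "conj_toeplitz \<phi> (szego_kernel (l i)) = (\<lambda>z. cnj (\<phi> (l i)) * szego_kernel (l i) z)" for i
        by (rule conj_toeplitz_szego_kernel[OF assms(4) l(3)])
    qed (use l in auto)
    then show False using compact by blast
  qed
  show "compact_operator_on H ip (conj_toeplitz \<phi>)" if "\<phi> = (\<lambda>z. 0)"
    unfolding compact_operator_on_def that conj_toeplitz_zero_symbol
  proof (intro conjI ballI allI impI)
    fix X :: "nat \<Rightarrow> complex \<Rightarrow> complex"
    have "strict_mono (id :: nat \<Rightarrow> nat)" by (simp add: strict_mono_def)
    moreover have "(\<lambda>n. ip_norm ip (\<lambda>z. 0 - 0)) \<longlonglongrightarrow> 0"
      using zero_mem by (simp add: ip_norm_def ip_zero_left)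
    ultimately show "\<exists>(r :: nat \<Rightarrow> nat) g. strict_mono r \<and> g \<in> H \<and>
        (\<lambda>n. ip_norm ip (\<lambda>z. 0 - g z)) \<longlonglongrightarrow> 0"
      using zero_mem by (intro exI[of _ id] exI[of _ "\<lambda>z. 0"] conjI) auto
  qed (simp_all add: zero_mem)
qed

end
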